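(* Let $G$ be a tame $\ell_c$-group. For any compact open subgroup $K\subset G$ and any irreducible smooth representation $\rho\in\widehat{K}$, put $$\mathscr{V}(K,\rho)=\{\pi\in\widehat{G} \mid \operatorname{Hom}_K(\pi|_K,\rho)\neq 0\}.$$ Then the sets $\mathscr{V}(K,\rho)$ (over all such pairs $(K,\rho)$) are open and form a basis for the Fell topology on $\widehat{G}$, meaning that every open set in $\widehat{G}$ is a union of sets of the form $\mathscr{V}(K,\rho)$.
   Context: An $\ell$-group is a Hausdorff, locally compact, totally disconnected topological group. An $\ell_c$-group is an $\ell$-group which is a filtered union of its compact open subgroups (every element lies in a compact open subgroup, and any two compact open subgroups are contained in a third). A complex representation $(\pi,V)$ of an $\ell$-group $G$ is smooth if every vector of $V$ has open stabilizer in $G$; it is admissible if in addition $V^K$ is finite-dimensional for every compact open subgroup $K \subset G$. An $\ell$-group is tame if all its irreducible smooth representations are admissible. $\widehat{G}$ is the set of isomorphism classes of irreducible smooth representations of $G$ (and similarly $\widehat{K}$ for $K$). Fell topology on $\widehat{G}$: for a smooth representation $V$ let $V^{\vee}$ be its smooth dual (the vectors of the linear dual $V^*$ with open stabilizer). For $(\pi,V)\in\widehat{G}$, vectors $v_1,\dots,v_n\in V$, $\xi_1,\dots,\xi_n\in V^{\vee}$, a compact subset $B\subset G$ and $\epsilon>0$, let $\mathscr{U}(\pi,v_j,\xi_j,B,\epsilon)$ be the set of $(\rho,X)\in\widehat{G}$ for which there exist $w_1,\dots,w_n\in X$ and $\zeta_1,\dots,\zeta_n\in X^{\vee}$ with $|\langle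 \xi_j,\pi(g)v_j\rangle-\langle\zeta_j,\rho(g)w_j\rangle|<\epsilon$ for all $1\le j\le n$ and $g\in B$. These sets form a basis of neighborhoods of $\pi$ in the Fell topology (so a subset $O\subset\widehat{G}$ is open iff for every $\pi\in O$ it contains some $\mathscr{U}(\pi,v_j,\xi_j,B,\epsilon)$). *)

theory Defs
  imports "HOL-Analysis.Analysis" "HOL-Algebra.Coset" "HOL-Library.Function_Algebras"
begin

section \<open>Complex vector spaces\<close>

class complex_vector = ab_group_add +
  fixes scaleC :: "complex \<Rightarrow> 'a \<Rightarrow> 'a"  (infixr \<open>*\<^sub>C\<close> 75)
  assumes scaleC_add_right: "a *\<^sub>C (x + y) = a *\<^sub>C x + a *\<^sub>C y"
    and scaleC_add_left: "(a + b) *\<^sub>C x = a *\<^sub>C x + b *\<^sub>C x"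
    and scaleC_scaleC: "a *\<^sub>C b *\<^sub>C x = (a * b) *\<^sub>C x"
    and scaleC_one: "1 *\<^sub>C x = x"

instantiation complex :: complex_vector
begin

definition complex_scaleC_def [simp]: "(a::complex) *\<^sub>C x = a * x"

instance
  by standard (simp_all add: algebra_simps)

end

instantiation "fun" :: (type, complex_vector) complex_vector
begin

definition fun_scaleC_def: "a *\<^sub>C f = (\<lambda>x. a *\<^sub>C f x)"

instance
  by standard
    (simp_all add: fun_scaleC_def fun_eq_iff scaleC_add_right scaleC_add_left scaleC_scaleC scaleC_one)

end

global_interpretation cvs: vector_space "scaleC :: complex \<Rightarrow> 'a \<Rightarrow> 'a :: complex_vector"
  by unfold_locales (simp_all add: scaleC_add_right scaleC_add_left scaleC_scaleC scaleC_one)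

global_interpretation cvs: vector_space_pair
  "scaleC :: complex \<Rightarrow> 'a \<Rightarrow> 'a :: complex_vector" "scaleC :: complex \<Rightarrow> 'b \<Rightarrow> 'b :: complex_vector"
  by unfold_locales

definition linear_map_on ::
  "'v::complex_vector set \<Rightarrow> 'w::complex_vector set \<Rightarrow> ('v \<Rightarrow> 'w) \<Rightarrow> bool" where
  "linear_map_on V W f \<longleftrightarrow>
     f ` V \<subseteq> W \<and>
     (\<forall>x\<in>V. \<forall>y\<in>V. f (x + y) = f x + f y) \<and>
     (\<forall>c. \<forall>x\<in>V. f (c *\<^sub>C x) = c *\<^sub>C f x)"

definition finite_dimensional :: "'v::complex_vector set \<Rightarrow> bool" where
  "finite_dimensional W \<longleftrightarrow> (\<exists>B. finite B \<and> cvs.span B = W)"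


section \<open>Totally disconnected locally compact groups\<close>

definition topological_group :: "('g, 'b) monoid_scheme \<Rightarrow> 'g topology \<Rightarrow> bool" where
  "topological_group G T \<longleftrightarrow>
     group G \<and> topspace T = carrier G \<and>
     continuous_map (prod_topology T T) T (\<lambda>(x, y). x \<otimes>\<^bsub>G\<^esub> y) \<and>
     continuous_map T T (\<lambda>x. inv\<^bsub>G\<^esub> x)"

definition totally_disconnected :: "'a topology \<Rightarrow> bool" where
  "totally_disconnected T \<longleftrightarrow> (\<forall>S. connectedin T S \<longrightarrow> (\<exists>a. S \<subseteq> {a}))"

definition l_group :: "('g, 'b) monoid_scheme \<Rightarrow> 'g topology \<Rightarrow> bool" where
  "l_group G T \<longleftrightarrow>
     topological_group G T \<and> Hausdorff_space T \<and> locally_compact_space T \<and> totally_disconnected T"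

definition compact_open_subgroup ::
  "('g, 'b) monoid_scheme \<Rightarrow> 'g topology \<Rightarrow> 'g set \<Rightarrow> bool" where
  "compact_open_subgroup G T K \<longleftrightarrow> subgroup K G \<and> compactin T K \<and> openin T K"

definition lc_group :: "('g, 'b) monoid_scheme \<Rightarrow> 'g topology \<Rightarrow> bool" where
  "lc_group G T \<longleftrightarrow>
     l_group G T \<and>
     (\<forall>g\<in>carrier G. \<exists>K. compact_open_subgroup G T K \<and> g \<in> K) \<and>
     (\<forall>K L. compact_open_subgroup G T K \<and> compact_open_subgroup G T L \<longrightarrow>
        (\<exists>M. compact_open_subgroup G T M \<and> K \<union> L \<subseteq> M))"


section \<open>Smooth representations\<close>

text \<open>
  A representation has as its space a complex subspace of an ambient complex vector space. The
  values of \<open>action \<pi> g\<close> outside \<open>vspace \<pi>\<close>, or for \<open>g\<close> outside the group, are irrelevant; in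
  particular the restriction of \<open>\<pi>\<close> to a subgroup \<open>K\<close> is \<open>\<pi>\<close> itself, regarded as a
  representation of \<open>G\<lparr>carrier := K\<rparr>\<close>.
\<close>

record ('g, 'v) crep =
  vspace :: "'v set"
  action :: "'g \<Rightarrow> 'v \<Rightarrow> 'v"

definition group_rep ::
  "('g, 'b) monoid_scheme \<Rightarrow> ('g, 'v::complex_vector) crep \<Rightarrow> bool" where
  "group_rep G \<pi> \<longleftrightarrow>
     cvs.subspace (vspace \<pi>) \<and>
     (\<forall>g\<in>carrier G. linear_map_on (vspace \<pi>) (vspace \<pi>) (action \<pi> g)) \<and>
     (\<forall>v\<in>vspace \<pi>. action \<pi> \<one>\<^bsub>G\<^esub> v = v) \<and>
     (\<forall>g\<in>carrier G. \<forall>h\<in>carrier G. \<forall>v\<in>vspace \<pi>.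
        action \<pi> (g \<otimes>\<^bsub>G\<^esub> h) v = action \<pi> g (action \<pi> h v))"

definition smooth_rep ::
  "('g, 'b) monoid_scheme \<Rightarrow> 'g topology \<Rightarrow> ('g, 'v::complex_vector) crep \<Rightarrow> bool" where
  "smooth_rep G T \<pi> \<longleftrightarrow>
     group_rep G \<pi> \<and> (\<forall>v\<in>vspace \<pi>. openin T {g \<in> carrier G. action \<pi> g v = v})"

definition irreducible_rep ::
  "('g, 'b) monoid_scheme \<Rightarrow> ('g, 'v::complex_vector) crep \<Rightarrow> bool" where
  "irreducible_rep G \<pi> \<longleftrightarrow>
     group_rep G \<pi> \<and> vspace \<pi> \<noteq> {0} \<and>
     (\<forall>W. cvs.subspace W \<and> W \<subseteq> vspace \<pi> \<and> (\<forall>g\<in>carrier G. action \<pi> g ` W \<subseteq> W) \<longrightarrow>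
        W = {0} \<or> W = vspace \<pi>)"

definition irreducible_smooth ::
  "('g, 'b) monoid_scheme \<Rightarrow> 'g topology \<Rightarrow> ('g, 'v::complex_vector) crep \<Rightarrow> bool" where
  "irreducible_smooth G T \<pi> \<longleftrightarrow> smooth_rep G T \<pi> \<and> irreducible_rep G \<pi>"

definition fixed_vectors :: "'g set \<Rightarrow> ('g, 'v) crep \<Rightarrow> 'v set" where
  "fixed_vectors K \<pi> = {v \<in> vspace \<pi>. \<forall>k\<in>K. action \<pi> k v = v}"

definition admissible ::
  "('g, 'b) monoid_scheme \<Rightarrow> 'g topology \<Rightarrow> ('g, 'v::complex_vector) crep \<Rightarrow> bool" where
  "admissible G T \<pi> \<longleftrightarrow>
     smooth_rep G T \<pi> \<and>
     (\<forall>K. compact_open_subgroup G T K \<longrightarrow> finite_dimensional (fixed_vectors K \<pi>))"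

text \<open>
  Linear maps defined on the space of a representation are extended by 0 to the ambient type, so
  that each of them is represented by exactly one function.
\<close>

definition Hom_rep ::
  "'g set \<Rightarrow> ('g, 'v::complex_vector) crep \<Rightarrow> ('g, 'w::complex_vector) crep \<Rightarrow> ('v \<Rightarrow> 'w) set" where
  "Hom_rep K \<pi> \<rho> =
     {f. linear_map_on (vspace \<pi>) (vspace \<rho>) f \<and> (\<forall>v. v \<notin> vspace \<pi> \<longrightarrow> f v = 0) \<and>
         (\<forall>k\<in>K. \<forall>v\<in>vspace \<pi>. f (action \<pi> k v) = action \<rho> k (f v))}"

definition isomorphic_reps ::
  "('g, 'b) monoid_scheme \<Rightarrow> ('g, 'v::complex_vector) crep \<Rightarrow> ('g, 'w::complex_vector) crep \<Rightarrow> bool" where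
  "isomorphic_reps G \<pi> \<rho> \<longleftrightarrow>
     (\<exists>f\<in>Hom_rep (carrier G) \<pi> \<rho>. bij_betw f (vspace \<pi>) (vspace \<rho>))"

definition dual_action ::
  "('g, 'b) monoid_scheme \<Rightarrow> ('g, 'v::complex_vector) crep \<Rightarrow> 'g \<Rightarrow> ('v \<Rightarrow> complex) \<Rightarrow> ('v \<Rightarrow> complex)" where
  "dual_action G \<pi> g \<xi> = (\<lambda>v. if v \<in> vspace \<pi> then \<xi> (action \<pi> (inv\<^bsub>G\<^esub> g) v) else 0)"

definition smooth_dual ::
  "('g, 'b) monoid_scheme \<Rightarrow> 'g topology \<Rightarrow> ('g, 'v::complex_vector) crep \<Rightarrow> ('v \<Rightarrow> complex) set" where
  "smooth_dual G T \<pi> =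
     {\<xi>. linear_map_on (vspace \<pi>) UNIV \<xi> \<and> (\<forall>v. v \<notin> vspace \<pi> \<longrightarrow> \<xi> v = 0) \<and>
         openin T {g \<in> carrier G. dual_action G \<pi> g \<xi> = \<xi>}}"


section \<open>Isomorphism classes of irreducible smooth representations\<close>

text \<open>
  Isomorphism classes are taken among the irreducible smooth representations on subspaces of the
  space of all functions from the type of group elements to the complex numbers. The lemma
  \<open>irreducible_smooth_universe\<close> below shows that every irreducible smooth representation, on a
  subspace of any complex vector space whatsoever, is isomorphic to one of these, so that no
  isomorphism class is lost. This also applies to representations of a subgroup.
\<close>

type_synonym 'g frep = "('g, 'g \<Rightarrow> complex) crep"

definition irr_iso_rel ::
  "('g, 'b) monoid_scheme \<Rightarrow> 'g topology \<Rightarrow> ('g frep \<times> 'g frep) set" where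
  "irr_iso_rel G T =
     {(\<pi>, \<rho>). irreducible_smooth G T \<pi> \<and> irreducible_smooth G T \<rho> \<and> isomorphic_reps G \<pi> \<rho>}"

definition irr_classes :: "('g, 'b) monoid_scheme \<Rightarrow> 'g topology \<Rightarrow> 'g frep set set" where
  "irr_classes G T = {\<pi>. irreducible_smooth G T \<pi>} // irr_iso_rel G T"

definition tame :: "('g, 'b) monoid_scheme \<Rightarrow> 'g topology \<Rightarrow> bool" where
  "tame G T \<longleftrightarrow> (\<forall>\<pi> :: 'g frep. irreducible_smooth G T \<pi> \<longrightarrow> admissible G T \<pi>)"


section \<open>The Fell topology\<close>

definition fell_nbhd ::
  "('g, 'b) monoid_scheme \<Rightarrow> 'g topology \<Rightarrow> 'g frep \<Rightarrow> nat \<Rightarrow> (nat \<Rightarrow> 'g \<Rightarrow> complex) \<Rightarrow>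
   (nat \<Rightarrow> ('g \<Rightarrow> complex) \<Rightarrow> complex) \<Rightarrow> 'g set \<Rightarrow> real \<Rightarrow> 'g frep set set" where
  "fell_nbhd G T \<pi> n v \<xi> B \<epsilon> =
     {c \<in> irr_classes G T. \<exists>\<rho>\<in>c. \<exists>w \<zeta>.
        (\<forall>j\<in>{1..n}. w j \<in> vspace \<rho> \<and> \<zeta> j \<in> smooth_dual G T \<rho>) \<and>
        (\<forall>j\<in>{1..n}. \<forall>g\<in>B. cmod (\<xi> j (action \<pi> g (v j)) - \<zeta> j (action \<rho> g (w j))) < \<epsilon>)}"

definition fell_open ::
  "('g, 'b) monoid_scheme \<Rightarrow> 'g topology \<Rightarrow> 'g frep set set \<Rightarrow> bool" where
  "fell_open G T U \<longleftrightarrow>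
     U \<subseteq> irr_classes G T \<and>
     (\<forall>c\<in>U. \<forall>\<pi>\<in>c. \<exists>n v \<xi> B \<epsilon>.
        (\<forall>j\<in>{1..n}. v j \<in> vspace \<pi> \<and> \<xi> j \<in> smooth_dual G T \<pi>) \<and> compactin T B \<and> 0 < \<epsilon> \<and>
        fell_nbhd G T \<pi> n v \<xi> B \<epsilon> \<subseteq> U)"

definition fell_topology ::
  "('g, 'b) monoid_scheme \<Rightarrow> 'g topology \<Rightarrow> 'g frep set topology" where
  "fell_topology G T = topology (fell_open G T)"

text \<open>
  The set of \<open>\<pi>\<close> with \<open>Hom\<^sub>K(\<pi>|\<^sub>K, \<rho>) \<noteq> 0\<close>, for a class \<open>r\<close> of irreducible smooth representations
  of \<open>K\<close>. The condition does not depend on the representatives \<open>\<pi>\<close> and \<open>\<rho>\<close>.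
\<close>

definition fell_basic ::
  "('g, 'b) monoid_scheme \<Rightarrow> 'g topology \<Rightarrow> 'g set \<Rightarrow> 'g frep set \<Rightarrow> 'g frep set set" where
  "fell_basic G T K r = {c \<in> irr_classes G T. \<exists>\<pi>\<in>c. \<exists>\<rho>\<in>r. Hom_rep K \<pi> \<rho> \<noteq> {0}}"

definition subgroup_classes ::
  "('g, 'b) monoid_scheme \<Rightarrow> 'g topology \<Rightarrow> 'g set \<Rightarrow> 'g frep set set" where
  "subgroup_classes G T K = irr_classes (G\<lparr>carrier := K\<rparr>) (subtopology T K)"


section \<open>The definitions are well behaved\<close>

lemma fell_nbhd_Int:
  assumes "\<And>j. n < j \<Longrightarrow> j \<le> n + m \<Longrightarrow> v'' j = v' (j - n) \<and> \<xi>'' j = \<xi>' (j - n)"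
    and "\<And>j. j \<le> n \<Longrightarrow> v'' j = v j \<and> \<xi>'' j = \<xi> j"
  shows "fell_nbhd G T \<pi> (n + m) v'' \<xi>'' (B \<union> B') (min \<epsilon> \<epsilon>')
           \<subseteq> fell_nbhd G T \<pi> n v \<xi> B \<epsilon> \<inter> fell_nbhd G T \<pi> m v' \<xi>' B' \<epsilon>'"
proof
  fix c assume "c \<in> fell_nbhd G T \<pi> (n + m) v'' \<xi>'' (B \<union> B') (min \<epsilon> \<epsilon>')"
  then obtain \<rho> w \<zeta> where c: "c \<in> irr_classes G T" "\<rho> \<in> c"
    and w: "\<And>j. j \<in> {1..n+m} \<Longrightarrow> w j \<in> vspace \<rho> \<and> \<zeta> j \<in> smooth_dual G T \<rho>"
    and e: "\<And>j g. j \<in> {1..n+m} \<Longrightarrow> g \<in> B \<union> B' \<Longrightarrow>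
       cmod (\<xi>'' j (action \<pi> g (v'' j)) - \<zeta> j (action \<rho> g (w j))) < min \<epsilon> \<epsilon>'"
    unfolding fell_nbhd_def by blast
  have "c \<in> fell_nbhd G T \<pi> n v \<xi> B \<epsilon>"
    unfolding fell_nbhd_def mem_Collect_eq
  proof (intro conjI bexI exI)
    show "\<forall>j\<in>{1..n}. w j \<in> vspace \<rho> \<and> \<zeta> j \<in> smooth_dual G T \<rho>"
      using w by simp
    show "\<forall>j\<in>{1..n}. \<forall>g\<in>B. cmod (\<xi> j (action \<pi> g (v j)) - \<zeta> j (action \<rho> g (w j))) < \<epsilon>"
    proof (intro ballI)
      fix j g assume "j \<in> {1..n}" "g \<in> B"
      with e[of j g] assms(2)[of j]
      show "cmod (\<xi> j (action \<pi> g (v j)) - \<zeta> j (action \<rho> g (w j))) < \<epsilon>" by simp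
    qed
  qed (use c in auto)
  moreover have "c \<in> fell_nbhd G T \<pi> m v' \<xi>' B' \<epsilon>'"
    unfolding fell_nbhd_def mem_Collect_eq
  proof (intro conjI bexI exI)
    show "\<forall>j\<in>{1..m}. w (n + j) \<in> vspace \<rho> \<and> \<zeta> (n + j) \<in> smooth_dual G T \<rho>"
      using w by simp
    show "\<forall>j\<in>{1..m}. \<forall>g\<in>B'.
        cmod (\<xi>' j (action \<pi> g (v' j)) - \<zeta> (n + j) (action \<rho> g (w (n + j)))) < \<epsilon>'"
    proof (intro ballI)
      fix j g assume "j \<in> {1..m}" "g \<in> B'"
      with e[of "n + j" g] assms(1)[of "n + j"]
      show "cmod (\<xi>' j (action \<pi> g (v' j)) - \<zeta> (n + j) (action \<rho> g (w (n + j)))) < \<epsilon>'" by simp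
    qed
  qed (use c in auto)
  ultimately show "c \<in> fell_nbhd G T \<pi> n v \<xi> B \<epsilon> \<inter> fell_nbhd G T \<pi> m v' \<xi>' B' \<epsilon>'" by blast
qed

lemma fell_openE:
  assumes "fell_open G T U" "c \<in> U" "\<pi> \<in> c"
  obtains n v \<xi> B \<epsilon> where "\<forall>j\<in>{1..n}. v j \<in> vspace \<pi> \<and> \<xi> j \<in> smooth_dual G T \<pi>"
    "compactin T B" "0 < \<epsilon>" "fell_nbhd G T \<pi> n v \<xi> B \<epsilon> \<subseteq> U"
proof -
  have "\<exists>n v \<xi> B \<epsilon>. (\<forall>j\<in>{1..n}. v j \<in> vspace \<pi> \<and> \<xi> j \<in> smooth_dual G T \<pi>) \<and>
        compactin T B \<and> 0 < \<epsilon> \<and> fell_nbhd G T \<pi> n v \<xi> B \<epsilon> \<subseteq> U"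
    using assms(1)[unfolded fell_open_def, THEN conjunct2, THEN bspec, OF assms(2), THEN bspec, OF assms(3)] .
  thus thesis by (elim exE conjE) (rule that)
qed

lemma istopology_fell_open: "istopology (fell_open G T)"
  unfolding istopology_def
proof (intro conjI allI impI)
  fix S U assume S: "fell_open G T S" and U: "fell_open G T U"
  show "fell_open G T (S \<inter> U)"
    unfolding fell_open_def
  proof (intro conjI ballI)
    show "S \<inter> U \<subseteq> irr_classes G T" using S unfolding fell_open_def by blast
  next
    fix c \<pi> assume c: "c \<in> S \<inter> U" "\<pi> \<in> c"
    obtain n v \<xi> B \<epsilon> where 1: "\<forall>j\<in>{1..n}. v j \<in> vspace \<pi> \<and> \<xi> j \<in> smooth_dual G T \<pi>"
      "compactin T B" "0 < \<epsilon>" "fell_nbhd G T \<pi> n v \<xi> B \<epsilon> \<subseteq> S"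
      using c(1) by (elim IntE) (rule fell_openE[OF S _ c(2)])
    obtain m v' \<xi>' B' \<epsilon>' where 2: "\<forall>j\<in>{1..m}. v' j \<in> vspace \<pi> \<and> \<xi>' j \<in> smooth_dual G T \<pi>"
      "compactin T B'" "0 < \<epsilon>'" "fell_nbhd G T \<pi> m v' \<xi>' B' \<epsilon>' \<subseteq> U"
      using c(1) by (elim IntE) (rule fell_openE[OF U _ c(2)])
    define v'' where "v'' = (\<lambda>j. if j \<le> n then v j else v' (j - n))"
    define \<xi>'' where "\<xi>'' = (\<lambda>j. if j \<le> n then \<xi> j else \<xi>' (j - n))"
    have "fell_nbhd G T \<pi> (n + m) v'' \<xi>'' (B \<union> B') (min \<epsilon> \<epsilon>')
           \<subseteq> fell_nbhd G T \<pi> n v \<xi> B \<epsilon> \<inter> fell_nbhd G T \<pi> m v' \<xi>' B' \<epsilon>'"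
      by (rule fell_nbhd_Int) (auto simp: v''_def \<xi>''_def)
    hence "fell_nbhd G T \<pi> (n + m) v'' \<xi>'' (B \<union> B') (min \<epsilon> \<epsilon>') \<subseteq> S \<inter> U"
      using 1(4) 2(4) by blast
    moreover have "\<forall>j\<in>{1..n+m}. v'' j \<in> vspace \<pi> \<and> \<xi>'' j \<in> smooth_dual G T \<pi>"
    proof
      fix j assume "j \<in> {1..n+m}"
      hence "j \<in> {1..n} \<or> \<not> j \<le> n \<and> j - n \<in> {1..m}" by auto
      thus "v'' j \<in> vspace \<pi> \<and> \<xi>'' j \<in> smooth_dual G T \<pi>"
        using 1(1) 2(1) by (auto simp: v''_def \<xi>''_def)
    qed
    moreover have "compactin T (B \<union> B')" using 1(2) 2(2) by (rule compactin_Un)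
    moreover have "0 < min \<epsilon> \<epsilon>'" using 1(3) 2(3) by simp
    ultimately show "\<exists>n v \<xi> B \<epsilon>. (\<forall>j\<in>{1..n}. v j \<in> vspace \<pi> \<and> \<xi> j \<in> smooth_dual G T \<pi>) \<and>
        compactin T B \<and> 0 < \<epsilon> \<and> fell_nbhd G T \<pi> n v \<xi> B \<epsilon> \<subseteq> S \<inter> U"
      by (intro exI conjI) assumption+
  qed
next
  fix \<K> assume K: "\<forall>U\<in>\<K>. fell_open G T U"
  show "fell_open G T (\<Union>\<K>)"
    unfolding fell_open_def
  proof (intro conjI ballI)
    show "\<Union>\<K> \<subseteq> irr_classes G T" using K unfolding fell_open_def by blast
  next
    fix c \<pi> assume "c \<in> \<Union>\<K>" "\<pi> \<in> c"
    then obtain U where U: "U \<in> \<K>" "c \<in> U" "fell_open G T U" using K by blast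
    obtain n v \<xi> B \<epsilon> where "\<forall>j\<in>{1..n}. v j \<in> vspace \<pi> \<and> \<xi> j \<in> smooth_dual G T \<pi>"
      "compactin T B" "0 < \<epsilon>" "fell_nbhd G T \<pi> n v \<xi> B \<epsilon> \<subseteq> U"
      using fell_openE[OF U(3,2) \<open>\<pi> \<in> c\<close>] .
    moreover from this(4) have "fell_nbhd G T \<pi> n v \<xi> B \<epsilon> \<subseteq> \<Union>\<K>" using U(1) by (rule order_trans[OF _ Union_upper])
    ultimately show "\<exists>n v \<xi> B \<epsilon>. (\<forall>j\<in>{1..n}. v j \<in> vspace \<pi> \<and> \<xi> j \<in> smooth_dual G T \<pi>) \<and>
        compactin T B \<and> 0 < \<epsilon> \<and> fell_nbhd G T \<pi> n v \<xi> B \<epsilon> \<subseteq> \<Union>\<K>"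
      by (intro exI conjI) assumption+
  qed
qed

lemma openin_fell_topology: "openin (fell_topology G T) U \<longleftrightarrow> fell_open G T U"
  unfolding fell_topology_def by (simp add: topology_inverse' istopology_fell_open)

lemma topspace_fell_topology: "topspace (fell_topology G T) = irr_classes G T"
proof -
  have "fell_open G T (irr_classes G T)"
    unfolding fell_open_def
  proof (intro conjI ballI order_refl)
    fix c and \<pi> :: "'a frep"
    have "fell_nbhd G T \<pi> 0 v \<xi> {} 1 \<subseteq> irr_classes G T" for v \<xi>
      unfolding fell_nbhd_def by blast
    thus "\<exists>n v \<xi> B \<epsilon>. (\<forall>j\<in>{1..n}. v j \<in> vspace \<pi> \<and> \<xi> j \<in> smooth_dual G T \<pi>) \<and>
        compactin T B \<and> 0 < \<epsilon> \<and> fell_nbhd G T \<pi> n v \<xi> B \<epsilon> \<subseteq> irr_classes G T"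
      by (intro exI[of _ 0] exI[of _ "{}"] exI[of _ 1] exI conjI)
        (auto intro: compactin_empty)
  qed
  moreover have "U \<subseteq> irr_classes G T" if "fell_open G T U" for U
    using that unfolding fell_open_def by blast
  ultimately show ?thesis
    unfolding topspace_def openin_fell_topology by blast
qed

text \<open>Transport of structure along an isomorphism.\<close>

lemma linear_map_on_zero:
  assumes "linear_map_on V W f" "cvs.subspace V"
  shows "f 0 = 0"
proof -
  have "f (0 *\<^sub>C 0) = 0 *\<^sub>C f 0"
    using assms cvs.subspace_0 unfolding linear_map_on_def by blast
  thus ?thesis by simp
qed

lemma linear_map_on_subspace_image:
  assumes f: "linear_map_on V W f" and U: "cvs.subspace U" "U \<subseteq> V"
  shows "cvs.subspace (f ` U)"
  unfolding cvs.subspace_def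
proof (intro conjI ballI allI)
  have "linear_map_on U W f" using f U(2) unfolding linear_map_on_def by blast
  thus "0 \<in> f ` U" using linear_map_on_zero U cvs.subspace_0 by (metis imageI)
next
  fix x y assume "x \<in> f ` U" "y \<in> f ` U"
  then obtain a b where ab: "a \<in> U" "b \<in> U" "x = f a" "y = f b" by blast
  hence "x + y = f (a + b)" using f U(2) unfolding linear_map_on_def by (metis subsetD)
  thus "x + y \<in> f ` U" using ab cvs.subspace_add[OF U(1)] by blast
next
  fix c x assume "x \<in> f ` U"
  then obtain a where a: "a \<in> U" "x = f a" by blast
  hence "c *\<^sub>C x = f (c *\<^sub>C a)" using f U(2) unfolding linear_map_on_def by (metis subsetD)
  thus "c *\<^sub>C x \<in> f ` U" using a cvs.subspace_scale[OF U(1)] by blast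
qed

lemma linear_map_on_subspace_vimage:
  assumes f: "linear_map_on V W f" and V: "cvs.subspace V" and U: "cvs.subspace U"
  shows "cvs.subspace {v \<in> V. f v \<in> U}"
  unfolding cvs.subspace_def
proof (intro conjI ballI allI)
  show "0 \<in> {v \<in> V. f v \<in> U}"
    using linear_map_on_zero[OF f V] cvs.subspace_0[OF V] cvs.subspace_0[OF U] by simp
next
  fix x y assume "x \<in> {v \<in> V. f v \<in> U}" "y \<in> {v \<in> V. f v \<in> U}"
  thus "x + y \<in> {v \<in> V. f v \<in> U}"
    using f cvs.subspace_add[OF U] cvs.subspace_add[OF V] unfolding linear_map_on_def by auto
next
  fix c x assume "x \<in> {v \<in> V. f v \<in> U}"
  thus "c *\<^sub>C x \<in> {v \<in> V. f v \<in> U}"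
    using f cvs.subspace_scale[OF U] cvs.subspace_scale[OF V] unfolding linear_map_on_def by auto
qed

lemma finite_dimensional_image:
  assumes f: "linear_map_on V W f" and U: "finite_dimensional U" "U \<subseteq> V"
  shows "finite_dimensional (f ` U)"
proof -
  obtain B where B: "finite B" "cvs.span B = U"
    using U(1) unfolding finite_dimensional_def by blast
  have sU: "cvs.subspace U" using B(2) cvs.subspace_span by blast
  have fU: "linear_map_on U W f" using f U(2) unfolding linear_map_on_def by blast
  have "cvs.span (f ` B) = f ` U"
  proof
    have "f ` B \<subseteq> f ` U" using B(2) cvs.span_superset by blast
    thus "cvs.span (f ` B) \<subseteq> f ` U"
      using linear_map_on_subspace_image[OF f sU U(2)] by (rule cvs.span_minimal)
  next
    have "cvs.span B \<subseteq> {u \<in> U. f u \<in> cvs.span (f ` B)}"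
    proof (rule cvs.span_minimal)
      show "B \<subseteq> {u \<in> U. f u \<in> cvs.span (f ` B)}"
        using B(2) cvs.span_superset by (auto intro: cvs.span_base)
      show "cvs.subspace {u \<in> U. f u \<in> cvs.span (f ` B)}"
        using linear_map_on_subspace_vimage[OF fU sU cvs.subspace_span] .
    qed
    thus "f ` U \<subseteq> cvs.span (f ` B)" using B(2) by blast
  qed
  thus ?thesis unfolding finite_dimensional_def using B(1) by blast
qed

lemma irreducible_smooth_transport:
  assumes \<pi>: "irreducible_smooth G T \<pi>" and \<sigma>: "group_rep G \<sigma>"
    and f: "f \<in> Hom_rep (carrier G) \<pi> \<sigma>" "bij_betw f (vspace \<pi>) (vspace \<sigma>)"
  shows "irreducible_smooth G T \<sigma>"
proof -
  have lin: "linear_map_on (vspace \<pi>) (vspace \<sigma>) f"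
    and eq: "\<And>g v. g \<in> carrier G \<Longrightarrow> v \<in> vspace \<pi> \<Longrightarrow> f (action \<pi> g v) = action \<sigma> g (f v)"
    using f(1) unfolding Hom_rep_def by auto
  have inj: "inj_on f (vspace \<pi>)" and img: "f ` vspace \<pi> = vspace \<sigma>"
    using f(2) unfolding bij_betw_def by auto
  have rep: "group_rep G \<pi>" and sub: "cvs.subspace (vspace \<pi>)"
    using \<pi> unfolding irreducible_smooth_def smooth_rep_def group_rep_def by auto
  have inv: "\<And>g v. g \<in> carrier G \<Longrightarrow> v \<in> vspace \<pi> \<Longrightarrow> action \<pi> g v \<in> vspace \<pi>"
    using rep unfolding group_rep_def linear_map_on_def by blast
  have f0: "f 0 = 0" using linear_map_on_zero[OF lin sub] .
  have "smooth_rep G T \<sigma>"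
    unfolding smooth_rep_def
  proof (intro conjI ballI \<sigma>)
    fix w assume "w \<in> vspace \<sigma>"
    then obtain v where v: "v \<in> vspace \<pi>" "w = f v" using img by blast
    have "{g \<in> carrier G. action \<sigma> g w = w} = {g \<in> carrier G. action \<pi> g v = v}"
    proof (intro Collect_cong conj_cong refl)
      fix g assume g: "g \<in> carrier G"
      show "action \<sigma> g w = w \<longleftrightarrow> action \<pi> g v = v"
        using eq[OF g v(1)] inj_on_eq_iff[OF inj inv[OF g v(1)] v(1)] v(2) by simp
    qed
    thus "openin T {g \<in> carrier G. action \<sigma> g w = w}"
      using \<pi> v unfolding irreducible_smooth_def smooth_rep_def by simp
  qed
  moreover have "irreducible_rep G \<sigma>"
    unfolding irreducible_rep_def
  proof (intro conjI allI impI \<sigma>)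
    obtain v where "v \<in> vspace \<pi>" "v \<noteq> 0"
      using \<pi> cvs.subspace_0[OF sub] unfolding irreducible_smooth_def irreducible_rep_def by blast
    hence "f v \<in> vspace \<sigma>" "f v \<noteq> 0"
      using img f0 inj_on_eq_iff[OF inj _ cvs.subspace_0[OF sub], of v] by auto
    thus "vspace \<sigma> \<noteq> {0}" by auto
  next
    fix W assume W: "cvs.subspace W \<and> W \<subseteq> vspace \<sigma> \<and> (\<forall>g\<in>carrier G. action \<sigma> g ` W \<subseteq> W)"
    define U where "U = {v \<in> vspace \<pi>. f v \<in> W}"
    have fU: "f ` U = W"
    proof
      show "f ` U \<subseteq> W" by (auto simp: U_def)
      show "W \<subseteq> f ` U"
      proof
        fix w assume w: "w \<in> W"
        hence "w \<in> f ` vspace \<pi>" using W img by auto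
        thus "w \<in> f ` U" using w by (auto simp: U_def)
      qed
    qed
    have "cvs.subspace U" unfolding U_def
      using linear_map_on_subspace_vimage[OF lin sub] W by blast
    moreover have "U \<subseteq> vspace \<pi>" unfolding U_def by blast
    moreover have "\<forall>g\<in>carrier G. action \<pi> g ` U \<subseteq> U"
      using W inv by (auto simp: U_def eq image_subset_iff)
    ultimately have "U = {0} \<or> U = vspace \<pi>"
      using \<pi> unfolding irreducible_smooth_def irreducible_rep_def by blast
    thus "W = {0} \<or> W = vspace \<sigma>" using fU f0 img by auto
  qed
  ultimately show ?thesis unfolding irreducible_smooth_def by blast
qed

theorem irreducible_smooth_universe:
  fixes \<pi> :: "('g, 'v::complex_vector) crep"
  assumes G: "group G" and \<pi>: "irreducible_smooth G T \<pi>"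
  shows "\<exists>\<sigma> :: 'g frep. irreducible_smooth G T \<sigma> \<and> isomorphic_reps G \<pi> \<sigma>"
proof -
  interpret group G by fact
  let ?V = "vspace \<pi>"
  have rep: "group_rep G \<pi>" and sub: "cvs.subspace ?V"
    using \<pi> unfolding irreducible_smooth_def smooth_rep_def group_rep_def by auto
  have act_lin: "\<And>g. g \<in> carrier G \<Longrightarrow> linear_map_on ?V ?V (action \<pi> g)"
    and act_one: "\<And>v. v \<in> ?V \<Longrightarrow> action \<pi> \<one>\<^bsub>G\<^esub> v = v"
    and act_mult: "\<And>g h v. g \<in> carrier G \<Longrightarrow> h \<in> carrier G \<Longrightarrow> v \<in> ?V \<Longrightarrow>
       action \<pi> (g \<otimes>\<^bsub>G\<^esub> h) v = action \<pi> g (action \<pi> h v)"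
    using rep unfolding group_rep_def by auto
  have inv: "\<And>g v. g \<in> carrier G \<Longrightarrow> v \<in> ?V \<Longrightarrow> action \<pi> g v \<in> ?V"
    using act_lin unfolding linear_map_on_def by blast
  obtain v0 where v0: "v0 \<in> ?V" "v0 \<noteq> 0"
    using \<pi> cvs.subspace_0[OF sub] unfolding irreducible_smooth_def irreducible_rep_def by blast
  have "cvs.independent {v0}" using v0(2) by (simp add: cvs.independent_insert)
  then obtain \<xi> :: "'v \<Rightarrow> complex" where \<xi>: "Vector_Spaces.linear (*\<^sub>C) (*\<^sub>C) \<xi>" "\<xi> v0 = 1"
    using cvs.linear_independent_extend[of "{v0}" "\<lambda>_. 1"] by auto
  have \<xi>_add: "\<xi> (x + y) = \<xi> x + \<xi> y" and \<xi>_scale: "\<xi> (c *\<^sub>C x) = c * \<xi> x" for x y c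
    using Vector_Spaces.linear.axioms module_hom.add[OF \<xi>(1)[unfolded Vector_Spaces.linear_iff_module_hom]]
      module_hom.scale[OF \<xi>(1)[unfolded Vector_Spaces.linear_iff_module_hom]] by auto
  define f :: "'v \<Rightarrow> 'g \<Rightarrow> complex" where
    "f = (\<lambda>v. if v \<in> ?V then (\<lambda>g. if g \<in> carrier G then \<xi> (action \<pi> g v) else 0) else 0)"
  define \<sigma> :: "'g frep" where
    "\<sigma> = \<lparr>vspace = f ` ?V, action = (\<lambda>g \<phi> h. if h \<in> carrier G then \<phi> (h \<otimes>\<^bsub>G\<^esub> g) else 0)\<rparr>"
  have f_eq: "f (action \<pi> g v) = action \<sigma> g (f v)" if "g \<in> carrier G" "v \<in> ?V" for g v
    using that inv act_mult by (auto simp: f_def \<sigma>_def fun_eq_iff)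
  have f_lin: "linear_map_on ?V (f ` ?V) f"
    unfolding linear_map_on_def
  proof (intro conjI ballI allI order_refl)
    fix x y assume xy: "x \<in> ?V" "y \<in> ?V"
    have "action \<pi> g (x + y) = action \<pi> g x + action \<pi> g y" if "g \<in> carrier G" for g
      using act_lin[OF that] xy unfolding linear_map_on_def by blast
    thus "f (x + y) = f x + f y"
      using xy cvs.subspace_add[OF sub xy] by (auto simp: f_def fun_eq_iff \<xi>_add)
  next
    fix c x assume x: "x \<in> ?V"
    have "action \<pi> g (c *\<^sub>C x) = c *\<^sub>C action \<pi> g x" if "g \<in> carrier G" for g
      using act_lin[OF that] x unfolding linear_map_on_def by blast
    thus "f (c *\<^sub>C x) = c *\<^sub>C f x"
      using x cvs.subspace_scale[OF sub x] by (auto simp: f_def fun_eq_iff \<xi>_scale fun_scaleC_def)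
  qed
  have f0: "f 0 = 0" using linear_map_on_zero[OF f_lin sub] .
  have "cvs.subspace {v \<in> ?V. f v \<in> {0}}"
    using linear_map_on_subspace_vimage[OF f_lin sub cvs.subspace_single_0] .
  moreover have "action \<pi> g v \<in> {v \<in> ?V. f v \<in> {0}}"
    if "g \<in> carrier G" "v \<in> {v \<in> ?V. f v \<in> {0}}" for g v
  proof -
    have "f (action \<pi> g v) = action \<sigma> g 0" using that f_eq by auto
    also have "\<dots> = 0" by (auto simp: \<sigma>_def fun_eq_iff)
    finally show ?thesis using that inv by simp
  qed
  ultimately have "{v \<in> ?V. f v \<in> {0}} = {0} \<or> {v \<in> ?V. f v \<in> {0}} = ?V"
    using \<pi> unfolding irreducible_smooth_def irreducible_rep_def by blast
  moreover have "f v0 \<noteq> 0"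
  proof
    assume "f v0 = 0"
    hence "f v0 \<one>\<^bsub>G\<^esub> = 0" by simp
    thus False using v0 \<xi>(2) act_one by (simp add: f_def)
  qed
  ultimately have ker: "v = 0" if "v \<in> ?V" "f v = 0" for v
    using that v0(1) by blast
  have inj: "inj_on f ?V"
  proof (rule inj_onI)
    fix x y assume xy: "x \<in> ?V" "y \<in> ?V" "f x = f y"
    have my: "(-1) *\<^sub>C y \<in> ?V" using cvs.subspace_scale[OF sub xy(2)] .
    have "f (x + (-1) *\<^sub>C y) = f x + (-1) *\<^sub>C f y"
      using f_lin xy my unfolding linear_map_on_def by metis
    also have "\<dots> = 0" using xy(3) by (simp add: fun_eq_iff fun_scaleC_def)
    finally have "x + (-1) *\<^sub>C y = 0" using ker cvs.subspace_add[OF sub xy(1) my] by blast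
    thus "x = y" by simp
  qed
  have hom: "f \<in> Hom_rep (carrier G) \<pi> \<sigma>"
    unfolding Hom_rep_def using f_lin f_eq by (auto simp: f_def \<sigma>_def)
  have bij: "bij_betw f ?V (vspace \<sigma>)" using inj by (simp add: bij_betw_def \<sigma>_def)
  have "group_rep G \<sigma>"
    unfolding group_rep_def
  proof (intro conjI ballI)
    show "cvs.subspace (vspace \<sigma>)"
      using linear_map_on_subspace_image[OF f_lin sub] by (simp add: \<sigma>_def)
  next
    fix g assume g: "g \<in> carrier G"
    have "action \<sigma> g ` vspace \<sigma> \<subseteq> vspace \<sigma>"
    proof
      fix \<psi> assume "\<psi> \<in> action \<sigma> g ` vspace \<sigma>"
      then obtain v where "v \<in> ?V" "\<psi> = action \<sigma> g (f v)" by (auto simp: \<sigma>_def)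
      hence "\<psi> = f (action \<pi> g v)" "action \<pi> g v \<in> ?V" using f_eq[OF g] inv[OF g] by auto
      thus "\<psi> \<in> vspace \<sigma>" by (simp add: \<sigma>_def)
    qed
    thus "linear_map_on (vspace \<sigma>) (vspace \<sigma>) (action \<sigma> g)"
      by (auto simp: linear_map_on_def \<sigma>_def fun_eq_iff fun_scaleC_def)
  next
    fix \<phi> assume "\<phi> \<in> vspace \<sigma>"
    thus "action \<sigma> \<one>\<^bsub>G\<^esub> \<phi> = \<phi>" by (auto simp: \<sigma>_def f_def fun_eq_iff)
  next
    fix g h \<phi> assume "g \<in> carrier G" "h \<in> carrier G" "\<phi> \<in> vspace \<sigma>"
    thus "action \<sigma> (g \<otimes>\<^bsub>G\<^esub> h) \<phi> = action \<sigma> g (action \<sigma> h \<phi>)"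
      by (auto simp: \<sigma>_def fun_eq_iff m_assoc)
  qed
  hence "irreducible_smooth G T \<sigma>"
    using irreducible_smooth_transport[OF \<pi> _ hom bij] by blast
  thus ?thesis using hom bij unfolding isomorphic_reps_def by blast
qed

lemma isomorphic_reps_sym:
  fixes \<pi> :: "('g, 'v::complex_vector) crep" and \<sigma> :: "('g, 'w::complex_vector) crep"
  assumes \<pi>: "group_rep G \<pi>" and iso: "isomorphic_reps G \<pi> \<sigma>"
  shows "isomorphic_reps G \<sigma> \<pi>"
proof -
  obtain f where f: "f \<in> Hom_rep (carrier G) \<pi> \<sigma>" "bij_betw f (vspace \<pi>) (vspace \<sigma>)"
    using iso unfolding isomorphic_reps_def by blast
  let ?V = "vspace \<pi>" and ?W = "vspace \<sigma>"
  have sub: "cvs.subspace ?V" using \<pi> unfolding group_rep_def by blast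
  have add: "\<And>x y. x \<in> ?V \<Longrightarrow> y \<in> ?V \<Longrightarrow> f (x + y) = f x + f y"
    and scale: "\<And>c x. x \<in> ?V \<Longrightarrow> f (c *\<^sub>C x) = c *\<^sub>C f x"
    and eq: "\<And>g v. g \<in> carrier G \<Longrightarrow> v \<in> ?V \<Longrightarrow> f (action \<pi> g v) = action \<sigma> g (f v)"
    using f(1) unfolding Hom_rep_def linear_map_on_def by auto
  have inv: "\<And>g v. g \<in> carrier G \<Longrightarrow> v \<in> ?V \<Longrightarrow> action \<pi> g v \<in> ?V"
    using \<pi> unfolding group_rep_def linear_map_on_def by blast
  define h where "h = (\<lambda>w. if w \<in> ?W then inv_into ?V f w else 0)"
  have hV: "h w \<in> ?V" and fh: "f (h w) = w" if "w \<in> ?W" for w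
    using that f(2) unfolding h_def by (auto simp: bij_betw_def inv_into_into f_inv_into_f)
  have hf: "h (f v) = v" if "v \<in> ?V" for v
    using that f(2) unfolding h_def by (auto simp: bij_betw_def)
  have "h \<in> Hom_rep (carrier G) \<sigma> \<pi>"
    unfolding Hom_rep_def linear_map_on_def mem_Collect_eq
  proof (intro conjI ballI allI impI)
    show "h ` ?W \<subseteq> ?V" using hV by blast
    show "h (x + y) = h x + h y" if "x \<in> ?W" "y \<in> ?W" for x y
      using add[OF hV hV, OF that] fh that hf[OF cvs.subspace_add[OF sub hV hV, OF that]] by simp
    show "h (c *\<^sub>C x) = c *\<^sub>C h x" if "x \<in> ?W" for c x
      using scale[OF hV, OF that] fh that hf[OF cvs.subspace_scale[OF sub hV, OF that]] by simp
    show "h w = 0" if "w \<notin> ?W" for w using that by (simp add: h_def)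
    show "h (action \<sigma> g w) = action \<pi> g (h w)" if "g \<in> carrier G" "w \<in> ?W" for g w
      using eq[OF that(1) hV[OF that(2)]] fh[OF that(2)] hf[OF inv[OF that(1) hV[OF that(2)]]]
      by simp
  qed
  moreover have "bij_betw h ?W ?V"
    using f(2) unfolding h_def by (simp add: bij_betw_inv_into cong: bij_betw_cong)
  ultimately show ?thesis unfolding isomorphic_reps_def by blast
qed

lemma isomorphic_reps_refl: "isomorphic_reps G \<pi> \<pi>" if "group_rep G \<pi>"
proof -
  let ?V = "vspace \<pi>" and ?f = "\<lambda>v. if v \<in> vspace \<pi> then v else 0"
  have sub: "cvs.subspace ?V" using that unfolding group_rep_def by blast
  have inv: "action \<pi> g v \<in> ?V" if "g \<in> carrier G" "v \<in> ?V" for g v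
    using \<open>group_rep G \<pi>\<close> that unfolding group_rep_def linear_map_on_def by blast
  have "?f \<in> Hom_rep (carrier G) \<pi> \<pi>"
    unfolding Hom_rep_def linear_map_on_def
    using cvs.subspace_add[OF sub] cvs.subspace_scale[OF sub] inv by simp
  moreover have "bij_betw ?f ?V ?V" by (rule bij_betwI[where g = ?f]) auto
  ultimately show ?thesis unfolding isomorphic_reps_def by blast
qed

lemma isomorphic_reps_trans:
  assumes \<rho>: "group_rep G \<rho>" and 1: "isomorphic_reps G \<pi> \<rho>" and 2: "isomorphic_reps G \<rho> \<sigma>"
  shows "isomorphic_reps G \<pi> \<sigma>"
proof -
  obtain f where f: "f \<in> Hom_rep (carrier G) \<pi> \<rho>" "bij_betw f (vspace \<pi>) (vspace \<rho>)"
    using 1 unfolding isomorphic_reps_def by blast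
  obtain h where h: "h \<in> Hom_rep (carrier G) \<rho> \<sigma>" "bij_betw h (vspace \<rho>) (vspace \<sigma>)"
    using 2 unfolding isomorphic_reps_def by blast
  have h0: "h 0 = 0"
    using h(1) \<rho> linear_map_on_zero unfolding Hom_rep_def group_rep_def by blast
  have fV: "f v \<in> vspace \<rho>" if "v \<in> vspace \<pi>" for v
    using f(2) that by (rule bij_betw_apply)
  have hV: "h w \<in> vspace \<sigma>" if "w \<in> vspace \<rho>" for w
    using h(2) that by (rule bij_betw_apply)
  have "h \<circ> f \<in> Hom_rep (carrier G) \<pi> \<sigma>"
    using f(1) h(1) h0 fV hV unfolding Hom_rep_def linear_map_on_def by auto
  thus ?thesis using bij_betw_trans[OF f(2) h(2)] unfolding isomorphic_reps_def by blast
qed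

lemma equiv_irr_iso_rel: "equiv {\<pi>. irreducible_smooth G T \<pi>} (irr_iso_rel G T)"
proof (rule equivI)
  have rep: "group_rep G \<pi>" if "irreducible_smooth G T \<pi>" for \<pi> :: "'a frep"
    using that unfolding irreducible_smooth_def irreducible_rep_def by blast
  show "refl_on {\<pi>. irreducible_smooth G T \<pi>} (irr_iso_rel G T)"
    using isomorphic_reps_refl[OF rep] by (auto simp: refl_on_def irr_iso_rel_def)
  show "sym (irr_iso_rel G T)"
    using isomorphic_reps_sym[OF rep] by (auto simp: sym_def irr_iso_rel_def)
  show "trans (irr_iso_rel G T)"
    unfolding trans_def irr_iso_rel_def using isomorphic_reps_trans[OF rep] by blast
  show "irr_iso_rel G T \<subseteq> {\<pi>. irreducible_smooth G T \<pi>} \<times> {\<pi>. irreducible_smooth G T \<pi>}"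
    by (auto simp: irr_iso_rel_def)
qed

text \<open>
  Tameness is formulated with representations on subspaces of the function space, but it yields
  admissibility of the irreducible smooth representations on arbitrary complex vector spaces.
\<close>

theorem tame_admissible:
  fixes \<pi> :: "('g, 'v::complex_vector) crep"
  assumes G: "group G" and tame: "tame G T" and \<pi>: "irreducible_smooth G T \<pi>"
  shows "admissible G T \<pi>"
proof -
  obtain \<sigma> :: "'g frep" where \<sigma>: "irreducible_smooth G T \<sigma>" "isomorphic_reps G \<pi> \<sigma>"
    using irreducible_smooth_universe[OF G \<pi>] by blast
  have rep: "group_rep G \<pi>" "group_rep G \<sigma>"
    using \<pi> \<sigma> unfolding irreducible_smooth_def irreducible_rep_def by auto
  obtain f where f: "f \<in> Hom_rep (carrier G) \<sigma> \<pi>" "bij_betw f (vspace \<sigma>) (vspace \<pi>)"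
    using isomorphic_reps_sym[OF rep(1) \<sigma>(2)] unfolding isomorphic_reps_def by blast
  have lin: "linear_map_on (vspace \<sigma>) (vspace \<pi>) f"
    and eq: "\<And>g v. g \<in> carrier G \<Longrightarrow> v \<in> vspace \<sigma> \<Longrightarrow> f (action \<sigma> g v) = action \<pi> g (f v)"
    using f(1) unfolding Hom_rep_def by auto
  have inv: "\<And>g v. g \<in> carrier G \<Longrightarrow> v \<in> vspace \<sigma> \<Longrightarrow> action \<sigma> g v \<in> vspace \<sigma>"
    using rep(2) unfolding group_rep_def linear_map_on_def by blast
  have adm: "admissible G T \<sigma>" using tame \<sigma>(1) unfolding tame_def by blast
  show ?thesis
    unfolding admissible_def
  proof (intro conjI allI impI)
    show "smooth_rep G T \<pi>" using \<pi> unfolding irreducible_smooth_def by blast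
  next
    fix K assume K: "compact_open_subgroup G T K"
    have KG: "k \<in> carrier G" if "k \<in> K" for k
      using K that unfolding compact_open_subgroup_def by (blast dest: subgroup.mem_carrier)
    have fd: "finite_dimensional (fixed_vectors K \<sigma>)" using adm K unfolding admissible_def by blast
    have "fixed_vectors K \<pi> = f ` fixed_vectors K \<sigma>"
    proof
      show "f ` fixed_vectors K \<sigma> \<subseteq> fixed_vectors K \<pi>"
        using lin KG unfolding fixed_vectors_def linear_map_on_def by (auto simp flip: eq)
      show "fixed_vectors K \<pi> \<subseteq> f ` fixed_vectors K \<sigma>"
      proof
        fix w assume w: "w \<in> fixed_vectors K \<pi>"
        then obtain v where v: "v \<in> vspace \<sigma>" "w = f v"
          using f(2) unfolding fixed_vectors_def bij_betw_def by blast
        have "action \<sigma> k v = v" if "k \<in> K" for k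
        proof -
          have "f (action \<sigma> k v) = f v"
            using w v eq KG that unfolding fixed_vectors_def by simp
          thus ?thesis using f(2) v inv KG that unfolding bij_betw_def by (meson inj_onD)
        qed
        thus "w \<in> f ` fixed_vectors K \<sigma>" using v unfolding fixed_vectors_def by blast
      qed
    qed
    thus "finite_dimensional (fixed_vectors K \<pi>)"
      using finite_dimensional_image[OF lin fd] unfolding fixed_vectors_def by auto
  qed
qed

end

theory Submission
  imports Defs
begin

text \<open>
  All averages are finite sums over cosets of open subgroups of a compact group. If \<open>\<pi>\<close> maps onto
  \<open>\<rho>\<close> over \<open>K\<close> and \<open>\<sigma>\<close> does not, Schur orthogonality on \<open>K\<close> keeps suitable coefficients of \<open>\<pi>\<close>
  uniformly away from those of \<open>\<sigma>\<close>, so \<open>\<V>(K, \<rho>)\<close> is open. Conversely, given \<open>v\<^sub>j\<close> in \<open>\<pi>\<close>, take \<open>N\<close> fixing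
  all \<open>v\<^sub>j\<close>. By tameness the \<open>N\<close>-invariants of \<open>\<pi>\<close> are finite-dimensional, so a large compact open
  \<open>K\<close> containing \<open>B\<close> already acts on them as irreducibly as \<open>G\<close> does, and they generate an irreducible
  representation \<open>\<rho>\<close> of \<open>K\<close>. Any \<open>\<sigma>\<close> in \<open>\<V>(K, \<rho>)\<close> has \<open>\<rho>\<close> as a direct summand over \<open>K\<close> and hence
  reproduces the coefficients of the \<open>v\<^sub>j\<close> on \<open>B\<close> exactly.
\<close>

section \<open>Linear algebra\<close>

text \<open>Coset sums can replace Haar integrals because a smooth vector is fixed by an open
  subgroup \<open>N\<close>, and \<open>N\<close> has finite index in a compact group. Such a sum is
  independent of the chosen representatives only when the summand is left
  \<open>N\<close>-invariant. This shapes the constructions: \<open>N\<close> is taken small enough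
  to fix all vectors and functionals in play, and a linear form that is not invariant is first
  composed with a projection onto \<open>N\<close>-invariants. Irreducible representations of a
  compact group are finite-dimensional. So Schur orthogonality can be summed over a basis of \<rho>,
  and the test coefficients on \<rho> are bounded independently of \<sigma>; this is why one
  \<epsilon> excludes all \<sigma> without a nonzero map to \<rho>. In the converse, the maps of
  \<sigma> to \<rho> need not be related to \<pi> in any other way. A nonzero \<open>K\<close>-map
  \<open>f\<close> from \<sigma> to \<rho> is onto and has an equivariant section \<open>s\<close>;
  the vectors are moved to \<sigma> by \<open>s\<close>, the functionals by composition with
  \<open>f\<close>, and \<open>f (s y) = y\<close> makes the coefficients agree.\<close>

lemma linear_map_onD:
  assumes "linear_map_on V W f"
  shows "x \<in> V \<Longrightarrow> f x \<in> W"
    and "x \<in> V \<Longrightarrow> y \<in> V \<Longrightarrow> f (x + y) = f x + f y"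
    and "x \<in> V \<Longrightarrow> f (c *\<^sub>C x) = c *\<^sub>C f x"
  using assms unfolding linear_map_on_def by auto

lemma linear_map_on_diff:
  assumes f: "linear_map_on V W f" and V: "cvs.subspace V" and xy: "x \<in> V" "y \<in> V"
  shows "f (x - y) = f x - f y"
proof -
  have "f (x + (-1) *\<^sub>C y) = f x + (-1) *\<^sub>C f y"
    using linear_map_onD(2,3)[OF f] xy cvs.subspace_scale[OF V xy(2)] by metis
  thus ?thesis by simp
qed

lemma linear_map_on_sum:
  assumes f: "linear_map_on V W f" and V: "cvs.subspace V" and x: "\<And>i. i \<in> I \<Longrightarrow> x i \<in> V"
  shows "f (\<Sum>i\<in>I. x i) = (\<Sum>i\<in>I. f (x i))"
  using x
proof (induction I rule: infinite_finite_induct)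
  case (insert i I)
  moreover have "(\<Sum>i\<in>I. x i) \<in> V" using insert by (intro cvs.subspace_sum[OF V]) auto
  ultimately show ?case using linear_map_onD(2)[OF f] by simp
qed (use linear_map_on_zero[OF f V] in auto)

lemma finite_dimensional_basis:
  assumes "finite_dimensional W"
  obtains B where "finite B" "cvs.independent B" "cvs.span B = W"
proof -
  obtain A where A: "finite A" "cvs.span A = W"
    using assms unfolding finite_dimensional_def by blast
  obtain B where B: "B \<subseteq> A" "cvs.independent B" "A \<subseteq> cvs.span B"
    using cvs.maximal_independent_subset by blast
  have "cvs.span B = W"
    using A(2) B cvs.span_mono[OF B(1)] cvs.span_minimal[OF B(3) cvs.subspace_span] by blast
  thus thesis using that B A finite_subset by blast
qed

lemma finite_dimensional_subspace:
  assumes "finite_dimensional W" "cvs.subspace X" "X \<subseteq> W"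
  shows "finite_dimensional X"
proof -
  obtain A where A: "finite A" "cvs.span A = W"
    using assms unfolding finite_dimensional_def by blast
  obtain B where B: "B \<subseteq> X" "cvs.independent B" "X \<subseteq> cvs.span B"
    using cvs.maximal_independent_subset by blast
  have "finite B" using cvs.independent_span_bound[OF A(1) B(2)] B(1) A(2) assms(3) by blast
  moreover have "cvs.span B = X" using B cvs.span_minimal[OF B(1) assms(2)] by blast
  ultimately show ?thesis unfolding finite_dimensional_def by blast
qed

lemma linear_map_on_representation:
  assumes "cvs.independent B" "cvs.span B = W"
  shows "linear_map_on W UNIV (\<lambda>x. cvs.representation B x b)"
  using assms by (auto simp: linear_map_on_def cvs.representation_add cvs.representation_scale)

lemma sum_representation:
  assumes "finite B" "cvs.independent B" "cvs.span B = W" "x \<in> W"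
  shows "(\<Sum>b\<in>B. cvs.representation B x b *\<^sub>C b) = x"
  using assms by (intro cvs.sum_representation_eq) auto

text \<open>\<open>cvs.representation\<close> vanishes off the span of \<open>B\<close>, so as a
  function on the ambient space it is not linear in general. A linear extension is required when a
  coordinate is composed with a map whose values may leave the span.\<close>

lemma representation_extend_linear:
  fixes B :: "'v::complex_vector set"
  assumes B: "cvs.independent B"
  obtains g :: "'v \<Rightarrow> complex" where "linear_map_on UNIV UNIV g"
    "\<And>x. x \<in> cvs.span B \<Longrightarrow> g x = cvs.representation B x b"
proof -
  obtain g :: "'v \<Rightarrow> complex" where g: "Vector_Spaces.linear (*\<^sub>C) (*\<^sub>C) g"
    "\<forall>x\<in>B. g x = cvs.representation B x b"
    using cvs.linear_independent_extend[OF B, of "\<lambda>x. cvs.representation B x b"] by auto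
  have lin: "linear_map_on UNIV UNIV g"
    using g(1) module_hom.add[OF g(1)[unfolded Vector_Spaces.linear_iff_module_hom]]
      module_hom.scale[OF g(1)[unfolded Vector_Spaces.linear_iff_module_hom]]
    by (auto simp: linear_map_on_def)
  have "cvs.span B \<subseteq> {x \<in> cvs.span B. g x - cvs.representation B x b = 0}"
  proof (rule cvs.span_minimal)
    show "B \<subseteq> {x \<in> cvs.span B. g x - cvs.representation B x b = 0}"
      using g(2) by (auto intro: cvs.span_base)
    show "cvs.subspace {x \<in> cvs.span B. g x - cvs.representation B x b = 0}"
      using linear_map_on_zero[OF lin cvs.subspace_UNIV] linear_map_onD(2,3)[OF lin] B
        cvs.span_zero[of B] cvs.span_add[of _ B] cvs.span_scale[of _ B]
      by (auto simp: cvs.subspace_def cvs.representation_zero cvs.representation_add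
          cvs.representation_scale)
  qed
  thus thesis using that[OF lin] by auto
qed

lemma sum_fun_apply: "(\<Sum>i\<in>I. f i) x = (\<Sum>i\<in>I. f i x)"
  for f :: "'i \<Rightarrow> 'a \<Rightarrow> 'b::comm_monoid_add"
  by (induction I rule: infinite_finite_induct) auto

text \<open>Independent subsets of the sets \<open>A K\<close> have at most \<open>card F\<close>
  elements, so some \<open>K0\<close> contains one of maximal size. An element of another
  \<open>A K\<close> outside its span would, inside a common upper bound \<open>M\<close>, give an
  independent set with one more element. It is applied to sets of operators coming from growing
  compact open subgroups.\<close>

lemma directed_span_stabilizes:
  assumes F: "finite F" and ne: "\<K> \<noteq> {}" and sub: "\<And>K. K \<in> \<K> \<Longrightarrow> A K \<subseteq> cvs.span F"
    and dir: "\<And>K L. K \<in> \<K> \<Longrightarrow> L \<in> \<K> \<Longrightarrow> \<exists>M\<in>\<K>. A K \<union> A L \<subseteq> A M"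
  shows "\<exists>K0\<in>\<K>. \<forall>K\<in>\<K>. A K \<subseteq> cvs.span (A K0)"
proof -
  define P where "P = (\<lambda>n. \<exists>K\<in>\<K>. \<exists>I. cvs.independent I \<and> I \<subseteq> A K \<and> card I = n)"
  have bound: "finite I \<and> card I \<le> card F" if "K \<in> \<K>" "cvs.independent I" "I \<subseteq> A K" for K I
    using cvs.independent_span_bound[OF F that(2)] sub[OF that(1)] that(3) by blast
  have "P 0" using ne cvs.independent_empty unfolding P_def by fastforce
  moreover have "\<And>n. P n \<Longrightarrow> n \<le> card F" using bound unfolding P_def by blast
  ultimately obtain n where n: "P n" "\<And>m. P m \<Longrightarrow> m \<le> n"
    using Nat.ex_has_greatest_nat[of P 0 "card F"] by blast
  obtain K0 I where K0: "K0 \<in> \<K>" "cvs.independent I" "I \<subseteq> A K0" "card I = n"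
    using n(1) unfolding P_def by blast
  have "A K \<subseteq> cvs.span (A K0)" if K: "K \<in> \<K>" for K
  proof
    fix x assume x: "x \<in> A K"
    have "x \<in> cvs.span I"
    proof (rule ccontr)
      assume nx: "x \<notin> cvs.span I"
      obtain M where M: "M \<in> \<K>" "A K \<union> A K0 \<subseteq> A M" using dir[OF K K0(1)] by blast
      have "cvs.independent (insert x I)" using nx K0(2) by (simp add: cvs.independent_insert)
      hence "P (card (insert x I))" using M x K0(3) unfolding P_def by blast
      moreover have "card (insert x I) = Suc n"
        using nx K0(4) bound[OF K0(1-3)] cvs.span_base by (metis card_insert_disjoint)
      ultimately show False using n(2) by fastforce
    qed
    thus "x \<in> cvs.span (A K0)" using cvs.span_mono[OF K0(3)] by blast
  qed
  thus ?thesis using K0(1) by blast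
qed

section \<open>Compact groups and finite coset sums\<close>

lemma topological_group_group: "topological_group G T \<Longrightarrow> group G"
  unfolding topological_group_def by blast

lemma continuous_map_mult:
  assumes "topological_group G T" "continuous_map X T f" "continuous_map X T g"
  shows "continuous_map X T (\<lambda>x. f x \<otimes>\<^bsub>G\<^esub> g x)"
proof -
  have "continuous_map X (prod_topology T T) (\<lambda>x. (f x, g x))"
    using assms(2,3) by (simp add: continuous_map_pairwise o_def)
  thus ?thesis
    using continuous_map_compose[of X "prod_topology T T" "\<lambda>x. (f x, g x)" T "\<lambda>(x, y). x \<otimes>\<^bsub>G\<^esub> y"]
      assms(1) unfolding topological_group_def by (simp add: o_def)
qed

lemma openin_r_coset:
  assumes G: "topological_group G T" and U: "openin T U" and g: "g \<in> carrier G"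
  shows "openin T (U #>\<^bsub>G\<^esub> g)"
proof -
  interpret group G using G by (rule topological_group_group)
  have top: "topspace T = carrier G" using G unfolding topological_group_def by blast
  have UG: "U \<subseteq> carrier G" using openin_subset[OF U] top by simp
  have "continuous_map T T (\<lambda>x. x \<otimes>\<^bsub>G\<^esub> inv\<^bsub>G\<^esub> g)"
    using continuous_map_mult[OF G, of T "\<lambda>x. x" "\<lambda>_. inv\<^bsub>G\<^esub> g"] g top by simp
  hence "openin T {x \<in> topspace T. x \<otimes>\<^bsub>G\<^esub> inv\<^bsub>G\<^esub> g \<in> U}"
    using U by (rule openin_continuous_map_preimage)
  moreover have "{x \<in> topspace T. x \<otimes>\<^bsub>G\<^esub> inv\<^bsub>G\<^esub> g \<in> U} = U #>\<^bsub>G\<^esub> g"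
  proof (intro equalityI subsetI)
    fix x assume "x \<in> {x \<in> topspace T. x \<otimes>\<^bsub>G\<^esub> inv\<^bsub>G\<^esub> g \<in> U}"
    hence x: "x \<in> carrier G" "x \<otimes>\<^bsub>G\<^esub> inv\<^bsub>G\<^esub> g \<in> U" using top by auto
    moreover have "x = (x \<otimes>\<^bsub>G\<^esub> inv\<^bsub>G\<^esub> g) \<otimes>\<^bsub>G\<^esub> g" using x g by (simp add: m_assoc)
    ultimately show "x \<in> U #>\<^bsub>G\<^esub> g" unfolding r_coset_def by blast
  next
    fix x assume "x \<in> U #>\<^bsub>G\<^esub> g"
    then obtain u where u: "u \<in> U" "x = u \<otimes>\<^bsub>G\<^esub> g" unfolding r_coset_def by blast
    thus "x \<in> {x \<in> topspace T. x \<otimes>\<^bsub>G\<^esub> inv\<^bsub>G\<^esub> g \<in> U}" using UG g top by (auto simp: m_assoc)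
  qed
  ultimately show ?thesis by simp
qed

lemma openin_of_r_cosets:
  assumes G: "topological_group G T" and N: "openin T N" "\<one>\<^bsub>G\<^esub> \<in> N" and A: "A \<subseteq> carrier G"
    and closed: "\<And>n a. n \<in> N \<Longrightarrow> a \<in> A \<Longrightarrow> n \<otimes>\<^bsub>G\<^esub> a \<in> A"
  shows "openin T A"
proof -
  interpret group G using G by (rule topological_group_group)
  have "A = (\<Union>a\<in>A. N #>\<^bsub>G\<^esub> a)"
  proof (intro equalityI subsetI)
    fix a assume a: "a \<in> A"
    hence "a = \<one>\<^bsub>G\<^esub> \<otimes>\<^bsub>G\<^esub> a" using A by auto
    thus "a \<in> (\<Union>a\<in>A. N #>\<^bsub>G\<^esub> a)" using a N(2) unfolding r_coset_def by blast
  qed (use closed in \<open>auto simp: r_coset_def\<close>)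
  moreover have "openin T (\<Union>a\<in>A. N #>\<^bsub>G\<^esub> a)"
    using openin_r_coset[OF G N(1)] A by (intro openin_Union) auto
  ultimately show ?thesis by simp
qed

definition open_subgroup :: "('g, 'b) monoid_scheme \<Rightarrow> 'g topology \<Rightarrow> 'g set \<Rightarrow> bool" where
  "open_subgroup G T N \<longleftrightarrow> subgroup N G \<and> openin T N"

text \<open>Intersecting with \<open>carrier G\<close> makes the empty family yield the whole group
  instead of the universe of the type.\<close>

lemma open_subgroup_INT:
  assumes G: "topological_group G T" and fin: "finite I"
    and N: "\<And>i. i \<in> I \<Longrightarrow> open_subgroup G T (N i)"
  shows "open_subgroup G T (carrier G \<inter> (\<Inter>i\<in>I. N i))"
proof -
  interpret group G using G by (rule topological_group_group)
  show ?thesis using fin N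
  proof (induction I)
    case empty
    show ?case using subgroup_self G unfolding open_subgroup_def topological_group_def
      by (metis INT_empty inf_top.right_neutral openin_topspace)
  next
    case (insert i I)
    have "carrier G \<inter> (\<Inter>i\<in>insert i I. N i) = N i \<inter> (carrier G \<inter> (\<Inter>i\<in>I. N i))" by blast
    thus ?case using insert subgroups_Inter_pair unfolding open_subgroup_def
      by (simp add: openin_Int)
  qed
qed

text \<open>An unnormalized substitute for the Haar integral over \<open>G\<close>. The
  representative of each coset \<open>N k\<close> is arbitrary; the value does not depend on it when
  \<open>F\<close> is left \<open>N\<close>-invariant. Division by the index is written out where an
  average is meant.\<close>

definition coset_sum :: "('g, 'b) monoid_scheme \<Rightarrow> 'g set \<Rightarrow> ('g \<Rightarrow> 'v::comm_monoid_add) \<Rightarrow> 'v" where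
  "coset_sum G N F = (\<Sum>C\<in>rcosets\<^bsub>G\<^esub> N. F (SOME k. k \<in> C))"

context group
begin

lemma rcoset_some:
  assumes "subgroup N G" "C \<in> rcosets N"
  shows "(SOME k. k \<in> C) \<in> C" "(SOME k. k \<in> C) \<in> carrier G"
proof -
  have "C \<noteq> {}" using subgroup.rcosets_non_empty[OF assms] .
  thus *: "(SOME k. k \<in> C) \<in> C" by (simp add: some_in_eq)
  show "(SOME k. k \<in> C) \<in> carrier G"
    using subgroup.rcosets_carrier[OF assms(1) group_axioms assms(2)] * by blast
qed

lemma coset_sum_cong:
  assumes "subgroup N G" "\<And>k. k \<in> carrier G \<Longrightarrow> F k = F' k"
  shows "coset_sum G N F = coset_sum G N F'"
  unfolding coset_sum_def using assms rcoset_some(2) by (intro sum.cong) auto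

lemma coset_sum_const:
  fixes x :: "'v::complex_vector"
  shows "coset_sum G N (\<lambda>_. x) = of_nat (card (rcosets N)) *\<^sub>C x"
proof -
  have "(\<Sum>C\<in>A. x) = of_nat (card A) *\<^sub>C x" for A :: "'a set set"
    by (induction A rule: infinite_finite_induct) (auto simp: scaleC_add_left scaleC_one)
  thus ?thesis unfolding coset_sum_def .
qed

text \<open>Right multiplication by \<open>h\<close> permutes the right cosets. It need not match
  the chosen representatives with each other, but left invariance of \<open>F\<close> makes any
  element of the coset \<open>N k h\<close> as good as the chosen one.\<close>

lemma coset_sum_shift:
  assumes N: "subgroup N G" and inv: "\<And>n k. n \<in> N \<Longrightarrow> k \<in> carrier G \<Longrightarrow> F (n \<otimes> k) = F k"
    and h: "h \<in> carrier G"
  shows "coset_sum G N (\<lambda>k. F (k \<otimes> h)) = coset_sum G N F"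
proof -
  have NG: "N \<subseteq> carrier G" using N subgroup.subset by blast
  have rep: "F (SOME k. k \<in> N #> a) = F a" if "a \<in> carrier G" for a
  proof -
    have "(SOME k. k \<in> N #> a) \<in> N #> a" using rcoset_some(1)[OF N] rcosetsI[OF NG that] by blast
    thus ?thesis using inv that unfolding r_coset_def by auto
  qed
  have trans: "(N #> a) #> b = N #> (a \<otimes> b)" if "a \<in> carrier G" "b \<in> carrier G" for a b
    using coset_mult_assoc[OF NG that] .
  have eq: "F ((SOME k. k \<in> C) \<otimes> h) = F (SOME k. k \<in> C #> h)" if C: "C \<in> rcosets N" for C
  proof -
    obtain a where a: "a \<in> carrier G" "C = N #> a" using C unfolding RCOSETS_def by blast
    have "(SOME k. k \<in> N #> a) \<in> N #> a" using rcoset_some(1)[OF N] C a by blast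
    then obtain n where n: "n \<in> N" "(SOME k. k \<in> N #> a) = n \<otimes> a" unfolding r_coset_def by blast
    have "F ((n \<otimes> a) \<otimes> h) = F (a \<otimes> h)" using inv n a h NG by (subst m_assoc) auto
    thus ?thesis using rep[of "a \<otimes> h"] a h n trans[OF a(1) h] by simp
  qed
  have bij: "bij_betw (\<lambda>C. C #> h) (rcosets N) (rcosets N)"
  proof (rule bij_betwI[where g = "\<lambda>C. C #> inv h"])
    show "(\<lambda>C. C #> h) \<in> (rcosets N) \<rightarrow> (rcosets N)"
      using trans h rcosetsI[OF NG] by (auto simp: RCOSETS_def[of G N])
    show "(\<lambda>C. C #> inv h) \<in> (rcosets N) \<rightarrow> (rcosets N)"
      using trans h rcosetsI[OF NG] by (auto simp: RCOSETS_def[of G N])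
  qed (use trans h in \<open>auto simp: RCOSETS_def[of G N] m_assoc\<close>)
  have "coset_sum G N (\<lambda>k. F (k \<otimes> h)) = (\<Sum>C\<in>rcosets N. F (SOME k. k \<in> C #> h))"
    unfolding coset_sum_def using eq by (intro sum.cong) auto
  also have "\<dots> = coset_sum G N F"
    unfolding coset_sum_def by (rule sum.reindex_bij_betw[OF bij])
  finally show ?thesis .
qed

lemma finite_image_left_invariant:
  assumes N: "subgroup N G" "finite (rcosets N)"
    and inv: "\<And>n k. n \<in> N \<Longrightarrow> k \<in> carrier G \<Longrightarrow> F (n \<otimes> k) = F k"
  shows "finite (F ` carrier G)"
proof -
  have NG: "N \<subseteq> carrier G" using N(1) subgroup.subset by blast
  have "F ` carrier G \<subseteq> (\<lambda>C. F (SOME k. k \<in> C)) ` (rcosets N)"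
  proof
    fix y assume "y \<in> F ` carrier G"
    then obtain a where a: "a \<in> carrier G" "y = F a" by blast
    have C: "N #> a \<in> rcosets N" using rcosetsI[OF NG a(1)] .
    have "(SOME k. k \<in> N #> a) \<in> N #> a" using rcoset_some(1)[OF N(1) C] .
    hence "F (SOME k. k \<in> N #> a) = F a" using inv a unfolding r_coset_def by auto
    thus "y \<in> (\<lambda>C. F (SOME k. k \<in> C)) ` (rcosets N)" using a C by force
  qed
  thus ?thesis using N(2) finite_surj by blast
qed

end

locale compact_group = group G for G (structure) +
  fixes T :: "'a topology"
  assumes topological: "topological_group G T" and compact: "compact_space T"
begin

lemma topspace_eq: "topspace T = carrier G"
  using topological unfolding topological_group_def by blast

text \<open>The cosets are an open cover of a compact space. Since they are pairwise disjoint, a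
  finite subcover already contains each of them.\<close>

lemma finite_rcosets:
  assumes "open_subgroup G T N"
  shows "finite (rcosets N)"
proof -
  have N: "subgroup N G" "openin T N" using assms unfolding open_subgroup_def by auto
  have NG: "N \<subseteq> carrier G" using N(1) subgroup.subset by blast
  have "\<forall>C\<in>rcosets N. openin T C"
    using openin_r_coset[OF topological N(2)] unfolding RCOSETS_def by blast
  moreover have "\<Union>(rcosets N) = topspace T" using rcosets_part_G[OF N(1)] topspace_eq by simp
  ultimately obtain \<F> where F: "finite \<F>" "\<F> \<subseteq> rcosets N" "topspace T \<subseteq> \<Union>\<F>"
    using compact unfolding compact_space_alt by (metis subset_refl)
  have "rcosets N \<subseteq> \<F>"
  proof
    fix C assume C: "C \<in> rcosets N"
    obtain k where k: "k \<in> C" "k \<in> carrier G" using rcoset_some[OF N(1) C] by blast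
    then obtain D where D: "D \<in> \<F>" "k \<in> D" using F(3) topspace_eq by blast
    hence "C = D" using rcos_disjoint[OF N(1)] C F(2) k unfolding pairwise_def disjnt_def by blast
    thus "C \<in> \<F>" using D by simp
  qed
  thus ?thesis using F(1) finite_subset by blast
qed

lemma card_rcosets_pos:
  assumes "open_subgroup G T N"
  shows "card (rcosets N) > 0"
  using finite_rcosets[OF assms] assms subgroup.subgroup_in_rcosets[OF _ group_axioms, of N]
  unfolding open_subgroup_def by (auto simp: card_gt_0_iff)

text \<open>The complement is stable under left multiplication by \<open>N\<close>, hence a union of
  open cosets; so \<open>N\<close> is closed in a compact space.\<close>

lemma compactin_open_subgroup:
  assumes "open_subgroup G T N"
  shows "compactin T N"
proof -
  have N: "subgroup N G" "openin T N" using assms unfolding open_subgroup_def by auto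
  have NG: "N \<subseteq> carrier G" using N(1) subgroup.subset by blast
  have "openin T (carrier G - N)"
  proof (rule openin_of_r_cosets[OF topological N(2)])
    show "n \<otimes> a \<in> carrier G - N" if "n \<in> N" "a \<in> carrier G - N" for n a
    proof -
      have "a = inv n \<otimes> (n \<otimes> a)" using that NG by (auto simp: m_assoc[symmetric])
      hence "n \<otimes> a \<notin> N"
        using that subgroup.m_closed[OF N(1)] subgroup.m_inv_closed[OF N(1)] by (metis DiffD2)
      thus ?thesis using that NG by auto
    qed
  qed (use subgroup.one_closed[OF N(1)] in auto)
  hence "closedin T N" using NG topspace_eq by (simp add: closedin_def)
  thus ?thesis using compact by (rule closedin_compact_space[rotated])
qed

text \<open>The conjugate of \<open>N\<close> by \<open>k\<close> cut out in \<open>conjN k\<close>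
  depends only on the coset \<open>N k\<close>. Intersecting over one representative per coset
  therefore gives the full intersection of conjugates, and finiteness keeps it open.\<close>

lemma open_normal_core:
  assumes "open_subgroup G T N"
  obtains M where "open_subgroup G T M" "M \<subseteq> N"
    "\<And>k n. k \<in> carrier G \<Longrightarrow> n \<in> M \<Longrightarrow> k \<otimes> n \<otimes> inv k \<in> M"
proof -
  have N: "subgroup N G" "openin T N" using assms unfolding open_subgroup_def by auto
  have NG: "N \<subseteq> carrier G" using N(1) subgroup.subset by blast
  have cancel: "inv a \<otimes> (a \<otimes> x) = x" if "a \<in> carrier G" "x \<in> carrier G" for a x
    using that by (simp flip: m_assoc)
  define conjN where "conjN = (\<lambda>k. {n \<in> carrier G. k \<otimes> n \<otimes> inv k \<in> N})"
  define R where "R = (\<lambda>C. SOME k. k \<in> C) ` (rcosets N)"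
  have RG: "R \<subseteq> carrier G" using rcoset_some(2)[OF N(1)] unfolding R_def by blast
  have conj_open: "open_subgroup G T (conjN k)" if k: "k \<in> carrier G" for k
    unfolding open_subgroup_def
  proof
    show "subgroup (conjN k) G"
    proof (rule subgroupI)
      have "k \<otimes> \<one> \<otimes> inv k \<in> N" using k subgroup.one_closed[OF N(1)] by simp
      thus "conjN k \<noteq> {}" unfolding conjN_def by blast
    next
      fix a assume "a \<in> conjN k"
      hence a: "a \<in> carrier G" "k \<otimes> a \<otimes> inv k \<in> N" unfolding conjN_def by auto
      have "inv (k \<otimes> a \<otimes> inv k) = k \<otimes> inv a \<otimes> inv k"
        using a k by (simp add: inv_mult_group m_assoc)
      thus "inv a \<in> conjN k" using a subgroup.m_inv_closed[OF N(1) a(2)] unfolding conjN_def by simp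
    next
      fix a b assume "a \<in> conjN k" "b \<in> conjN k"
      hence a: "a \<in> carrier G" "k \<otimes> a \<otimes> inv k \<in> N" and b: "b \<in> carrier G" "k \<otimes> b \<otimes> inv k \<in> N"
        unfolding conjN_def by auto
      have "(k \<otimes> a \<otimes> inv k) \<otimes> (k \<otimes> b \<otimes> inv k) = k \<otimes> (a \<otimes> b) \<otimes> inv k"
        using a b k cancel[of k "b \<otimes> inv k"] by (simp add: m_assoc)
      thus "a \<otimes> b \<in> conjN k" using a b subgroup.m_closed[OF N(1) a(2) b(2)] unfolding conjN_def by simp
    qed (auto simp: conjN_def)
    have "continuous_map T T (\<lambda>n. k \<otimes> n \<otimes> inv k)"
      using k topspace_eq by (intro continuous_map_mult[OF topological]) auto
    from openin_continuous_map_preimage[OF this N(2)]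
    show "openin T (conjN k)" unfolding conjN_def topspace_eq .
  qed
  define M where "M = carrier G \<inter> (\<Inter>k\<in>R. conjN k)"
  have M: "open_subgroup G T M" unfolding M_def
    using conj_open RG finite_rcosets[OF assms]
    by (intro open_subgroup_INT[OF topological]) (auto simp: R_def)
  \<comment> \<open>With \<open>r = m \<otimes> k\<close> and \<open>m\<close> in \<open>N\<close>,
    conjugation by \<open>k\<close> is conjugation by \<open>r\<close> followed by conjugation by
    \<open>inv m\<close>, and the latter preserves \<open>N\<close>.\<close>
  have Mall: "k \<otimes> n \<otimes> inv k \<in> N" if n: "n \<in> M" and k: "k \<in> carrier G" for n k
  proof -
    define r where "r = (SOME x. x \<in> N #> k)"
    have C: "N #> k \<in> rcosets N" using rcosetsI[OF NG k] .
    have r: "r \<in> R" "r \<in> N #> k" using C rcoset_some(1)[OF N(1) C] unfolding r_def R_def by auto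
    then obtain m where m: "m \<in> N" "r = m \<otimes> k" unfolding r_coset_def by blast
    have mG: "m \<in> carrier G" "n \<in> carrier G" using m NG n unfolding M_def by auto
    have "r \<otimes> n \<otimes> inv r \<in> N" using n r(1) unfolding M_def conjN_def by blast
    hence "inv m \<otimes> (r \<otimes> n \<otimes> inv r) \<otimes> m \<in> N"
      using m(1) subgroup.m_closed[OF N(1)] subgroup.m_inv_closed[OF N(1)] by blast
    moreover have "inv m \<otimes> (r \<otimes> n \<otimes> inv r) \<otimes> m = k \<otimes> n \<otimes> inv k"
    proof -
      have "inv m \<otimes> (m \<otimes> (k \<otimes> n \<otimes> inv k) \<otimes> inv m) \<otimes> m = k \<otimes> n \<otimes> inv k"
        using mG k cancel[of m "k \<otimes> n \<otimes> inv k"] by (simp add: m_assoc)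
      moreover have "r \<otimes> n \<otimes> inv r = m \<otimes> (k \<otimes> n \<otimes> inv k) \<otimes> inv m"
        using mG k m(2) by (simp add: inv_mult_group m_assoc)
      ultimately show ?thesis by simp
    qed
    ultimately show ?thesis by simp
  qed
  show thesis
  proof (rule that[OF M])
    show "M \<subseteq> N" using Mall[of _ \<one>] unfolding M_def by auto
    fix k n assume k: "k \<in> carrier G" and n: "n \<in> M"
    have nG: "n \<in> carrier G" using n unfolding M_def by blast
    have "r \<otimes> (k \<otimes> n \<otimes> inv k) \<otimes> inv r \<in> N" if "r \<in> R" for r
    proof -
      have rG: "r \<in> carrier G" using that RG by blast
      have "(r \<otimes> k) \<otimes> n \<otimes> inv (r \<otimes> k) \<in> N" using Mall[OF n] rG k by blast
      thus ?thesis using rG k nG by (simp add: inv_mult_group m_assoc)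
    qed
    thus "k \<otimes> n \<otimes> inv k \<in> M" using k nG unfolding M_def conjN_def by auto
  qed
qed

end

section \<open>Averaging over a compact group\<close>

lemma (in group) coset_sum_mem:
  fixes F :: "'a \<Rightarrow> 'v::complex_vector"
  assumes "subgroup N G" "cvs.subspace S" "\<And>k. k \<in> carrier G \<Longrightarrow> F k \<in> S"
  shows "coset_sum G N F \<in> S"
  unfolding coset_sum_def using assms rcoset_some(2) by (intro cvs.subspace_sum) auto

lemma (in group) linear_coset_sum:
  assumes N: "subgroup N G" and f: "linear_map_on V W f" "cvs.subspace V"
    and F: "\<And>k. k \<in> carrier G \<Longrightarrow> F k \<in> V"
  shows "f (coset_sum G N F) = coset_sum G N (\<lambda>k. f (F k))"
  unfolding coset_sum_def using F rcoset_some(2)[OF N] by (intro linear_map_on_sum[OF f]) auto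

locale group_representation = group G for G (structure) +
  fixes \<pi> :: "('a, 'v::complex_vector) crep"
  assumes rep: "group_rep G \<pi>"
begin

lemma subspace_vspace: "cvs.subspace (vspace \<pi>)"
  and linear_action: "g \<in> carrier G \<Longrightarrow> linear_map_on (vspace \<pi>) (vspace \<pi>) (action \<pi> g)"
  and action_one: "v \<in> vspace \<pi> \<Longrightarrow> action \<pi> \<one> v = v"
  and action_mult: "g \<in> carrier G \<Longrightarrow> h \<in> carrier G \<Longrightarrow> v \<in> vspace \<pi> \<Longrightarrow>
    action \<pi> (g \<otimes> h) v = action \<pi> g (action \<pi> h v)"
  using rep unfolding group_rep_def by auto

lemma action_mem: "g \<in> carrier G \<Longrightarrow> v \<in> vspace \<pi> \<Longrightarrow> action \<pi> g v \<in> vspace \<pi>"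
  and action_add: "g \<in> carrier G \<Longrightarrow> v \<in> vspace \<pi> \<Longrightarrow> w \<in> vspace \<pi> \<Longrightarrow>
    action \<pi> g (v + w) = action \<pi> g v + action \<pi> g w"
  and action_scale: "g \<in> carrier G \<Longrightarrow> v \<in> vspace \<pi> \<Longrightarrow> action \<pi> g (c *\<^sub>C v) = c *\<^sub>C action \<pi> g v"
  using linear_map_onD[OF linear_action] by blast+

lemma action_zero: "g \<in> carrier G \<Longrightarrow> action \<pi> g 0 = 0"
  using linear_map_on_zero[OF linear_action subspace_vspace] .

lemma action_inv:
  assumes "g \<in> carrier G" "v \<in> vspace \<pi>"
  shows "action \<pi> (inv g) (action \<pi> g v) = v" "action \<pi> g (action \<pi> (inv g) v) = v"
  using assms action_mult[of "inv g" g v] action_mult[of g "inv g" v] action_one by simp_all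

lemma subgroup_stabilizer:
  assumes v: "v \<in> vspace \<pi>"
  shows "subgroup {g \<in> carrier G. action \<pi> g v = v} G"
proof (rule subgroupI)
  show "{g \<in> carrier G. action \<pi> g v = v} \<noteq> {}" using action_one[OF v] by blast
  fix g assume g: "g \<in> {g \<in> carrier G. action \<pi> g v = v}"
  show "inv g \<in> {g \<in> carrier G. action \<pi> g v = v}" using g action_inv(1)[of g v] v by simp
  fix h assume "h \<in> {g \<in> carrier G. action \<pi> g v = v}"
  thus "g \<otimes> h \<in> {g \<in> carrier G. action \<pi> g v = v}" using g action_mult[of g h v] v by simp
qed blast

lemma subspace_fixed_vectors:
  assumes "K \<subseteq> carrier G"
  shows "cvs.subspace (fixed_vectors K \<pi>)"
  using assms subspace_vspace action_zero action_add action_scale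
  unfolding cvs.subspace_def fixed_vectors_def by (auto simp: subset_iff)

lemma subrepresentation:
  assumes "cvs.subspace Y" "Y \<subseteq> vspace \<pi>" "\<And>g. g \<in> carrier G \<Longrightarrow> action \<pi> g ` Y \<subseteq> Y"
  shows "group_rep G (\<pi>\<lparr>vspace := Y\<rparr>)"
  using assms subsetD[OF assms(2)] action_one action_mult action_add action_scale
  by (simp add: group_rep_def linear_map_on_def)

end

text \<open>The average over \<open>k\<close> of \<open>\<tau>(k)^-1 A \<sigma>(k)\<close>, where
  \<open>A\<close> is the finite-rank map
  \<open>w \<mapsto> \<Sum>i. \<zeta> i w *\<^sub>C u i\<close>. Writing \<open>A\<close> through
  functionals and vectors allows \<open>N\<close>-invariance to be imposed on each of them
  separately. The value 0 off the space is the convention of \<open>Hom_rep\<close>.\<close>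

definition intertwining_average ::
  "('g, 'b) monoid_scheme \<Rightarrow> 'g set \<Rightarrow> ('g, 'v::complex_vector) crep \<Rightarrow>
   ('g, 'w::complex_vector) crep \<Rightarrow> 'i set \<Rightarrow> ('i \<Rightarrow> 'v \<Rightarrow> complex) \<Rightarrow> ('i \<Rightarrow> 'w) \<Rightarrow> 'v \<Rightarrow> 'w" where
  "intertwining_average G N \<sigma> \<tau> I \<zeta> u = (\<lambda>w. if w \<in> vspace \<sigma> then
     inverse (of_nat (card (rcosets\<^bsub>G\<^esub> N))) *\<^sub>C
       coset_sum G N (\<lambda>k. \<Sum>i\<in>I. \<zeta> i (action \<sigma> k w) *\<^sub>C action \<tau> (inv\<^bsub>G\<^esub> k) (u i))
     else 0)"

text \<open>The summand is left \<open>N\<close>-invariant in \<open>k\<close>; replacing \<open>w\<close> by \<open>\<sigma>(h) w\<close> amounts to a right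
  translation of \<open>k\<close> by \<open>h\<close>, which permutes the cosets \<open>N k\<close>.\<close>

lemma intertwining_average_Hom:
  assumes G: "group G" and N: "subgroup N G" and \<sigma>: "group_rep G \<sigma>" and \<tau>: "group_rep G \<tau>"
    and \<zeta>: "\<And>i. i \<in> I \<Longrightarrow> linear_map_on (vspace \<sigma>) UNIV (\<zeta> i)"
      "\<And>i n w. i \<in> I \<Longrightarrow> n \<in> N \<Longrightarrow> w \<in> vspace \<sigma> \<Longrightarrow> \<zeta> i (action \<sigma> n w) = \<zeta> i w"
    and u: "\<And>i. i \<in> I \<Longrightarrow> u i \<in> vspace \<tau>"
      "\<And>i n. i \<in> I \<Longrightarrow> n \<in> N \<Longrightarrow> action \<tau> n (u i) = u i"
  shows "intertwining_average G N \<sigma> \<tau> I \<zeta> u \<in> Hom_rep (carrier G) \<sigma> \<tau>"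
proof -
  interpret \<sigma>: group_representation G \<sigma> using G \<sigma> by (simp add: group_representation_def group_representation_axioms_def)
  interpret \<tau>: group_representation G \<tau> using G \<tau> by (simp add: group_representation_def group_representation_axioms_def)
  have NG: "N \<subseteq> carrier G" using N subgroup.subset by blast
  define F where "F = (\<lambda>w k. \<Sum>i\<in>I. \<zeta> i (action \<sigma> k w) *\<^sub>C action \<tau> (inv\<^bsub>G\<^esub> k) (u i))"
  define c where "c = (inverse (of_nat (card (rcosets\<^bsub>G\<^esub> N))) :: complex)"
  have avg: "intertwining_average G N \<sigma> \<tau> I \<zeta> u w = c *\<^sub>C coset_sum G N (F w)"
    if "w \<in> vspace \<sigma>" for w
    using that unfolding intertwining_average_def F_def c_def by simp
  have F_mem: "F w k \<in> vspace \<tau>" if "k \<in> carrier G" for w k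
    unfolding F_def using that u(1) \<tau>.action_mem
    by (intro cvs.subspace_sum[OF \<tau>.subspace_vspace] cvs.subspace_scale[OF \<tau>.subspace_vspace]) auto
  have sum_mem: "coset_sum G N (F w) \<in> vspace \<tau>" for w
    using \<sigma>.coset_sum_mem[OF N \<tau>.subspace_vspace] F_mem by blast
  have F_add: "F (x + y) k = F x k + F y k"
    if "x \<in> vspace \<sigma>" "y \<in> vspace \<sigma>" "k \<in> carrier G" for x y k
    unfolding F_def sum.distrib[symmetric]
    using that linear_map_onD(2)[OF \<zeta>(1)]
    by (intro sum.cong) (auto simp: \<sigma>.action_add \<sigma>.action_mem scaleC_add_left)
  have F_scale: "F (a *\<^sub>C x) k = a *\<^sub>C F x k" if "x \<in> vspace \<sigma>" "k \<in> carrier G" for a x k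
    unfolding F_def cvs.scale_sum_right
    using that linear_map_onD(3)[OF \<zeta>(1)]
    by (intro sum.cong) (auto simp: \<sigma>.action_scale \<sigma>.action_mem scaleC_scaleC)
  have F_inv: "F w (n \<otimes>\<^bsub>G\<^esub> k) = F w k"
    if "n \<in> N" "k \<in> carrier G" "w \<in> vspace \<sigma>" for n k w
    unfolding F_def
  proof (rule sum.cong[OF refl])
    fix i assume i: "i \<in> I"
    have n: "n \<in> carrier G" "inv\<^bsub>G\<^esub> n \<in> N" using that NG subgroup.m_inv_closed[OF N] by auto
    have "\<zeta> i (action \<sigma> (n \<otimes>\<^bsub>G\<^esub> k) w) = \<zeta> i (action \<sigma> k w)"
      using \<zeta>(2) i that n \<sigma>.action_mem by (simp add: \<sigma>.action_mult)
    moreover have "action \<tau> (inv\<^bsub>G\<^esub> (n \<otimes>\<^bsub>G\<^esub> k)) (u i) = action \<tau> (inv\<^bsub>G\<^esub> k) (u i)"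
      using u i that n by (simp add: \<sigma>.inv_mult_group \<tau>.action_mult)
    ultimately show "\<zeta> i (action \<sigma> (n \<otimes>\<^bsub>G\<^esub> k) w) *\<^sub>C action \<tau> (inv\<^bsub>G\<^esub> (n \<otimes>\<^bsub>G\<^esub> k)) (u i)
      = \<zeta> i (action \<sigma> k w) *\<^sub>C action \<tau> (inv\<^bsub>G\<^esub> k) (u i)" by simp
  qed
  have F_shift: "F (action \<sigma> h w) k = action \<tau> h (F w (k \<otimes>\<^bsub>G\<^esub> h))"
    if "h \<in> carrier G" "k \<in> carrier G" "w \<in> vspace \<sigma>" for h k w
  proof -
    have "action \<tau> h (F w (k \<otimes>\<^bsub>G\<^esub> h)) = (\<Sum>i\<in>I. action \<tau> h
        (\<zeta> i (action \<sigma> (k \<otimes>\<^bsub>G\<^esub> h) w) *\<^sub>C action \<tau> (inv\<^bsub>G\<^esub> (k \<otimes>\<^bsub>G\<^esub> h)) (u i)))"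
      unfolding F_def using that u(1) \<tau>.action_mem
      by (intro linear_map_on_sum[OF \<tau>.linear_action \<tau>.subspace_vspace]
          cvs.subspace_scale[OF \<tau>.subspace_vspace]) auto
    also have "\<dots> = F (action \<sigma> h w) k"
      unfolding F_def
    proof (rule sum.cong[OF refl])
      fix i assume i: "i \<in> I"
      have "action \<tau> h (action \<tau> (inv\<^bsub>G\<^esub> (k \<otimes>\<^bsub>G\<^esub> h)) (u i)) = action \<tau> (inv\<^bsub>G\<^esub> k) (u i)"
        using that u(1)[OF i] \<tau>.action_mem by (simp add: \<sigma>.inv_mult_group \<tau>.action_mult \<tau>.action_inv)
      thus "action \<tau> h (\<zeta> i (action \<sigma> (k \<otimes>\<^bsub>G\<^esub> h) w) *\<^sub>C action \<tau> (inv\<^bsub>G\<^esub> (k \<otimes>\<^bsub>G\<^esub> h)) (u i))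
        = \<zeta> i (action \<sigma> k (action \<sigma> h w)) *\<^sub>C action \<tau> (inv\<^bsub>G\<^esub> k) (u i)"
        using that u(1)[OF i] \<tau>.action_mem by (simp add: \<tau>.action_scale \<sigma>.action_mult)
    qed
    finally show ?thesis by simp
  qed
  show ?thesis
    unfolding Hom_rep_def linear_map_on_def mem_Collect_eq
  proof (intro conjI ballI allI impI)
    show "intertwining_average G N \<sigma> \<tau> I \<zeta> u ` vspace \<sigma> \<subseteq> vspace \<tau>"
      using sum_mem cvs.subspace_scale[OF \<tau>.subspace_vspace] by (auto simp: avg)
  next
    fix x y assume xy: "x \<in> vspace \<sigma>" "y \<in> vspace \<sigma>"
    have "coset_sum G N (F (x + y)) = coset_sum G N (\<lambda>k. F x k + F y k)"
      using F_add[OF xy] by (intro \<sigma>.coset_sum_cong[OF N]) auto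
    thus "intertwining_average G N \<sigma> \<tau> I \<zeta> u (x + y) =
      intertwining_average G N \<sigma> \<tau> I \<zeta> u x + intertwining_average G N \<sigma> \<tau> I \<zeta> u y"
      using xy cvs.subspace_add[OF \<sigma>.subspace_vspace xy]
      by (simp add: avg coset_sum_def sum.distrib scaleC_add_right)
  next
    fix a x assume x: "x \<in> vspace \<sigma>"
    have "coset_sum G N (F (a *\<^sub>C x)) = coset_sum G N (\<lambda>k. a *\<^sub>C F x k)"
      using F_scale[OF x] by (intro \<sigma>.coset_sum_cong[OF N]) auto
    thus "intertwining_average G N \<sigma> \<tau> I \<zeta> u (a *\<^sub>C x) = a *\<^sub>C intertwining_average G N \<sigma> \<tau> I \<zeta> u x"
      using x cvs.subspace_scale[OF \<sigma>.subspace_vspace x]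
      by (simp add: avg coset_sum_def scaleC_scaleC mult.commute flip: cvs.scale_sum_right)
  next
    fix w assume "w \<notin> vspace \<sigma>"
    thus "intertwining_average G N \<sigma> \<tau> I \<zeta> u w = 0" by (simp add: intertwining_average_def)
  next
    fix h w assume h: "h \<in> carrier G" and w: "w \<in> vspace \<sigma>"
    have "coset_sum G N (F (action \<sigma> h w)) = coset_sum G N (\<lambda>k. action \<tau> h (F w (k \<otimes>\<^bsub>G\<^esub> h)))"
      using F_shift h w by (intro \<sigma>.coset_sum_cong[OF N]) auto
    also have "\<dots> = action \<tau> h (coset_sum G N (\<lambda>k. F w (k \<otimes>\<^bsub>G\<^esub> h)))"
      using h F_mem
      by (intro \<sigma>.linear_coset_sum[OF N \<tau>.linear_action \<tau>.subspace_vspace, symmetric]) auto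
    also have "coset_sum G N (\<lambda>k. F w (k \<otimes>\<^bsub>G\<^esub> h)) = coset_sum G N (F w)"
      using F_inv w h by (intro \<sigma>.coset_sum_shift[OF N]) auto
    finally show "intertwining_average G N \<sigma> \<tau> I \<zeta> u (action \<sigma> h w) =
        action \<tau> h (intertwining_average G N \<sigma> \<tau> I \<zeta> u w)"
      using h w \<sigma>.action_mem[OF h w] sum_mem by (simp add: avg \<tau>.action_scale)
  qed
qed

lemma (in compact_group) coset_average_const:
  assumes N: "open_subgroup G T N" and F: "\<And>k. k \<in> carrier G \<Longrightarrow> F k = (x :: 'x::complex_vector)"
  shows "inverse (of_nat (card (rcosets N))) *\<^sub>C coset_sum G N F = x"
proof -
  have "coset_sum G N F = of_nat (card (rcosets N)) *\<^sub>C x"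
    using coset_sum_cong[of N F "\<lambda>_. x"] N F coset_sum_const unfolding open_subgroup_def by metis
  thus ?thesis using card_rcosets_pos[OF N] by (simp add: scaleC_scaleC scaleC_one)
qed

text \<open>The inequality stays strict because there are finitely many cosets and at least one. The
  final contradiction in the proof of openness rests on this strictness.\<close>

lemma (in compact_group) coset_average_less:
  fixes F :: "'a \<Rightarrow> complex"
  assumes N: "open_subgroup G T N" and F: "\<And>k. k \<in> carrier G \<Longrightarrow> cmod (F k) < C"
  shows "cmod (inverse (of_nat (card (rcosets N))) *\<^sub>C coset_sum G N F) < C"
proof -
  have sN: "subgroup N G" using N unfolding open_subgroup_def by blast
  have "cmod (coset_sum G N F) \<le> (\<Sum>D\<in>rcosets N. cmod (F (SOME k. k \<in> D)))"
    unfolding coset_sum_def by (rule norm_sum)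
  also have "\<dots> < (\<Sum>D\<in>rcosets N. C)"
    using F rcoset_some(2)[OF sN] finite_rcosets[OF N] card_rcosets_pos[OF N]
    by (intro sum_strict_mono) auto
  finally show ?thesis using card_rcosets_pos[OF N] by (simp add: norm_mult norm_divide norm_inverse field_simps)
qed

section \<open>Smooth representations of a compact group: orbits and invariants\<close>

locale compact_representation = compact_group G T for G (structure) and T +
  fixes \<pi> :: "('a, 'v::complex_vector) crep"
  assumes smooth: "smooth_rep G T \<pi>"

sublocale compact_representation \<subseteq> group_representation
  using smooth by unfold_locales (simp add: smooth_rep_def)

context compact_representation
begin

lemma open_subgroup_fixing:
  assumes "finite X" "X \<subseteq> vspace \<pi>"
  obtains N where "open_subgroup G T N" "\<And>n x. n \<in> N \<Longrightarrow> x \<in> X \<Longrightarrow> action \<pi> n x = x"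
proof -
  define N where "N = carrier G \<inter> (\<Inter>x\<in>X. {g \<in> carrier G. action \<pi> g x = x})"
  have "open_subgroup G T N" unfolding N_def
  proof (rule open_subgroup_INT[OF topological assms(1)])
    fix x assume "x \<in> X"
    hence x: "x \<in> vspace \<pi>" using assms by blast
    thus "open_subgroup G T {g \<in> carrier G. action \<pi> g x = x}"
      using subgroup_stabilizer smooth unfolding open_subgroup_def smooth_rep_def by blast
  qed
  thus thesis using that unfolding N_def by blast
qed

lemma open_subgroup_fixing_vector:
  assumes "v \<in> vspace \<pi>"
  obtains N where "open_subgroup G T N" "\<And>n. n \<in> N \<Longrightarrow> action \<pi> n v = v"
  using open_subgroup_fixing[of "{v}"] assms by (metis empty_subsetI finite.simps insert_subset singletonI)

lemma finite_orbit:
  assumes v: "v \<in> vspace \<pi>"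
  shows "finite ((\<lambda>g. action \<pi> g v) ` carrier G)"
proof -
  obtain N where N: "open_subgroup G T N" "\<And>n. n \<in> N \<Longrightarrow> action \<pi> n v = v"
    using open_subgroup_fixing_vector[OF v] by blast
  have sub: "subgroup N G" using N(1) unfolding open_subgroup_def by blast
  \<comment> \<open>\<open>k \<mapsto> \<pi>(k) v\<close> is invariant under right multiplication by
    the subgroup fixing \<open>v\<close>. Inverting \<open>k\<close> turns this into the left
    invariance that matches right cosets.\<close>
  have "finite ((\<lambda>k. action \<pi> (inv k) v) ` carrier G)"
  proof (rule finite_image_left_invariant[OF sub finite_rcosets[OF N(1)]])
    fix n k assume n: "n \<in> N" and k: "k \<in> carrier G"
    have "n \<in> carrier G" "inv n \<in> N"
      using n subgroup.mem_carrier[OF sub] subgroup.m_inv_closed[OF sub] by auto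
    thus "action \<pi> (inv (n \<otimes> k)) v = action \<pi> (inv k) v"
      using k v N(2) by (simp add: inv_mult_group action_mult)
  qed
  moreover have "(\<lambda>g. action \<pi> g v) ` carrier G \<subseteq> (\<lambda>k. action \<pi> (inv k) v) ` carrier G"
  proof
    fix y assume "y \<in> (\<lambda>g. action \<pi> g v) ` carrier G"
    then obtain g where "g \<in> carrier G" "y = action \<pi> g v" by blast
    hence "inv g \<in> carrier G" "y = action \<pi> (inv (inv g)) v" by auto
    thus "y \<in> (\<lambda>k. action \<pi> (inv k) v) ` carrier G" by blast
  qed
  ultimately show ?thesis using finite_subset by blast
qed

lemma invariant_span_orbits:
  assumes X: "X \<subseteq> vspace \<pi>"
  defines "Y \<equiv> cvs.span (\<Union>x\<in>X. (\<lambda>g. action \<pi> g x) ` carrier G)"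
  shows "Y \<subseteq> vspace \<pi>" "X \<subseteq> Y" "\<And>g. g \<in> carrier G \<Longrightarrow> action \<pi> g ` Y \<subseteq> Y"
proof -
  let ?O = "\<Union>x\<in>X. (\<lambda>g. action \<pi> g x) ` carrier G"
  have O: "?O \<subseteq> vspace \<pi>" using X action_mem by blast
  show YV: "Y \<subseteq> vspace \<pi>" unfolding Y_def using cvs.span_minimal[OF O subspace_vspace] .
  show "X \<subseteq> Y"
  proof
    fix x assume x: "x \<in> X"
    hence "x = action \<pi> \<one> x" using action_one X by auto
    hence "x \<in> ?O" using x by blast
    thus "x \<in> Y" unfolding Y_def by (rule cvs.span_base)
  qed
  fix g assume g: "g \<in> carrier G"
  have "Y \<subseteq> {v \<in> vspace \<pi>. action \<pi> g v \<in> Y}"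
    unfolding Y_def
  proof (rule cvs.span_minimal)
    show "cvs.subspace {v \<in> vspace \<pi>. action \<pi> g v \<in> cvs.span ?O}"
      using linear_map_on_subspace_vimage[OF linear_action[OF g] subspace_vspace cvs.subspace_span] .
    show "?O \<subseteq> {v \<in> vspace \<pi>. action \<pi> g v \<in> cvs.span ?O}"
    proof
      fix y assume "y \<in> ?O"
      then obtain x h where x: "x \<in> X" "h \<in> carrier G" "y = action \<pi> h x" by blast
      hence "action \<pi> g y = action \<pi> (g \<otimes> h) x" using g X action_mult by auto
      moreover have "g \<otimes> h \<in> carrier G" using g x by simp
      ultimately have "action \<pi> g y \<in> ?O" using x(1) by blast
      thus "y \<in> {v \<in> vspace \<pi>. action \<pi> g v \<in> cvs.span ?O}"
        using \<open>y \<in> ?O\<close> O cvs.span_base[of _ ?O] by blast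
    qed
  qed
  thus "action \<pi> g ` Y \<subseteq> Y" by blast
qed

text \<open>The orbit of a nonzero vector is finite, and its span is a nonzero invariant subspace,
  hence everything.\<close>

lemma irreducible_finite_dimensional:
  assumes "irreducible_rep G \<pi>"
  shows "finite_dimensional (vspace \<pi>)"
proof -
  obtain x where x: "x \<in> vspace \<pi>" "x \<noteq> 0"
    using assms cvs.subspace_0[OF subspace_vspace] unfolding irreducible_rep_def by blast
  let ?Y = "cvs.span (\<Union>x\<in>{x}. (\<lambda>g. action \<pi> g x) ` carrier G)"
  have "?Y = {0} \<or> ?Y = vspace \<pi>"
    using assms invariant_span_orbits[of "{x}"] x(1) cvs.subspace_span
    unfolding irreducible_rep_def by blast
  moreover have "x \<in> ?Y" using invariant_span_orbits(2)[of "{x}"] x(1) by blast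
  ultimately have "?Y = vspace \<pi>" using x(2) by blast
  thus ?thesis using finite_orbit[OF x(1)] unfolding finite_dimensional_def by fastforce
qed

text \<open>The vectors \<open>\<pi>(h) v - v\<close> span a complement of the invariants: averaging over the cosets of
  an open normal subgroup kills them but fixes the invariant vectors.\<close>

lemma invariant_projection:
  obtains E where "linear_map_on (vspace \<pi>) (vspace \<pi>) E"
    "\<And>v. v \<in> vspace \<pi> \<Longrightarrow> E v \<in> fixed_vectors (carrier G) \<pi>"
    "\<And>v. v \<in> fixed_vectors (carrier G) \<pi> \<Longrightarrow> E v = v"
    "\<And>h v. h \<in> carrier G \<Longrightarrow> v \<in> vspace \<pi> \<Longrightarrow> E (action \<pi> h v) = E v"
    "\<And>v. v \<in> vspace \<pi> \<Longrightarrow> E v \<in> cvs.span ((\<lambda>h. action \<pi> h v) ` carrier G)"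
proof -
  let ?V = "vspace \<pi>"
  define P where "P = fixed_vectors (carrier G) \<pi>"
  define D where "D = (\<lambda>(h, v). action \<pi> h v - v) ` (carrier G \<times> ?V)"
  define Z where "Z = cvs.span D"
  have sP: "cvs.subspace P" unfolding P_def using subspace_fixed_vectors by blast
  have sZ: "cvs.subspace Z" unfolding Z_def by (rule cvs.subspace_span)
  have PV: "P \<subseteq> ?V" unfolding P_def fixed_vectors_def by blast
  have DZ: "action \<pi> h v - v \<in> Z" if "h \<in> carrier G" "v \<in> ?V" for h v
    unfolding Z_def using that by (intro cvs.span_base) (auto simp: D_def)
  \<comment> \<open>Each generator of \<open>Z\<close> needs its own subgroup fixing its vector.
    Claiming that the sum vanishes for all normal open \<open>M\<close> below some \<open>N\<close>
    makes the claim stable under linear combinations, by intersecting the subgroups.\<close>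
  have killed: "z \<in> ?V \<and> (\<exists>N. open_subgroup G T N \<and> (\<forall>M. open_subgroup G T M \<and> M \<subseteq> N \<and>
      (\<forall>k\<in>carrier G. \<forall>n\<in>M. k \<otimes> n \<otimes> inv k \<in> M) \<longrightarrow> coset_sum G M (\<lambda>k. action \<pi> k z) = 0))"
    if "z \<in> Z" for z
    using that unfolding Z_def
  proof (induction rule: cvs.span_induct_alt)
    case base
    have "open_subgroup G T (carrier G)"
      using subgroup_self topspace_eq unfolding open_subgroup_def by (metis openin_topspace)
    moreover have "coset_sum G M (\<lambda>k. action \<pi> k 0) = 0" if "subgroup M G" for M
      using coset_sum_cong[OF that, of "\<lambda>k. action \<pi> k 0" "\<lambda>_. 0"] action_zero
      by (simp add: coset_sum_def)
    ultimately show ?case using cvs.subspace_0[OF subspace_vspace] unfolding open_subgroup_def by blast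
  next
    case (step c x y)
    then obtain h v where hv: "h \<in> carrier G" "v \<in> ?V" "x = action \<pi> h v - v" unfolding D_def by auto
    have yV: "y \<in> ?V" using step by blast
    have hvV: "action \<pi> h v \<in> ?V" using hv action_mem by blast
    have xV: "x \<in> ?V" using hv hvV cvs.subspace_diff[OF subspace_vspace] by blast
    obtain N1 where N1: "open_subgroup G T N1" and N1y: "\<And>M. open_subgroup G T M \<Longrightarrow> M \<subseteq> N1 \<Longrightarrow>
      (\<forall>k\<in>carrier G. \<forall>n\<in>M. k \<otimes> n \<otimes> inv k \<in> M) \<Longrightarrow> coset_sum G M (\<lambda>k. action \<pi> k y) = 0"
      using step by blast
    obtain N2 where N2: "open_subgroup G T N2" "\<And>n. n \<in> N2 \<Longrightarrow> action \<pi> n v = v"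
      using open_subgroup_fixing_vector[OF hv(2)] by blast
    have "coset_sum G M (\<lambda>k. action \<pi> k (c *\<^sub>C x + y)) = 0"
      if M: "open_subgroup G T M" "M \<subseteq> N1 \<inter> N2"
        and nor: "\<forall>k\<in>carrier G. \<forall>n\<in>M. k \<otimes> n \<otimes> inv k \<in> M" for M
    proof -
      have sM: "subgroup M G" using M unfolding open_subgroup_def by blast
      \<comment> \<open>Normality enters here:
        \<open>n \<otimes> k = k \<otimes> (inv k \<otimes> n \<otimes> k)\<close>, and the bracket
        lies in \<open>M\<close>, which fixes \<open>v\<close>. Hence
        \<open>k \<mapsto> \<pi>(k) v\<close> is left \<open>M\<close>-invariant, and translating it
        by \<open>h\<close> does not change the sum.\<close>
      have inv: "action \<pi> (n \<otimes> k) v = action \<pi> k v" if "n \<in> M" "k \<in> carrier G" for n k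
      proof -
        have n: "n \<in> carrier G" using that subgroup.mem_carrier[OF sM] by blast
        have m: "inv k \<otimes> n \<otimes> k \<in> M" using nor that(1) that(2) by (metis inv_closed inv_inv)
        have "n \<otimes> k = k \<otimes> (inv k \<otimes> n \<otimes> k)"
          using n that(2) by (simp add: m_assoc) (simp flip: m_assoc)
        hence "action \<pi> (n \<otimes> k) v = action \<pi> k (action \<pi> (inv k \<otimes> n \<otimes> k) v)"
          using action_mult n that(2) hv by simp
        thus ?thesis using N2(2) m M(2) by auto
      qed
      have "coset_sum G M (\<lambda>k. action \<pi> k (action \<pi> h v)) = coset_sum G M (\<lambda>k. action \<pi> (k \<otimes> h) v)"
        using hv action_mult by (intro coset_sum_cong[OF sM]) auto
      also have "\<dots> = coset_sum G M (\<lambda>k. action \<pi> k v)"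
        using coset_sum_shift[OF sM inv hv(1)] by blast
      finally have shift: "coset_sum G M (\<lambda>k. action \<pi> k (action \<pi> h v)) = coset_sum G M (\<lambda>k. action \<pi> k v)" .
      have "coset_sum G M (\<lambda>k. action \<pi> k (c *\<^sub>C x + y)) = coset_sum G M
          (\<lambda>k. c *\<^sub>C (action \<pi> k (action \<pi> h v) - action \<pi> k v) + action \<pi> k y)"
        using xV yV hvV hv cvs.subspace_scale[OF subspace_vspace xV]
          linear_map_on_diff[OF linear_action subspace_vspace hvV hv(2)]
        by (intro coset_sum_cong[OF sM]) (auto simp: action_add action_scale)
      also have "\<dots> = c *\<^sub>C (coset_sum G M (\<lambda>k. action \<pi> k (action \<pi> h v)) - coset_sum G M (\<lambda>k. action \<pi> k v))
          + coset_sum G M (\<lambda>k. action \<pi> k y)"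
        by (simp add: coset_sum_def sum.distrib sum_subtractf flip: cvs.scale_sum_right)
      also have "\<dots> = 0" using shift N1y[OF M(1) _ nor] M(2) by simp
      finally show ?thesis .
    qed
    moreover have "open_subgroup G T (N1 \<inter> N2)"
      using N1 N2(1) subgroups_Inter_pair unfolding open_subgroup_def by (simp add: openin_Int)
    moreover have "c *\<^sub>C x + y \<in> ?V"
      using cvs.subspace_add[OF subspace_vspace cvs.subspace_scale[OF subspace_vspace xV] yV] .
    ultimately show ?case by blast
  qed
  \<comment> \<open>Averaging over \<open>M\<close> returns an invariant vector unchanged but sends
    an element of \<open>Z\<close> to 0, so \<open>P\<close> and \<open>Z\<close> meet only in
    0.\<close>
  have zero: "z = 0" if z: "z \<in> Z" "z \<in> P" for z
  proof -
    obtain N where N: "open_subgroup G T N" and N0: "\<And>M. open_subgroup G T M \<Longrightarrow> M \<subseteq> N \<Longrightarrow>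
      (\<forall>k\<in>carrier G. \<forall>n\<in>M. k \<otimes> n \<otimes> inv k \<in> M) \<Longrightarrow> coset_sum G M (\<lambda>k. action \<pi> k z) = 0"
      using killed[OF z(1)] by blast
    obtain M where M: "open_subgroup G T M" "M \<subseteq> N" "\<And>k n. k \<in> carrier G \<Longrightarrow> n \<in> M \<Longrightarrow> k \<otimes> n \<otimes> inv k \<in> M"
      using open_normal_core[OF N] by blast
    have "z = inverse (of_nat (card (rcosets M))) *\<^sub>C coset_sum G M (\<lambda>k. action \<pi> k z)"
      using z(2) by (intro coset_average_const[OF M(1), symmetric]) (auto simp: P_def fixed_vectors_def)
    thus ?thesis using N0[OF M(1,2)] M(3) by simp
  qed
  \<comment> \<open>The witness is the average of \<open>\<pi>(k)^-1 v\<close> over cosets of a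
    subgroup fixing \<open>v\<close>. The difference from \<open>v\<close> is a combination of
    vectors \<open>v - \<pi>(h) v\<close> and lies in \<open>Z\<close>.\<close>
  have ex: "\<exists>y. y \<in> P \<and> v - y \<in> Z \<and> y \<in> cvs.span ((\<lambda>h. action \<pi> h v) ` carrier G)"
    if v: "v \<in> ?V" for v
  proof -
    obtain N where N: "open_subgroup G T N" "\<And>n. n \<in> N \<Longrightarrow> action \<pi> n v = v"
      using open_subgroup_fixing_vector[OF v] by blast
    have sN: "subgroup N G" using N(1) unfolding open_subgroup_def by blast
    define c where "c = (inverse (of_nat (card (rcosets N))) :: complex)"
    define F where "F = (\<lambda>k. action \<pi> (inv k) v)"
    have FV: "F k \<in> ?V" if "k \<in> carrier G" for k using that v action_mem unfolding F_def by simp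
    have sumV: "coset_sum G N F \<in> ?V" using coset_sum_mem[OF sN subspace_vspace] FV by blast
    have F_inv: "F (n \<otimes> k) = F k" if "n \<in> N" "k \<in> carrier G" for n k
      using that v N(2) subgroup.mem_carrier[OF sN] subgroup.m_inv_closed[OF sN]
      unfolding F_def by (simp add: inv_mult_group action_mult)
    have "action \<pi> h (c *\<^sub>C coset_sum G N F) = c *\<^sub>C coset_sum G N F" if h: "h \<in> carrier G" for h
    proof -
      have "action \<pi> h (coset_sum G N F) = coset_sum G N (\<lambda>k. action \<pi> h (F k))"
        using FV by (intro linear_coset_sum[OF sN linear_action[OF h] subspace_vspace]) auto
      also have "\<dots> = coset_sum G N (\<lambda>k. F (k \<otimes> inv h))"
        using h v unfolding F_def by (intro coset_sum_cong[OF sN]) (simp add: inv_mult_group action_mult)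
      also have "\<dots> = coset_sum G N F" using coset_sum_shift[OF sN F_inv] h by simp
      finally show ?thesis using action_scale[OF h sumV] by simp
    qed
    hence "c *\<^sub>C coset_sum G N F \<in> P"
      using cvs.subspace_scale[OF subspace_vspace sumV] unfolding P_def fixed_vectors_def by blast
    moreover have "v - c *\<^sub>C coset_sum G N F \<in> Z"
    proof -
      have "v = c *\<^sub>C coset_sum G N (\<lambda>_. v)"
        unfolding c_def by (rule coset_average_const[OF N(1), symmetric]) simp
      hence "v - c *\<^sub>C coset_sum G N F = c *\<^sub>C (coset_sum G N (\<lambda>_. v) - coset_sum G N F)"
        by (metis cvs.scale_right_diff_distrib)
      also have "coset_sum G N (\<lambda>_. v) - coset_sum G N F = coset_sum G N (\<lambda>k. - (F k - v))"
        by (simp add: coset_sum_def sum_subtractf)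
      also have "c *\<^sub>C \<dots> \<in> Z"
        using DZ v
        by (intro cvs.subspace_scale[OF sZ] coset_sum_mem[OF sN sZ] cvs.subspace_neg[OF sZ])
          (simp add: F_def)
      finally show ?thesis .
    qed
    moreover have "c *\<^sub>C coset_sum G N F \<in> cvs.span ((\<lambda>h. action \<pi> h v) ` carrier G)"
      by (intro cvs.span_scale coset_sum_mem[OF sN cvs.subspace_span] cvs.span_base) (auto simp: F_def)
    ultimately show ?thesis by blast
  qed
  \<comment> \<open>\<open>E v\<close> is the component of \<open>v\<close> in the direct sum of
    \<open>P\<close> and \<open>Z\<close>. The subgroup used for averaging depends on
    \<open>v\<close>, so linearity is not read off a formula but derived from uniqueness of the
    component; the span condition rides along for the last property.\<close>
  define E where "E = (\<lambda>v. SOME y. y \<in> P \<and> v - y \<in> Z \<and> y \<in> cvs.span ((\<lambda>h. action \<pi> h v) ` carrier G))"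
  have E: "E v \<in> P" "v - E v \<in> Z" "E v \<in> cvs.span ((\<lambda>h. action \<pi> h v) ` carrier G)" if "v \<in> ?V" for v
    using someI_ex[OF ex[OF that]] unfolding E_def by auto
  have uniq: "E v = y" if "v \<in> ?V" "y \<in> P" "v - y \<in> Z" for v y
  proof -
    have "E v - y = (v - y) - (v - E v)" by simp
    hence "E v - y \<in> Z" using cvs.subspace_diff[OF sZ that(3) E(2)[OF that(1)]] by simp
    moreover have "E v - y \<in> P" using cvs.subspace_diff[OF sP E(1)[OF that(1)] that(2)] .
    ultimately show ?thesis using zero by fastforce
  qed
  show thesis
  proof (rule that)
    show "linear_map_on ?V ?V E"
      unfolding linear_map_on_def
    proof (intro conjI ballI allI)
      show "E ` ?V \<subseteq> ?V" using E(1) PV by blast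
    next
      fix x y assume xy: "x \<in> ?V" "y \<in> ?V"
      have "(x + y) - (E x + E y) = (x - E x) + (y - E y)" by simp
      hence "(x + y) - (E x + E y) \<in> Z" using cvs.subspace_add[OF sZ E(2)[OF xy(1)] E(2)[OF xy(2)]] by (simp only:)
      thus "E (x + y) = E x + E y"
        using uniq cvs.subspace_add[OF subspace_vspace xy] cvs.subspace_add[OF sP E(1) E(1)] xy by simp
    next
      fix c x assume x: "x \<in> ?V"
      have "c *\<^sub>C x - c *\<^sub>C E x = c *\<^sub>C (x - E x)" by (simp add: cvs.scale_right_diff_distrib)
      hence "c *\<^sub>C x - c *\<^sub>C E x \<in> Z" using cvs.subspace_scale[OF sZ E(2)[OF x]] by (simp only:)
      thus "E (c *\<^sub>C x) = c *\<^sub>C E x"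
        using uniq cvs.subspace_scale[OF subspace_vspace x] cvs.subspace_scale[OF sP E(1)] x by simp
    qed
  next
    show "E v \<in> fixed_vectors (carrier G) \<pi>" if "v \<in> ?V" for v using E(1)[OF that] unfolding P_def .
  next
    show "E v = v" if "v \<in> fixed_vectors (carrier G) \<pi>" for v
      using uniq[of v v] that PV cvs.subspace_0[OF sZ] unfolding P_def by auto
  next
    fix h v assume h: "h \<in> carrier G" and v: "v \<in> ?V"
    have "action \<pi> h v - E v = (action \<pi> h v - v) + (v - E v)" by simp
    hence "action \<pi> h v - E v \<in> Z" using cvs.subspace_add[OF sZ DZ[OF h v] E(2)[OF v]] by (simp only:)
    thus "E (action \<pi> h v) = E v" using uniq action_mem[OF h v] E(1)[OF v] by blast
  qed (rule E(3))
qed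

end

section \<open>Restriction to subgroups, semisimplicity and orthogonality\<close>

lemma sum_representation_linear:
  assumes B: "finite B" "cvs.independent B" "cvs.span B = W" and f: "linear_map_on W X f" and x: "x \<in> W"
  shows "(\<Sum>b\<in>B. cvs.representation B x b *\<^sub>C f b) = f x"
proof -
  have W: "cvs.subspace W" using B(3) cvs.subspace_span by blast
  have BW: "b \<in> W" if "b \<in> B" for b using B(3) that cvs.span_base by blast
  have "f (\<Sum>b\<in>B. cvs.representation B x b *\<^sub>C b) = (\<Sum>b\<in>B. f (cvs.representation B x b *\<^sub>C b))"
    using BW cvs.subspace_scale[OF W] by (intro linear_map_on_sum[OF f W]) auto
  also have "\<dots> = (\<Sum>b\<in>B. cvs.representation B x b *\<^sub>C f b)"
    using BW linear_map_onD(3)[OF f] by (intro sum.cong) auto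
  finally show ?thesis using sum_representation[OF B x] by simp
qed

lemma compact_group_subgroup:
  assumes G: "topological_group G T" and K: "subgroup K G" "compactin T K"
  shows "compact_group (G\<lparr>carrier := K\<rparr>) (subtopology T K)"
proof -
  interpret group G using G by (rule topological_group_group)
  have top: "topspace T = carrier G" using G unfolding topological_group_def by blast
  have KG: "K \<subseteq> carrier G" using K(1) subgroup.subset by blast
  have topK: "topspace (subtopology T K) = K" using KG top by auto
  have gK: "group (G\<lparr>carrier := K\<rparr>)" using subgroup.subgroup_is_group[OF K(1) group_axioms] .
  have "continuous_map (prod_topology (subtopology T K) (subtopology T K)) (subtopology T K)
      (\<lambda>(x, y). x \<otimes>\<^bsub>G\<lparr>carrier := K\<rparr>\<^esub> y)"
  proof (rule continuous_map_into_subtopology)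
    show "continuous_map (prod_topology (subtopology T K) (subtopology T K)) T
        (\<lambda>(x, y). x \<otimes>\<^bsub>G\<lparr>carrier := K\<rparr>\<^esub> y)"
      unfolding subtopology_Times[symmetric]
      using G unfolding topological_group_def by (auto intro: continuous_map_from_subtopology)
    show "(\<lambda>(x, y). x \<otimes>\<^bsub>G\<lparr>carrier := K\<rparr>\<^esub> y) \<in>
        topspace (prod_topology (subtopology T K) (subtopology T K)) \<rightarrow> K"
      using subgroup.m_closed[OF K(1)] by auto
  qed
  moreover have "continuous_map (subtopology T K) (subtopology T K) (\<lambda>x. inv\<^bsub>G\<lparr>carrier := K\<rparr>\<^esub> x)"
  proof (rule continuous_map_eq)
    show "continuous_map (subtopology T K) (subtopology T K) (\<lambda>x. inv\<^bsub>G\<^esub> x)"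
      using G subgroup.m_inv_closed[OF K(1)] unfolding topological_group_def
      by (intro continuous_map_into_subtopology continuous_map_from_subtopology) auto
    show "inv\<^bsub>G\<^esub> x = inv\<^bsub>G\<lparr>carrier := K\<rparr>\<^esub> x" if "x \<in> topspace (subtopology T K)" for x
      using that m_inv_consistent[OF K(1)] topK by simp
  qed
  ultimately have "topological_group (G\<lparr>carrier := K\<rparr>) (subtopology T K)"
    using gK topK unfolding topological_group_def by simp
  thus ?thesis using gK compact_space_subtopology[OF K(2)]
    by (simp add: compact_group_def compact_group_axioms_def)
qed

lemma group_rep_subgroup:
  assumes "group_rep G \<pi>" "subgroup K G"
  shows "group_rep (G\<lparr>carrier := K\<rparr>) \<pi>"
  using assms subgroup.mem_carrier[OF assms(2)] unfolding group_rep_def by simp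

lemma smooth_rep_subgroup:
  assumes "smooth_rep G T \<pi>" "subgroup K G"
  shows "smooth_rep (G\<lparr>carrier := K\<rparr>) (subtopology T K) \<pi>"
proof -
  have "{g \<in> K. action \<pi> g v = v} = {g \<in> carrier G. action \<pi> g v = v} \<inter> K" for v
    using subgroup.mem_carrier[OF assms(2)] by blast
  thus ?thesis
    using assms group_rep_subgroup[OF _ assms(2)] unfolding smooth_rep_def
    by (auto simp: openin_subtopology)
qed

lemma compact_representation_subgroup:
  assumes "topological_group G T" "subgroup K G" "compactin T K" "smooth_rep G T \<pi>"
  shows "compact_representation (G\<lparr>carrier := K\<rparr>) (subtopology T K) \<pi>"
  using compact_group_subgroup[OF assms(1-3)] smooth_rep_subgroup[OF assms(4,2)]
  by (simp add: compact_representation_def compact_representation_axioms_def)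

lemma open_subgroup_restrict:
  assumes G: "group G" and N: "open_subgroup G T N" and K: "subgroup K G"
  shows "open_subgroup (G\<lparr>carrier := K\<rparr>) (subtopology T K) (N \<inter> K)"
proof -
  interpret group G by fact
  have "subgroup (N \<inter> K) G" using N K subgroups_Inter_pair unfolding open_subgroup_def by blast
  thus ?thesis using N K subgroup_incl unfolding open_subgroup_def openin_subtopology by blast
qed

lemma open_subgroup_Int:
  assumes "group G" "open_subgroup G T N" "open_subgroup G T M"
  shows "open_subgroup G T (N \<inter> M)"
  using assms group.subgroups_Inter_pair unfolding open_subgroup_def by (auto simp: openin_Int)

lemma (in group_representation) fixes_span:
  assumes "N \<subseteq> carrier G" "B \<subseteq> vspace \<pi>" "\<And>n b. n \<in> N \<Longrightarrow> b \<in> B \<Longrightarrow> action \<pi> n b = b"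
  shows "cvs.span B \<subseteq> fixed_vectors N \<pi>"
  using assms by (intro cvs.span_minimal subspace_fixed_vectors) (auto simp: fixed_vectors_def)

lemma subgroup_invariant_projection:
  assumes "topological_group G T" "subgroup N G" "compactin T N" "smooth_rep G T \<pi>"
  obtains E where "linear_map_on (vspace \<pi>) (vspace \<pi>) E"
    "\<And>v. v \<in> vspace \<pi> \<Longrightarrow> E v \<in> fixed_vectors N \<pi>"
    "\<And>v. v \<in> fixed_vectors N \<pi> \<Longrightarrow> E v = v"
    "\<And>h v. h \<in> N \<Longrightarrow> v \<in> vspace \<pi> \<Longrightarrow> E (action \<pi> h v) = E v"
    "\<And>v. v \<in> vspace \<pi> \<Longrightarrow> E v \<in> cvs.span ((\<lambda>h. action \<pi> h v) ` N)"
proof -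
  have carrier: "carrier (G\<lparr>carrier := N\<rparr>) = N" by simp
  show thesis
    by (rule compact_representation.invariant_projection[OF compact_representation_subgroup[OF assms],
          unfolded carrier]) (rule that)
qed

text \<open>A linear projection onto \<open>Y\<close> is averaged over the group. Its coordinate
  forms need not be invariant under any open subgroup. Precomposing them with the projection
  \<open>E\<close> onto the vectors fixed by \<open>N\<close> repairs this, and changes nothing on
  \<open>Y\<close> because \<open>N\<close> fixes \<open>Y\<close> pointwise.\<close>

lemma (in compact_representation) equivariant_projection:
  assumes Y: "cvs.subspace Y" "Y \<subseteq> vspace \<pi>" "\<And>g. g \<in> carrier G \<Longrightarrow> action \<pi> g ` Y \<subseteq> Y"
    and fd: "finite_dimensional Y"
  obtains p where "p \<in> Hom_rep (carrier G) \<pi> (\<pi>\<lparr>vspace := Y\<rparr>)" "\<And>y. y \<in> Y \<Longrightarrow> p y = y"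
proof -
  obtain B where B: "finite B" "cvs.independent B" "cvs.span B = Y"
    using finite_dimensional_basis[OF fd] .
  have BY: "B \<subseteq> Y" using B(3) cvs.span_superset by blast
  obtain N where N: "open_subgroup G T N" "\<And>n x. n \<in> N \<Longrightarrow> x \<in> B \<Longrightarrow> action \<pi> n x = x"
    using open_subgroup_fixing[OF B(1)] BY Y(2) by blast
  have sN: "subgroup N G" using N(1) unfolding open_subgroup_def by blast
  have NG: "N \<subseteq> carrier G" using subgroup.subset[OF sN] .
  have YN: "Y \<subseteq> fixed_vectors N \<pi>" using fixes_span[OF NG _ N(2)] BY Y(2) B(3) by blast
  obtain E where E: "linear_map_on (vspace \<pi>) (vspace \<pi>) E"
    "\<And>v. v \<in> vspace \<pi> \<Longrightarrow> E v \<in> fixed_vectors N \<pi>"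
    "\<And>v. v \<in> fixed_vectors N \<pi> \<Longrightarrow> E v = v"
    "\<And>h v. h \<in> N \<Longrightarrow> v \<in> vspace \<pi> \<Longrightarrow> E (action \<pi> h v) = E v"
    "\<And>v. v \<in> vspace \<pi> \<Longrightarrow> E v \<in> cvs.span ((\<lambda>h. action \<pi> h v) ` N)"
    by (rule subgroup_invariant_projection[OF topological sN compactin_open_subgroup[OF N(1)] smooth])
      (rule that)
  have "\<exists>g. linear_map_on UNIV (UNIV :: complex set) g \<and> (\<forall>x\<in>Y. g x = cvs.representation B x b)" for b
    by (rule representation_extend_linear[OF B(2), of b]) (use B(3) in auto)
  then obtain g where g: "\<And>b. linear_map_on UNIV (UNIV :: complex set) (g b)"
    "\<And>b x. x \<in> Y \<Longrightarrow> g b x = cvs.representation B x b" by metis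
  let ?\<tau> = "\<pi>\<lparr>vspace := Y\<rparr>"
  define p where "p = intertwining_average G N \<pi> ?\<tau> B (\<lambda>b v. g b (E v)) (\<lambda>b. b)"
  have "p \<in> Hom_rep (carrier G) \<pi> ?\<tau>"
    unfolding p_def
  proof (rule intertwining_average_Hom[OF group_axioms sN rep subrepresentation[OF Y]])
    show "linear_map_on (vspace \<pi>) UNIV (\<lambda>v. g b (E v))" for b
      using linear_map_onD[OF E(1)] linear_map_onD[OF g(1)] unfolding linear_map_on_def by simp
  qed (use E(4) BY N(2) in auto)
  moreover have "p y = y" if y: "y \<in> Y" for y
  proof -
    have yV: "y \<in> vspace \<pi>" using y Y(2) by blast
    \<comment> \<open>Every term of the average already returns \<open>y\<close>: the vector
      \<open>\<pi>(k) y\<close> stays in \<open>Y\<close>, is expanded there in the basis, and is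
      moved back by \<open>inv k\<close>.\<close>
    have "(\<Sum>b\<in>B. g b (E (action \<pi> k y)) *\<^sub>C action \<pi> (inv k) b) = y" if k: "k \<in> carrier G" for k
    proof -
      have kY: "action \<pi> k y \<in> Y" using Y(3)[OF k] y by blast
      have lin: "linear_map_on Y (vspace \<pi>) (action \<pi> (inv k))"
        using linear_action[of "inv k"] k Y(2) unfolding linear_map_on_def by (auto simp: subset_iff)
      have "E (action \<pi> k y) = action \<pi> k y" using E(3) kY YN by blast
      hence "(\<Sum>b\<in>B. g b (E (action \<pi> k y)) *\<^sub>C action \<pi> (inv k) b)
          = (\<Sum>b\<in>B. cvs.representation B (action \<pi> k y) b *\<^sub>C action \<pi> (inv k) b)"
        using g(2)[OF kY] by simp
      also have "\<dots> = action \<pi> (inv k) (action \<pi> k y)" using sum_representation_linear[OF B lin kY] .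
      finally show ?thesis using action_inv[OF k yV] by simp
    qed
    thus ?thesis using coset_average_const[OF N(1), of _ y] yV
      unfolding p_def intertwining_average_def by simp
  qed
  ultimately show thesis by (rule that)
qed

text \<open>Preimages \<open>u b\<close> of a basis define a linear section. Conjugating it by
  \<open>k\<close> gives another section because \<open>f\<close> is equivariant, so the average is
  an equivariant one. \<open>N\<close> fixes both the basis, hence all of \<rho>, and the chosen
  preimages.\<close>

lemma intertwining_section:
  assumes \<sigma>: "compact_representation G T \<sigma>" and \<rho>: "compact_representation G T \<rho>"
    and f: "f \<in> Hom_rep (carrier G) \<sigma> \<rho>" "f ` vspace \<sigma> = vspace \<rho>"
    and fd: "finite_dimensional (vspace \<rho>)"
  obtains s where "s \<in> Hom_rep (carrier G) \<rho> \<sigma>" "\<And>y. y \<in> vspace \<rho> \<Longrightarrow> f (s y) = y"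
proof -
  interpret \<sigma>: compact_representation G T \<sigma> by fact
  interpret \<rho>: compact_representation G T \<rho> by fact
  obtain B where B: "finite B" "cvs.independent B" "cvs.span B = vspace \<rho>"
    using finite_dimensional_basis[OF fd] .
  have BY: "B \<subseteq> vspace \<rho>" using B(3) cvs.span_superset by blast
  have lin_f: "linear_map_on (vspace \<sigma>) (vspace \<rho>) f"
    and eq_f: "\<And>k v. k \<in> carrier G \<Longrightarrow> v \<in> vspace \<sigma> \<Longrightarrow> f (action \<sigma> k v) = action \<rho> k (f v)"
    using f(1) unfolding Hom_rep_def by auto
  have "\<forall>b\<in>B. \<exists>u\<in>vspace \<sigma>. f u = b" using f(2) BY by (metis imageE subsetD)
  then obtain u where u: "\<And>b. b \<in> B \<Longrightarrow> u b \<in> vspace \<sigma>" "\<And>b. b \<in> B \<Longrightarrow> f (u b) = b" by metis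
  obtain N1 where N1: "open_subgroup G T N1" "\<And>n x. n \<in> N1 \<Longrightarrow> x \<in> B \<Longrightarrow> action \<rho> n x = x"
    using \<rho>.open_subgroup_fixing[OF B(1) BY] by blast
  obtain N2 where N2: "open_subgroup G T N2" "\<And>n x. n \<in> N2 \<Longrightarrow> x \<in> u ` B \<Longrightarrow> action \<sigma> n x = x"
    using \<sigma>.open_subgroup_fixing[of "u ` B"] B(1) u(1) by blast
  define N where "N = N1 \<inter> N2"
  have N: "open_subgroup G T N" unfolding N_def using open_subgroup_Int[OF \<sigma>.group_axioms N1(1) N2(1)] .
  have sN: "subgroup N G" using N unfolding open_subgroup_def by blast
  have NG: "N \<subseteq> carrier G" using subgroup.subset[OF sN] .
  have YN: "vspace \<rho> \<subseteq> fixed_vectors N \<rho>"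
    using \<rho>.fixes_span[OF NG BY] N1(2) B(3) unfolding N_def by blast
  define s where "s = intertwining_average G N \<rho> \<sigma> B (\<lambda>b x. cvs.representation B x b) u"
  have s: "s \<in> Hom_rep (carrier G) \<rho> \<sigma>"
    unfolding s_def
  proof (rule intertwining_average_Hom[OF \<sigma>.group_axioms sN \<rho>.rep \<sigma>.rep])
    show "linear_map_on (vspace \<rho>) UNIV (\<lambda>x. cvs.representation B x b)" for b
      using linear_map_on_representation[OF B(2,3)] .
    show "cvs.representation B (action \<rho> n w) b = cvs.representation B w b"
      if "n \<in> N" "w \<in> vspace \<rho>" for n w b
      using YN that unfolding fixed_vectors_def by auto
    show "action \<sigma> n (u b) = u b" if "b \<in> B" "n \<in> N" for b n
      using N2(2) that unfolding N_def by blast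
  qed (use u in auto)
  have "f (s y) = y" if y: "y \<in> vspace \<rho>" for y
  proof -
    define F where "F = (\<lambda>k. \<Sum>b\<in>B. cvs.representation B (action \<rho> k y) b *\<^sub>C action \<sigma> (inv\<^bsub>G\<^esub> k) (u b))"
    have summand: "cvs.representation B (action \<rho> k y) b *\<^sub>C action \<sigma> (inv\<^bsub>G\<^esub> k) (u b) \<in> vspace \<sigma>"
      if "k \<in> carrier G" "b \<in> B" for k b
      using u that \<sigma>.action_mem cvs.subspace_scale[OF \<sigma>.subspace_vspace] by simp
    have FV: "F k \<in> vspace \<sigma>" if "k \<in> carrier G" for k
      unfolding F_def using summand that by (intro cvs.subspace_sum[OF \<sigma>.subspace_vspace]) auto
    have fF: "f (F k) = y" if k: "k \<in> carrier G" for k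
    proof -
      have ky: "action \<rho> k y \<in> vspace \<rho>" using \<rho>.action_mem k y by blast
      have "f (F k) = (\<Sum>b\<in>B. f (cvs.representation B (action \<rho> k y) b *\<^sub>C action \<sigma> (inv\<^bsub>G\<^esub> k) (u b)))"
        unfolding F_def using summand k by (intro linear_map_on_sum[OF lin_f \<sigma>.subspace_vspace]) auto
      also have "\<dots> = (\<Sum>b\<in>B. cvs.representation B (action \<rho> k y) b *\<^sub>C action \<rho> (inv\<^bsub>G\<^esub> k) b)"
        using k u \<sigma>.action_mem linear_map_onD(3)[OF lin_f] eq_f by (intro sum.cong) auto
      also have "\<dots> = action \<rho> (inv\<^bsub>G\<^esub> k) (action \<rho> k y)"
        using k by (intro sum_representation_linear[OF B \<rho>.linear_action ky]) auto
      finally show ?thesis using \<rho>.action_inv[OF k y] by simp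
    qed
    have sumV: "coset_sum G N F \<in> vspace \<sigma>"
      using \<sigma>.coset_sum_mem[OF sN \<sigma>.subspace_vspace] FV by blast
    have "s y = inverse (of_nat (card (rcosets\<^bsub>G\<^esub> N))) *\<^sub>C coset_sum G N F"
      using y unfolding s_def intertwining_average_def F_def by simp
    hence "f (s y) = inverse (of_nat (card (rcosets\<^bsub>G\<^esub> N))) *\<^sub>C coset_sum G N (\<lambda>k. f (F k))"
      using linear_map_onD(3)[OF lin_f sumV]
        \<sigma>.linear_coset_sum[OF sN lin_f \<sigma>.subspace_vspace, of F] FV by simp
    thus ?thesis using \<sigma>.coset_average_const[OF N fF] by simp
  qed
  thus thesis using that s by blast
qed

text \<open>Schur orthogonality. Averaging the rank-one map
  \<open>w \<mapsto> \<zeta> w *\<^sub>C u\<close> (hence the one-element index set) gives an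
  intertwiner from \<sigma> to \<rho>, which must be 0; the sum in question is \<open>\<mu>\<close>
  applied to the unnormalized average.\<close>

lemma matrix_coefficients_orthogonal:
  assumes \<sigma>: "compact_representation G T \<sigma>" and \<rho>: "compact_representation G T \<rho>"
    and Hom: "Hom_rep (carrier G) \<sigma> \<rho> = {0}" and N: "open_subgroup G T N"
    and \<zeta>: "linear_map_on (vspace \<sigma>) UNIV \<zeta>"
      "\<And>n w. n \<in> N \<Longrightarrow> w \<in> vspace \<sigma> \<Longrightarrow> \<zeta> (action \<sigma> n w) = \<zeta> w"
    and u: "u \<in> vspace \<rho>" "\<And>n. n \<in> N \<Longrightarrow> action \<rho> n u = u"
    and \<mu>: "linear_map_on (vspace \<rho>) UNIV \<mu>" and w: "w \<in> vspace \<sigma>"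
  shows "coset_sum G N (\<lambda>k. \<zeta> (action \<sigma> k w) * \<mu> (action \<rho> (inv\<^bsub>G\<^esub> k) u)) = (0::complex)"
proof -
  interpret \<sigma>: compact_representation G T \<sigma> by fact
  interpret \<rho>: compact_representation G T \<rho> by fact
  have sN: "subgroup N G" using N unfolding open_subgroup_def by blast
  define F where "F = (\<lambda>k. \<zeta> (action \<sigma> k w) *\<^sub>C action \<rho> (inv\<^bsub>G\<^esub> k) u)"
  have FV: "F k \<in> vspace \<rho>" if "k \<in> carrier G" for k
    unfolding F_def using that u(1) \<rho>.action_mem cvs.subspace_scale[OF \<rho>.subspace_vspace] by simp
  have "intertwining_average G N \<sigma> \<rho> {()} (\<lambda>_. \<zeta>) (\<lambda>_. u) \<in> Hom_rep (carrier G) \<sigma> \<rho>"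
    by (rule intertwining_average_Hom[OF \<sigma>.group_axioms sN \<sigma>.rep \<rho>.rep]) (use \<zeta> u in auto)
  hence "intertwining_average G N \<sigma> \<rho> {()} (\<lambda>_. \<zeta>) (\<lambda>_. u) w = 0" using Hom by simp
  hence "inverse (of_nat (card (rcosets\<^bsub>G\<^esub> N))) *\<^sub>C coset_sum G N F = 0"
    using w unfolding intertwining_average_def F_def by simp
  hence "coset_sum G N F = 0" using \<sigma>.card_rcosets_pos[OF N] by (simp add: cvs.scale_eq_0_iff)
  hence "coset_sum G N (\<lambda>k. \<mu> (F k)) = 0"
    using \<sigma>.linear_coset_sum[OF sN \<mu> \<rho>.subspace_vspace, of F] FV
      linear_map_on_zero[OF \<mu> \<rho>.subspace_vspace] by simp
  moreover have "coset_sum G N (\<lambda>k. \<mu> (F k)) =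
      coset_sum G N (\<lambda>k. \<zeta> (action \<sigma> k w) * \<mu> (action \<rho> (inv\<^bsub>G\<^esub> k) u))"
    using linear_map_onD(3)[OF \<mu>] u \<rho>.action_mem unfolding F_def
    by (intro \<sigma>.coset_sum_cong[OF sN]) simp
  ultimately show ?thesis by simp
qed

lemma nonzero_Hom_surj:
  assumes \<sigma>: "group_rep G \<sigma>" and \<rho>: "irreducible_rep G \<rho>"
    and f: "f \<in> Hom_rep (carrier G) \<sigma> \<rho>" "v \<in> vspace \<sigma>" "f v \<noteq> 0"
  shows "f ` vspace \<sigma> = vspace \<rho>"
proof -
  have lin: "linear_map_on (vspace \<sigma>) (vspace \<rho>) f"
    and eq: "\<And>k v. k \<in> carrier G \<Longrightarrow> v \<in> vspace \<sigma> \<Longrightarrow> f (action \<sigma> k v) = action \<rho> k (f v)"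
    using f(1) unfolding Hom_rep_def by auto
  have sub: "cvs.subspace (vspace \<sigma>)"
    and inv: "\<And>k v. k \<in> carrier G \<Longrightarrow> v \<in> vspace \<sigma> \<Longrightarrow> action \<sigma> k v \<in> vspace \<sigma>"
    using \<sigma> unfolding group_rep_def linear_map_on_def by blast+
  have "cvs.subspace (f ` vspace \<sigma>)" using linear_map_on_subspace_image[OF lin sub] by simp
  moreover have "f ` vspace \<sigma> \<subseteq> vspace \<rho>" using linear_map_onD(1)[OF lin] by blast
  moreover have "\<forall>g\<in>carrier G. action \<rho> g ` (f ` vspace \<sigma>) \<subseteq> f ` vspace \<sigma>"
  proof (intro ballI subsetI)
    fix g y assume g: "g \<in> carrier G" and "y \<in> action \<rho> g ` (f ` vspace \<sigma>)"
    then obtain w where w: "w \<in> vspace \<sigma>" "y = action \<rho> g (f w)" by blast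
    hence "y = f (action \<sigma> g w)" using eq[OF g] by simp
    thus "y \<in> f ` vspace \<sigma>" using inv[OF g w(1)] by blast
  qed
  ultimately have "f ` vspace \<sigma> = {0} \<or> f ` vspace \<sigma> = vspace \<rho>"
    using \<rho> unfolding irreducible_rep_def by blast
  thus ?thesis using f(2,3) by blast
qed

section \<open>Smooth functionals\<close>

text \<open>Translates an open stabilizer for \<open>dual_action\<close>, which involves inverses
  and extension by 0, into the plain invariance under an open subgroup that averaging
  requires.\<close>

lemma smooth_dual_invariant:
  fixes G (structure)
  assumes G: "topological_group G T" and \<pi>: "group_rep G \<pi>" and \<xi>: "\<xi> \<in> smooth_dual G T \<pi>"
  obtains N where "open_subgroup G T N" "\<And>n v. n \<in> N \<Longrightarrow> v \<in> vspace \<pi> \<Longrightarrow> \<xi> (action \<pi> n v) = \<xi> v"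
proof -
  interpret group_representation G \<pi>
    using topological_group_group[OF G] \<pi> by (simp add: group_representation_def group_representation_axioms_def)
  define N where "N = {g \<in> carrier G. dual_action G \<pi> g \<xi> = \<xi>}"
  have \<xi>0: "\<xi> v = 0" if "v \<notin> vspace \<pi>" for v using \<xi> that unfolding smooth_dual_def by blast
  have iff: "g \<in> N \<longleftrightarrow> (\<forall>v\<in>vspace \<pi>. \<xi> (action \<pi> g v) = \<xi> v)" if g: "g \<in> carrier G" for g
  proof
    assume n: "g \<in> N"
    show "\<forall>v\<in>vspace \<pi>. \<xi> (action \<pi> g v) = \<xi> v"
    proof
      fix v assume v: "v \<in> vspace \<pi>"
      have "\<xi> (action \<pi> g v) = dual_action G \<pi> g \<xi> (action \<pi> g v)" using n unfolding N_def by simp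
      also have "\<dots> = \<xi> v" using action_mem action_inv g v by (simp add: dual_action_def)
      finally show "\<xi> (action \<pi> g v) = \<xi> v" .
    qed
  next
    assume inv: "\<forall>v\<in>vspace \<pi>. \<xi> (action \<pi> g v) = \<xi> v"
    have "dual_action G \<pi> g \<xi> v = \<xi> v" for v
    proof (cases "v \<in> vspace \<pi>")
      case True
      thus ?thesis using inv[rule_format, of "action \<pi> (inv g) v"] action_mem[of "inv g" v] action_inv(2)[OF g] g
        by (simp add: dual_action_def)
    qed (use \<xi>0 in \<open>simp add: dual_action_def\<close>)
    thus "g \<in> N" using g unfolding N_def by blast
  qed
  have NG: "N \<subseteq> carrier G" unfolding N_def by blast
  have "subgroup N G"
  proof (rule subgroupI[OF NG])
    show "N \<noteq> {}" using iff[of \<one>] action_one by auto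
    fix a assume a: "a \<in> N"
    hence aG: "a \<in> carrier G" using NG by blast
    have "\<xi> (action \<pi> (inv a) v) = \<xi> v" if v: "v \<in> vspace \<pi>" for v
    proof -
      have "\<xi> (action \<pi> a (action \<pi> (inv a) v)) = \<xi> (action \<pi> (inv a) v)"
        using iff[OF aG] a action_mem[of "inv a" v] aG v by simp
      thus ?thesis using action_inv(2)[OF aG v] by simp
    qed
    thus "inv a \<in> N" using iff[of "inv a"] aG by simp
    fix b assume b: "b \<in> N"
    hence bG: "b \<in> carrier G" using NG by blast
    show "a \<otimes> b \<in> N"
      using iff[of "a \<otimes> b"] iff[OF aG] iff[OF bG] a b aG bG action_mem action_mult by simp
  qed
  hence "open_subgroup G T N" using \<xi> unfolding open_subgroup_def smooth_dual_def N_def by blast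
  thus thesis using that iff NG by blast
qed

text \<open>The stabilizer of \<open>\<xi>\<close> is stable under left multiplication by
  \<open>N\<close>, so it is a union of open cosets.\<close>

lemma smooth_dualI:
  fixes G (structure)
  assumes G: "topological_group G T" and \<pi>: "group_rep G \<pi>"
    and \<xi>: "linear_map_on (vspace \<pi>) UNIV \<xi>" "\<And>v. v \<notin> vspace \<pi> \<Longrightarrow> \<xi> v = 0"
    and N: "open_subgroup G T N" "\<And>n v. n \<in> N \<Longrightarrow> v \<in> vspace \<pi> \<Longrightarrow> \<xi> (action \<pi> n v) = \<xi> v"
  shows "\<xi> \<in> smooth_dual G T \<pi>"
proof -
  interpret group_representation G \<pi>
    using topological_group_group[OF G] \<pi> by (simp add: group_representation_def group_representation_axioms_def)
  have sN: "subgroup N G" using N(1) unfolding open_subgroup_def by blast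
  have "openin T {g \<in> carrier G. dual_action G \<pi> g \<xi> = \<xi>}"
  proof (rule openin_of_r_cosets[OF G _ subgroup.one_closed[OF sN]])
    show "openin T N" using N(1) unfolding open_subgroup_def by blast
    fix n a assume n: "n \<in> N" and a: "a \<in> {g \<in> carrier G. dual_action G \<pi> g \<xi> = \<xi>}"
    have nG: "n \<in> carrier G" "inv n \<in> N"
      using n subgroup.mem_carrier[OF sN] subgroup.m_inv_closed[OF sN] by auto
    have aG: "a \<in> carrier G" using a by blast
    have "dual_action G \<pi> (n \<otimes> a) \<xi> v = \<xi> v" for v
    proof (cases "v \<in> vspace \<pi>")
      case True
      have m: "action \<pi> (inv n) v \<in> vspace \<pi>" using True nG action_mem by simp
      have "dual_action G \<pi> (n \<otimes> a) \<xi> v = dual_action G \<pi> a \<xi> (action \<pi> (inv n) v)"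
        using True m nG aG by (simp add: dual_action_def inv_mult_group action_mult)
      also have "\<dots> = \<xi> v" using a N(2)[OF nG(2) True] by simp
      finally show ?thesis .
    qed (use \<xi>(2) in \<open>simp add: dual_action_def\<close>)
    thus "n \<otimes> a \<in> {g \<in> carrier G. dual_action G \<pi> g \<xi> = \<xi>}" using nG a by auto
  qed blast
  thus ?thesis using \<xi> unfolding smooth_dual_def by blast
qed

lemma open_subgroup_of_open_subgroup:
  assumes "group G" "subgroup K G" "openin T K" "open_subgroup (G\<lparr>carrier := K\<rparr>) (subtopology T K) N"
  shows "open_subgroup G T N"
  using assms group.incl_subgroup[OF assms(1,2)] openin_trans_full[of T K N]
  unfolding open_subgroup_def by blast

section \<open>Isomorphism classes and the sets \<open>\<V>(K, \<rho>)\<close>\<close>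

lemma irr_classesD:
  assumes "c \<in> irr_classes G T" "\<pi> \<in> c"
  shows "irreducible_smooth G T \<pi>" "\<pi>' \<in> c \<Longrightarrow> isomorphic_reps G \<pi> \<pi>'"
proof -
  show "irreducible_smooth G T \<pi>"
    using in_quotient_imp_subset[OF equiv_irr_iso_rel, of c G T] assms unfolding irr_classes_def by blast
  assume "\<pi>' \<in> c"
  thus "isomorphic_reps G \<pi> \<pi>'"
    using in_quotient_imp_in_rel[OF equiv_irr_iso_rel, of c G T \<pi> \<pi>'] assms
    unfolding irr_classes_def irr_iso_rel_def by blast
qed

lemma irr_classes_nonempty:
  assumes "c \<in> irr_classes G T"
  obtains \<pi> where "\<pi> \<in> c"
  using in_quotient_imp_non_empty[OF equiv_irr_iso_rel, of c G T] assms unfolding irr_classes_def by blast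

lemma irr_class_of:
  assumes "irreducible_smooth G T \<pi>"
  shows "irr_iso_rel G T `` {\<pi>} \<in> irr_classes G T" "\<pi> \<in> irr_iso_rel G T `` {\<pi>}"
proof -
  show "irr_iso_rel G T `` {\<pi>} \<in> irr_classes G T"
    using assms unfolding irr_classes_def by (intro quotientI) simp
  show "\<pi> \<in> irr_iso_rel G T `` {\<pi>}"
    using equiv_class_self[OF equiv_irr_iso_rel, of \<pi> G T] assms by simp
qed

lemma irreducible_smoothD:
  assumes "irreducible_smooth G T \<pi>"
  shows "smooth_rep G T \<pi>" "irreducible_rep G \<pi>" "group_rep G \<pi>"
  using assms unfolding irreducible_smooth_def smooth_rep_def by auto

lemma Hom_rep_comp:
  assumes f: "f \<in> Hom_rep K \<pi> \<rho>" and h: "h \<in> Hom_rep K \<rho> \<sigma>" "h 0 = 0"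
  shows "h \<circ> f \<in> Hom_rep K \<pi> \<sigma>"
proof -
  have "f v \<in> vspace \<rho>" if "v \<in> vspace \<pi>" for v
    using f that unfolding Hom_rep_def linear_map_on_def by blast
  thus ?thesis using f h unfolding Hom_rep_def linear_map_on_def by auto
qed

text \<open>\<open>fell_basic\<close> only provides some pair of representatives with a nonzero map,
  whereas \<open>fell_open\<close> asks for a neighborhood at every representative. The map is
  transported to a prescribed pair by composing with isomorphisms on both sides.\<close>

lemma fell_basicD:
  assumes c: "c \<in> fell_basic G T K r" and K: "subgroup K G"
    and r: "r \<in> subgroup_classes G T K" and \<pi>: "\<pi> \<in> c" and \<rho>: "\<rho> \<in> r"
  obtains f v where "f \<in> Hom_rep K \<pi> \<rho>" "v \<in> vspace \<pi>" "f v \<noteq> 0"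
proof -
  let ?K = "G\<lparr>carrier := K\<rparr>"
  obtain \<pi>0 \<rho>0 where c': "c \<in> irr_classes G T" "\<pi>0 \<in> c" "\<rho>0 \<in> r" "Hom_rep K \<pi>0 \<rho>0 \<noteq> {0}"
    using c unfolding fell_basic_def by blast
  have r': "r \<in> irr_classes ?K (subtopology T K)" using r unfolding subgroup_classes_def .
  have reps: "group_rep G \<pi>" "group_rep G \<pi>0" "group_rep ?K \<rho>" "group_rep ?K \<rho>0"
    using irr_classesD(1)[OF c'(1)] irr_classesD(1)[OF r'] c' \<pi> \<rho> irreducible_smoothD(3) by blast+
  obtain a where a: "a \<in> Hom_rep (carrier G) \<pi> \<pi>0" "bij_betw a (vspace \<pi>) (vspace \<pi>0)"
    using irr_classesD(2)[OF c'(1) \<pi> c'(2)] unfolding isomorphic_reps_def by blast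
  obtain b where b: "b \<in> Hom_rep (carrier ?K) \<rho>0 \<rho>" "bij_betw b (vspace \<rho>0) (vspace \<rho>)"
    using irr_classesD(2)[OF r' c'(3) \<rho>] unfolding isomorphic_reps_def by blast
  have aK: "a \<in> Hom_rep K \<pi> \<pi>0" using a(1) subgroup.mem_carrier[OF K] unfolding Hom_rep_def by blast
  have bK: "b \<in> Hom_rep K \<rho>0 \<rho>" using b(1) by simp
  have sub: "cvs.subspace (vspace \<pi>0)" "cvs.subspace (vspace \<rho>0)"
    using reps unfolding group_rep_def by auto
  \<comment> \<open>\<open>Hom_rep K \<pi>0 \<rho>0 \<noteq> {0}\<close> would also hold for an
    empty set. A nonzero member can be extracted only once the zero map is known to belong to
    it.\<close>
  have "0 \<in> Hom_rep K \<pi>0 \<rho>0"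
  proof -
    have "action \<rho>0 k 0 = 0" if "k \<in> K" for k
      using reps(4) that linear_map_on_zero[OF _ sub(2)] unfolding group_rep_def by auto
    thus ?thesis using cvs.subspace_0[OF sub(2)] unfolding Hom_rep_def linear_map_on_def by auto
  qed
  then obtain f where f: "f \<in> Hom_rep K \<pi>0 \<rho>0" "f \<noteq> 0" using c'(4) by blast
  then obtain x where x: "f x \<noteq> 0" by (metis ext zero_fun_def)
  have xV: "x \<in> vspace \<pi>0" using f(1) x unfolding Hom_rep_def by blast
  then have "x \<in> a ` vspace \<pi>" using a(2) unfolding bij_betw_def by simp
  then obtain v where v: "v \<in> vspace \<pi>" "a v = x" by (metis imageE)
  have f0: "f 0 = 0" using f(1) linear_map_on_zero[OF _ sub(1)] unfolding Hom_rep_def by blast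
  have b0: "b 0 = 0" using b(1) linear_map_on_zero[OF _ sub(2)] unfolding Hom_rep_def by blast
  have fx: "f x \<in> vspace \<rho>0" using f(1) xV unfolding Hom_rep_def linear_map_on_def by blast
  have "b (f x) \<noteq> b 0"
    using inj_on_eq_iff[OF bij_betw_imp_inj_on[OF b(2)] fx cvs.subspace_0[OF sub(2)]] x by simp
  hence "(b \<circ> (f \<circ> a)) v \<noteq> 0" using v b0 by simp
  moreover have "f \<circ> a \<in> Hom_rep K \<pi> \<rho>0"
    by (rule Hom_rep_comp[of a K \<pi> \<pi>0 f \<rho>0]) (fact aK f(1) f0)+
  then have "b \<circ> (f \<circ> a) \<in> Hom_rep K \<pi> \<rho>"
    by (rule Hom_rep_comp[of "f \<circ> a" K \<pi> \<rho>0 b \<rho>]) (fact bK b0)+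
  ultimately show thesis using that v(1) by blast
qed

lemma compact_open_subgroupD:
  assumes "compact_open_subgroup G T K"
  shows "subgroup K G" "compactin T K" "openin T K" "open_subgroup G T K"
  using assms unfolding compact_open_subgroup_def open_subgroup_def by auto

lemma smooth_functional_restrict:
  assumes G: "topological_group G T" and K: "subgroup K G" and \<pi>: "group_rep G \<pi>"
    and \<xi>: "\<xi> \<in> smooth_dual G T \<pi>"
  obtains N where "open_subgroup (G\<lparr>carrier := K\<rparr>) (subtopology T K) N"
    "\<And>n v. n \<in> N \<Longrightarrow> v \<in> vspace \<pi> \<Longrightarrow> \<xi> (action \<pi> n v) = \<xi> v"
proof -
  obtain N where N: "open_subgroup G T N" "\<And>n v. n \<in> N \<Longrightarrow> v \<in> vspace \<pi> \<Longrightarrow> \<xi> (action \<pi> n v) = \<xi> v"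
    using smooth_dual_invariant[OF G \<pi> \<xi>] by blast
  show thesis
    using that[OF open_subgroup_restrict[OF topological_group_group[OF G] N(1) K]] N(2) by blast
qed

text \<open>For a basis \<open>e\<^sub>i\<close> of \<open>\<rho>\<close> with dual basis \<open>e\<^sub>i\<^sup>*\<close>, a linear form \<open>\<mu>\<close> and \<open>x = f v\<close>, the sum
  \<open>\<Sum>\<^sub>i e\<^sub>i\<^sup>*(\<rho>(k) x) \<mu>(\<rho>(k)\<^sup>-\<^sup>1 e\<^sub>i) = \<mu>(x)\<close> does not depend on \<open>k\<close>, whereas its analogue for
  coefficients of a representation without a nonzero intertwiner to \<open>\<rho>\<close> averages to \<open>0\<close>. Hence the
  coefficients \<open>e\<^sub>i\<^sup>*(f(\<pi>(k) v))\<close> cannot be approximated by the latter.\<close>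

lemma fell_basic_open:
  assumes G: "topological_group G T" and K: "compact_open_subgroup G T K"
    and r: "r \<in> subgroup_classes G T K"
  shows "fell_open G T (fell_basic G T K r)"
  unfolding fell_open_def
proof (intro conjI ballI)
  show "fell_basic G T K r \<subseteq> irr_classes G T" unfolding fell_basic_def by blast
next
  fix c \<pi> assume c: "c \<in> fell_basic G T K r" and \<pi>: "\<pi> \<in> c"
  let ?K = "G\<lparr>carrier := K\<rparr>" and ?T = "subtopology T K"
  note K' = compact_open_subgroupD[OF K]
  have gG: "group G" using topological_group_group[OF G] .
  have r': "r \<in> irr_classes ?K ?T" using r unfolding subgroup_classes_def .
  obtain \<rho> where \<rho>: "\<rho> \<in> r" using irr_classes_nonempty[OF r'] .
  have c': "c \<in> irr_classes G T" using c unfolding fell_basic_def by blast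
  have irr: "irreducible_smooth G T \<pi>" "irreducible_smooth ?K ?T \<rho>"
    using irr_classesD(1) c' r' \<pi> \<rho> by blast+
  note \<pi>' = irreducible_smoothD[OF irr(1)] and \<rho>' = irreducible_smoothD[OF irr(2)]
  have rep\<sigma>: "compact_representation ?K ?T \<sigma>" if "smooth_rep G T \<sigma>" for \<sigma> :: "'a frep"
    using compact_representation_subgroup[OF G K'(1,2) that] .
  interpret \<pi>: compact_representation ?K ?T \<pi> using rep\<sigma>[OF \<pi>'(1)] .
  interpret \<rho>: compact_representation ?K ?T \<rho>
    using compact_group_subgroup[OF G K'(1,2)] \<rho>'(1)
    by (simp add: compact_representation_def compact_representation_axioms_def)
  obtain f v where f: "f \<in> Hom_rep K \<pi> \<rho>" "v \<in> vspace \<pi>" "f v \<noteq> 0"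
    using fell_basicD[OF c K'(1) r \<pi> \<rho>] .
  have lin_f: "linear_map_on (vspace \<pi>) (vspace \<rho>) f"
    and eq_f: "\<And>k v. k \<in> K \<Longrightarrow> v \<in> vspace \<pi> \<Longrightarrow> f (action \<pi> k v) = action \<rho> k (f v)"
    using f(1) unfolding Hom_rep_def by auto
  obtain B where B: "finite B" "cvs.independent B" "cvs.span B = vspace \<rho>"
    using finite_dimensional_basis[OF \<rho>.irreducible_finite_dimensional[OF \<rho>'(2)]] .
  have BV: "B \<subseteq> vspace \<rho>" using B(3) cvs.span_superset by blast
  define n where "n = card B"
  obtain e where e: "bij_betw e {1..n} B"
    using ex_bij_betw_nat_finite_1[OF B(1)] unfolding n_def by blast
  have eB: "e j \<in> B" "e j \<in> vspace \<rho>" if "j \<in> {1..n}" for j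
    using bij_betw_apply[OF e that] BV by auto
  define co where "co = (\<lambda>b x. cvs.representation B x b)"
  have co_lin: "linear_map_on (vspace \<rho>) UNIV (co b)" for b
    unfolding co_def using linear_map_on_representation[OF B(2,3)] .
  define x where "x = f v"
  have xV: "x \<in> vspace \<rho>" unfolding x_def using linear_map_onD(1)[OF lin_f f(2)] .
  have x0: "x \<noteq> 0" unfolding x_def by (rule f(3))
  obtain b0 where b0: "b0 \<in> B" "co b0 x \<noteq> 0"
  proof -
    have "(\<Sum>b\<in>B. co b x *\<^sub>C b) = x" unfolding co_def using sum_representation[OF B xV] .
    hence "\<exists>b\<in>B. co b x \<noteq> 0" using x0 sum.neutral[of B "\<lambda>b. co b x *\<^sub>C b"] by auto
    thus thesis using that by blast
  qed
  \<comment> \<open>A coordinate that does not vanish at \<open>x\<close>: the number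
    \<open>\<mu> x\<close> is the gap that no approximating coefficients can bridge.\<close>
  define \<mu> where "\<mu> = co b0"
  have \<mu>: "linear_map_on (vspace \<rho>) UNIV \<mu>" unfolding \<mu>_def by (rule co_lin)
  have n: "n > 0" unfolding n_def using b0(1) B(1) by (auto simp: card_gt_0_iff)
  obtain N where N: "open_subgroup ?K ?T N" "\<And>m x. m \<in> N \<Longrightarrow> x \<in> B \<Longrightarrow> action \<rho> m x = x"
    using \<rho>.open_subgroup_fixing[OF B(1) BV] by blast
  have sN: "subgroup N ?K" and NK: "N \<subseteq> K"
    using N(1) subgroup.subset[of N ?K] unfolding open_subgroup_def by auto
  have VN: "vspace \<rho> \<subseteq> fixed_vectors N \<rho>" using \<rho>.fixes_span[of N B] NK BV N(2) B(3) by simp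
  \<comment> \<open>\<open>f\<close> commutes only with \<open>K\<close>, but these forms are smooth
    for \<open>G\<close>: \<open>N\<close> acts trivially on \<rho>, and it is open in
    \<open>G\<close> because \<open>K\<close> is.\<close>
  define \<xi> where "\<xi> = (\<lambda>j w. if w \<in> vspace \<pi> then co (e j) (f w) else 0)"
  have \<xi>: "\<xi> j \<in> smooth_dual G T \<pi>" for j
  proof (rule smooth_dualI[OF G \<pi>'(3)])
    show "linear_map_on (vspace \<pi>) UNIV (\<xi> j)"
      unfolding linear_map_on_def
    proof (intro conjI ballI allI)
      fix x y a assume x: "x \<in> vspace \<pi>" and y: "y \<in> vspace \<pi>"
      note fx = linear_map_onD(1)[OF lin_f x] and fy = linear_map_onD(1)[OF lin_f y]
      show "\<xi> j (x + y) = \<xi> j x + \<xi> j y"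
        using x y cvs.subspace_add[OF \<pi>.subspace_vspace x y] linear_map_onD(2)[OF lin_f x y]
          linear_map_onD(2)[OF co_lin fx fy] unfolding \<xi>_def by simp
    next
      fix x a assume x: "x \<in> vspace \<pi>"
      show "\<xi> j (a *\<^sub>C x) = a *\<^sub>C \<xi> j x"
        using x cvs.subspace_scale[OF \<pi>.subspace_vspace x] linear_map_onD(3)[OF lin_f x]
          linear_map_onD(3)[OF co_lin linear_map_onD(1)[OF lin_f x]] unfolding \<xi>_def by simp
    qed simp
    show "open_subgroup G T N" using open_subgroup_of_open_subgroup[OF gG K'(1,3) N(1)] .
    fix m w assume m: "m \<in> N" and w: "w \<in> vspace \<pi>"
    have "action \<rho> m (f w) = f w"
      using VN m linear_map_onD(1)[OF lin_f w] unfolding fixed_vectors_def by blast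
    thus "\<xi> j (action \<pi> m w) = \<xi> j w"
      using eq_f[of m w] m NK w \<pi>.action_mem[of m w] unfolding \<xi>_def by auto
  qed (simp add: \<xi>_def)
  define q where "q = (\<lambda>j k. \<mu> (action \<rho> (inv\<^bsub>?K\<^esub> k) (e j)))"
  \<comment> \<open>The vectors \<open>\<rho>(k)^-1 (e j)\<close> run through a finite orbit, so
    \<open>q\<close> takes finitely many values. The resulting bound depends on \<rho> alone and may
    enter \<epsilon> before any \<sigma> is considered.\<close>
  have "finite (\<Union>j\<in>{1..n}. (\<lambda>k. cmod (q j k)) ` K)"
  proof (intro finite_UN_I)
    fix j assume j: "j \<in> {1..n}"
    have "(\<lambda>k. cmod (q j k)) ` K \<subseteq> (\<lambda>y. cmod (\<mu> y)) ` ((\<lambda>k. action \<rho> k (e j)) ` carrier ?K)"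
      using \<pi>.inv_closed unfolding q_def by auto
    thus "finite ((\<lambda>k. cmod (q j k)) ` K)" using \<rho>.finite_orbit[OF eB(2)[OF j]] finite_subset by blast
  qed simp
  hence "bdd_above (\<Union>j\<in>{1..n}. (\<lambda>k. cmod (q j k)) ` K)" by (rule bdd_above_finite)
  then obtain M0 where M0: "\<And>j k. j \<in> {1..n} \<Longrightarrow> k \<in> K \<Longrightarrow> cmod (q j k) \<le> M0"
    unfolding bdd_above_def by blast
  define M where "M = max M0 1"
  have M: "M > 0" "\<And>j k. j \<in> {1..n} \<Longrightarrow> k \<in> K \<Longrightarrow> cmod (q j k) \<le> M"
    using M0 unfolding M_def by fastforce+
  \<comment> \<open>Chosen so that \<open>n\<close> error terms, each below \<epsilon> and weighted
    by at most \<open>M\<close>, add up to less than \<open>cmod (\<mu> x)\<close>. The maximum with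
    1 in \<open>M\<close> keeps the denominator positive.\<close>
  define \<epsilon> where "\<epsilon> = cmod (\<mu> x) / (n * M)"
  have \<epsilon>: "\<epsilon> > 0" using b0(2) n M(1) unfolding \<epsilon>_def \<mu>_def by simp
  have coeff: "(\<Sum>j=1..n. \<xi> j (action \<pi> k v) * q j k) = \<mu> x" if k: "k \<in> K" for k
  proof -
    have kx: "action \<rho> k x \<in> vspace \<rho>" using \<rho>.action_mem k xV by simp
    have ik: "inv\<^bsub>?K\<^esub> k \<in> carrier ?K" using \<pi>.inv_closed k by simp
    have lin: "linear_map_on (vspace \<rho>) UNIV (\<lambda>y. \<mu> (action \<rho> (inv\<^bsub>?K\<^esub> k) y))"
      using linear_map_onD[OF \<rho>.linear_action[OF ik]] linear_map_onD[OF \<mu>]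
      unfolding linear_map_on_def by simp
    have "(\<Sum>j=1..n. \<xi> j (action \<pi> k v) * q j k)
        = (\<Sum>j=1..n. cvs.representation B (action \<rho> k x) (e j) *\<^sub>C \<mu> (action \<rho> (inv\<^bsub>?K\<^esub> k) (e j)))"
      using \<pi>.action_mem[of k v] k f(2) eq_f[OF k f(2)] unfolding \<xi>_def q_def co_def x_def
      by (intro sum.cong) auto
    also have "\<dots> = (\<Sum>b\<in>B. cvs.representation B (action \<rho> k x) b *\<^sub>C \<mu> (action \<rho> (inv\<^bsub>?K\<^esub> k) b))"
      using sum.reindex_bij_betw[OF e] .
    also have "\<dots> = \<mu> (action \<rho> (inv\<^bsub>?K\<^esub> k) (action \<rho> k x))"
      using sum_representation_linear[OF B lin kx] .
    finally show ?thesis using \<rho>.action_inv(1)[of k x] k xV by simp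
  qed
  have "fell_nbhd G T \<pi> n (\<lambda>_. v) \<xi> K \<epsilon> \<subseteq> fell_basic G T K r"
  proof
    fix c2 assume "c2 \<in> fell_nbhd G T \<pi> n (\<lambda>_. v) \<xi> K \<epsilon>"
    then obtain \<sigma> w \<zeta> where c2: "c2 \<in> irr_classes G T" "\<sigma> \<in> c2"
      and w\<zeta>: "\<And>j. j \<in> {1..n} \<Longrightarrow> w j \<in> vspace \<sigma>" "\<And>j. j \<in> {1..n} \<Longrightarrow> \<zeta> j \<in> smooth_dual G T \<sigma>"
      and close: "\<And>j k. j \<in> {1..n} \<Longrightarrow> k \<in> K \<Longrightarrow>
        cmod (\<xi> j (action \<pi> k v) - \<zeta> j (action \<sigma> k (w j))) < \<epsilon>"
      unfolding fell_nbhd_def by blast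
    note \<sigma>' = irreducible_smoothD[OF irr_classesD(1)[OF c2]]
    have "Hom_rep K \<sigma> \<rho> \<noteq> {0}"
    proof
      assume Hom: "Hom_rep K \<sigma> \<rho> = {0}"
      have "\<exists>L. open_subgroup ?K ?T L \<and> (\<forall>m\<in>L. \<forall>y\<in>vspace \<sigma>. \<zeta> j (action \<sigma> m y) = \<zeta> j y)"
        if j: "j \<in> {1..n}" for j
        using smooth_functional_restrict[OF G K'(1) \<sigma>'(3) w\<zeta>(2)[OF j]] by metis
      then obtain L where L: "\<And>j. j \<in> {1..n} \<Longrightarrow> open_subgroup ?K ?T (L j)"
        "\<And>j m y. j \<in> {1..n} \<Longrightarrow> m \<in> L j \<Longrightarrow> y \<in> vspace \<sigma> \<Longrightarrow> \<zeta> j (action \<sigma> m y) = \<zeta> j y"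
        by metis
      \<comment> \<open>Shrinks \<open>N\<close> until all the forms \<open>\<zeta> j\<close> are
        invariant as well, so that one coset space serves all \<open>n\<close> orthogonality
        relations.\<close>
      define N' where "N' = N \<inter> (carrier ?K \<inter> (\<Inter>j\<in>{1..n}. L j))"
      have N': "open_subgroup ?K ?T N'"
        unfolding N'_def using L(1)
        by (intro open_subgroup_Int[OF \<pi>.group_axioms N(1)] open_subgroup_INT[OF \<pi>.topological]) auto
      have orth: "coset_sum ?K N' (\<lambda>k. \<zeta> j (action \<sigma> k (w j)) * q j k) = 0" if j: "j \<in> {1..n}" for j
        unfolding q_def
      proof (rule matrix_coefficients_orthogonal[OF rep\<sigma>[OF \<sigma>'(1)] \<rho>.compact_representation_axioms _ N'])
        show "Hom_rep (carrier ?K) \<sigma> \<rho> = {0}" using Hom by simp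
        show "linear_map_on (vspace \<sigma>) UNIV (\<zeta> j)" using w\<zeta>(2)[OF j] unfolding smooth_dual_def by blast
        show "\<zeta> j (action \<sigma> m y) = \<zeta> j y" if "m \<in> N'" "y \<in> vspace \<sigma>" for m y
          using L(2)[OF j] that j unfolding N'_def by blast
        show "action \<rho> m (e j) = e j" if "m \<in> N'" for m
          using N(2) eB(1)[OF j] that unfolding N'_def by blast
      qed (use eB(2)[OF j] \<mu> w\<zeta>(1)[OF j] in auto)
      \<comment> \<open>The error paired with the test coefficients. Its average is
        \<open>\<mu> x\<close> by the constant sum for \<pi> and orthogonality for \<sigma>, yet
        pointwise its modulus is less than \<open>cmod (\<mu> x)\<close>.\<close>
      define F where "F = (\<lambda>k. \<Sum>j=1..n. (\<xi> j (action \<pi> k v) - \<zeta> j (action \<sigma> k (w j))) * q j k)"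
      have "cmod (F k) < cmod (\<mu> x)" if k: "k \<in> carrier ?K" for k
      proof -
        have kK: "k \<in> K" using k by simp
        have "cmod (F k) \<le> (\<Sum>j=1..n. cmod (\<xi> j (action \<pi> k v) - \<zeta> j (action \<sigma> k (w j))) * cmod (q j k))"
          unfolding F_def norm_mult[symmetric] by (rule norm_sum)
        also have "\<dots> \<le> (\<Sum>j=1..n. cmod (\<xi> j (action \<pi> k v) - \<zeta> j (action \<sigma> k (w j))) * M)"
          using M(2) kK by (intro sum_mono mult_left_mono) auto
        also have "\<dots> < (\<Sum>j=1..n. \<epsilon> * M)"
          using close kK M(1) n by (intro sum_strict_mono mult_strict_right_mono) auto
        also have "\<dots> = cmod (\<mu> x)" using n M(1) by (simp add: \<epsilon>_def)
        finally show ?thesis .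
      qed
      hence "cmod (inverse (of_nat (card (rcosets\<^bsub>?K\<^esub> N'))) *\<^sub>C coset_sum ?K N' F) < cmod (\<mu> x)"
        by (rule \<pi>.coset_average_less[OF N'])
      moreover have "coset_sum ?K N' F = coset_sum ?K N' (\<lambda>k. \<Sum>j=1..n. \<xi> j (action \<pi> k v) * q j k)
          - (\<Sum>j=1..n. coset_sum ?K N' (\<lambda>k. \<zeta> j (action \<sigma> k (w j)) * q j k))"
        unfolding F_def coset_sum_def sum.swap[of _ "{1..n}"] sum_subtractf[symmetric]
        by (simp add: left_diff_distrib sum_subtractf)
      moreover have "inverse (of_nat (card (rcosets\<^bsub>?K\<^esub> N'))) *\<^sub>C
          coset_sum ?K N' (\<lambda>k. \<Sum>j=1..n. \<xi> j (action \<pi> k v) * q j k) = \<mu> x"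
        using coeff by (intro \<pi>.coset_average_const[OF N']) auto
      ultimately show False using orth by simp
    qed
    thus "c2 \<in> fell_basic G T K r" using c2 \<rho> unfolding fell_basic_def by blast
  qed
  thus "\<exists>n v \<xi> B \<epsilon>. (\<forall>j\<in>{1..n}. v j \<in> vspace \<pi> \<and> \<xi> j \<in> smooth_dual G T \<pi>) \<and> compactin T B \<and>
      0 < \<epsilon> \<and> fell_nbhd G T \<pi> n v \<xi> B \<epsilon> \<subseteq> fell_basic G T K r"
    using f(2) \<xi> K'(2) \<epsilon> by (intro exI[of _ n] exI[of _ "\<lambda>_. v"] exI[of _ \<xi>] exI[of _ K] exI[of _ \<epsilon>]) simp
qed

section \<open>Irreducible representations of large compact open subgroups\<close>

lemma lc_groupD:
  assumes "lc_group G T"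
  shows "topological_group G T" "g \<in> carrier G \<Longrightarrow> \<exists>K. compact_open_subgroup G T K \<and> g \<in> K"
    "compact_open_subgroup G T K \<Longrightarrow> compact_open_subgroup G T L \<Longrightarrow>
      \<exists>M. compact_open_subgroup G T M \<and> K \<union> L \<subseteq> M"
  using assms unfolding lc_group_def l_group_def by blast+

lemma lc_group_finite_Union:
  assumes lc: "lc_group G T" and fin: "finite \<F>" and F: "\<And>K. K \<in> \<F> \<Longrightarrow> compact_open_subgroup G T K"
  obtains M where "compact_open_subgroup G T M" "\<Union>\<F> \<subseteq> M"
proof -
  have "\<exists>M. compact_open_subgroup G T M \<and> \<Union>\<F> \<subseteq> M"
    using fin F
  proof (induction \<F>)
    case empty
    have "\<one>\<^bsub>G\<^esub> \<in> carrier G"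
      using topological_group_group[OF lc_groupD(1)[OF lc]] by (simp add: group.is_monoid)
    from lc_groupD(2)[OF lc this] show ?case by auto
  next
    case (insert K \<F>)
    then obtain M where M: "compact_open_subgroup G T M" "\<Union>\<F> \<subseteq> M" by auto
    have "compact_open_subgroup G T K" using insert.prems by simp
    from lc_groupD(3)[OF lc this M(1)] obtain M' where "compact_open_subgroup G T M'" "K \<union> M \<subseteq> M'"
      by blast
    thus ?case using M(2) by (intro exI[of _ M']) auto
  qed
  thus thesis by (elim exE conjE) (rule that)
qed

text \<open>The compact open subgroups cover \<open>G\<close>; finitely many of them cover
  \<open>B\<close>, and directedness puts these into a single one.\<close>

lemma lc_group_compact_subset:
  assumes lc: "lc_group G T" and B: "compactin T B"
  obtains K where "compact_open_subgroup G T K" "B \<subseteq> K"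
proof -
  let ?\<U> = "{K. compact_open_subgroup G T K}"
  have top: "topspace T = carrier G" using lc_groupD(1)[OF lc] unfolding topological_group_def by blast
  have "B \<subseteq> \<Union>?\<U>"
  proof
    fix g assume "g \<in> B"
    hence "g \<in> carrier G" using compactin_subset_topspace[OF B] top by blast
    from lc_groupD(2)[OF lc this] show "g \<in> \<Union>?\<U>" by blast
  qed
  moreover have "\<And>U. U \<in> ?\<U> \<Longrightarrow> openin T U" using compact_open_subgroupD(3) by blast
  ultimately obtain \<F> where F: "finite \<F>" "\<F> \<subseteq> ?\<U>" "B \<subseteq> \<Union>\<F>"
    using compactinD[OF B, of ?\<U>] by metis
  have "\<And>K. K \<in> \<F> \<Longrightarrow> compact_open_subgroup G T K" using F(2) by blast
  then obtain M where M: "compact_open_subgroup G T M" "\<Union>\<F> \<subseteq> M"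
    by (rule lc_group_finite_Union[OF lc F(1)])
  show thesis using that[OF M(1) order_trans[OF F(3) M(2)]] .
qed

lemma compact_open_subgroup_fixing:
  assumes lc: "lc_group G T" and \<pi>: "smooth_rep G T \<pi>" and X: "finite X" "X \<subseteq> vspace \<pi>"
  obtains N where "compact_open_subgroup G T N" "\<And>n x. n \<in> N \<Longrightarrow> x \<in> X \<Longrightarrow> action \<pi> n x = x"
proof -
  note G = lc_groupD(1)[OF lc]
  \<comment> \<open>The empty set serves only to produce some compact open subgroup. Inside it every
    open subgroup is automatically compact.\<close>
  obtain K where K: "compact_open_subgroup G T K" using lc_group_compact_subset[OF lc compactin_empty] .
  note K' = compact_open_subgroupD[OF K]
  interpret compact_representation "G\<lparr>carrier := K\<rparr>" "subtopology T K" \<pi>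
    using compact_representation_subgroup[OF G K'(1,2) \<pi>] .
  obtain N where N: "open_subgroup (G\<lparr>carrier := K\<rparr>) (subtopology T K) N"
    "\<And>n x. n \<in> N \<Longrightarrow> x \<in> X \<Longrightarrow> action \<pi> n x = x"
    using open_subgroup_fixing[OF X] by blast
  have "open_subgroup G T N"
    using open_subgroup_of_open_subgroup[OF topological_group_group[OF G] K'(1,3) N(1)] .
  moreover have "compactin T N" using compactin_open_subgroup[OF N(1)] by (simp add: compactin_subtopology)
  ultimately have "compact_open_subgroup G T N" unfolding compact_open_subgroup_def open_subgroup_def by blast
  thus thesis using that N(2) by blast
qed

text \<open>With \<open>E\<close> the projection onto the \<open>N\<close>-invariants \<open>P\<close>, the operators \<open>E \<pi>(k)\<close> on \<open>P\<close> for
  \<open>k \<in> K\<close> span a subspace of the finite-dimensional space of endomorphisms of \<open>P\<close>. As \<open>K\<close> grows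
  these subspaces become stationary, and for \<open>k\<close> ranging over all of \<open>G\<close> they act transitively on the
  nonzero vectors by irreducibility.\<close>

lemma invariants_cyclic_over_subgroup:
  fixes \<pi> :: "('g, 'v::complex_vector) crep"
  assumes lc: "lc_group G T" and \<pi>: "irreducible_smooth G T \<pi>" and N: "compact_open_subgroup G T N"
    and fd: "finite_dimensional (fixed_vectors N \<pi>)" and K1: "compact_open_subgroup G T K1"
  obtains K where "compact_open_subgroup G T K" "K1 \<subseteq> K" "N \<subseteq> K"
    "\<And>x. x \<in> fixed_vectors N \<pi> \<Longrightarrow> x \<noteq> 0 \<Longrightarrow>
      fixed_vectors N \<pi> \<subseteq> cvs.span ((\<lambda>k. action \<pi> k x) ` K)"
proof -
  note G = lc_groupD(1)[OF lc] and N' = compact_open_subgroupD[OF N] and \<pi>' = irreducible_smoothD[OF \<pi>]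
  interpret group_representation G \<pi>
    using topological_group_group[OF G] \<pi>'(3)
    by (simp add: group_representation_def group_representation_axioms_def)
  define P where "P = fixed_vectors N \<pi>"
  have PV: "P \<subseteq> vspace \<pi>" unfolding P_def fixed_vectors_def by blast
  obtain B where B: "finite B" "cvs.independent B" "cvs.span B = P"
    using finite_dimensional_basis[OF fd] unfolding P_def .
  have BP: "B \<subseteq> P" using B(3) cvs.span_superset by blast
  obtain E where E: "linear_map_on (vspace \<pi>) (vspace \<pi>) E"
    "\<And>v. v \<in> vspace \<pi> \<Longrightarrow> E v \<in> fixed_vectors N \<pi>"
    "\<And>v. v \<in> fixed_vectors N \<pi> \<Longrightarrow> E v = v"
    "\<And>h v. h \<in> N \<Longrightarrow> v \<in> vspace \<pi> \<Longrightarrow> E (action \<pi> h v) = E v"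
    "\<And>v. v \<in> vspace \<pi> \<Longrightarrow> E v \<in> cvs.span ((\<lambda>h. action \<pi> h v) ` N)"
    by (rule subgroup_invariant_projection[OF G N'(1,2) \<pi>'(1)]) (rule that)
  \<comment> \<open>The compression of \<open>\<pi>(g)\<close> to \<open>P\<close>, extended by 0,
    so that these operators are vectors in a function space and spans of them make sense.\<close>
  define op where "op = (\<lambda>g x. if x \<in> P then E (action \<pi> g x) else 0)"
  \<comment> \<open>Matrix units of the endomorphisms of \<open>P\<close> for the basis
    \<open>B\<close>; together they span a finite-dimensional space containing every
    \<open>op g\<close>.\<close>
  define unit :: "'v \<times> 'v \<Rightarrow> 'v \<Rightarrow> 'v" where "unit = (\<lambda>(b, b') x. if x \<in> P then cvs.representation B x b *\<^sub>C b' else 0)"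
  \<comment> \<open>Requiring \<open>N \<subseteq> K\<close> ensures that applying \<open>E\<close>
    to \<open>\<pi>(k) x\<close> does not leave the span of the \<open>K\<close>-orbit of
    \<open>x\<close>.\<close>
  define \<K> where "\<K> = {K. compact_open_subgroup G T K \<and> K1 \<union> N \<subseteq> K}"
  have op_span: "op g \<in> cvs.span (unit ` (B \<times> B))" if g: "g \<in> carrier G" for g
  proof -
    have lin: "linear_map_on P P (\<lambda>x. E (action \<pi> g x))"
      using linear_map_onD[OF E(1)] linear_map_onD[OF linear_action[OF g]] E(2) PV
      unfolding linear_map_on_def P_def by (auto simp: subset_iff)
    have "op g = (\<Sum>b\<in>B. \<Sum>b'\<in>B. cvs.representation B (E (action \<pi> g b)) b' *\<^sub>C unit (b, b'))"
      (is "_ = ?S")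
    proof
      fix x
      show "op g x = ?S x"
      proof (cases "x \<in> P")
        case True
        have "?S x = (\<Sum>b\<in>B. cvs.representation B x b *\<^sub>C
            (\<Sum>b'\<in>B. cvs.representation B (E (action \<pi> g b)) b' *\<^sub>C b'))"
          using True by (simp add: sum_fun_apply unit_def fun_scaleC_def cvs.scale_sum_right
              scaleC_scaleC mult.commute)
        also have "\<dots> = (\<Sum>b\<in>B. cvs.representation B x b *\<^sub>C E (action \<pi> g b))"
          using sum_representation[OF B] linear_map_onD(1)[OF lin] BP by (intro sum.cong) auto
        also have "\<dots> = E (action \<pi> g x)" using sum_representation_linear[OF B lin True] .
        finally show ?thesis using True by (simp add: op_def)
      qed (simp add: op_def sum_fun_apply unit_def fun_scaleC_def)
    qed
    moreover have "?S \<in> cvs.span (unit ` (B \<times> B))"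
      by (intro cvs.span_sum cvs.span_scale) (rule cvs.span_base, blast)
    ultimately show ?thesis by (simp only:)
  qed
  have KG: "K \<subseteq> carrier G" if "K \<in> \<K>" for K
    using that compact_open_subgroupD(1) subgroup.subset unfolding \<K>_def by blast
  have dir: "\<exists>M\<in>\<K>. K \<union> L \<subseteq> M" if "K \<in> \<K>" "compact_open_subgroup G T L" for K L
    using lc_groupD(3)[OF lc, of K L] that unfolding \<K>_def by blast
  have "\<exists>K0\<in>\<K>. \<forall>K\<in>\<K>. op ` K \<subseteq> cvs.span (op ` K0)"
  proof (rule directed_span_stabilizes)
    show "finite (unit ` (B \<times> B))" using B(1) by simp
    show "\<K> \<noteq> {}" using lc_groupD(3)[OF lc K1 N] unfolding \<K>_def by blast
    show "op ` K \<subseteq> cvs.span (unit ` (B \<times> B))" if "K \<in> \<K>" for K using op_span KG[OF that] by blast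
    show "\<exists>M\<in>\<K>. op ` K \<union> op ` L \<subseteq> op ` M" if KL: "K \<in> \<K>" "L \<in> \<K>" for K L
    proof -
      have "compact_open_subgroup G T L" using KL(2) unfolding \<K>_def by blast
      then obtain M where "M \<in> \<K>" "K \<union> L \<subseteq> M" using dir[OF KL(1)] by blast
      thus ?thesis by (intro bexI[of _ M]) auto
    qed
  qed
  then obtain K where K: "K \<in> \<K>" "\<And>L. L \<in> \<K> \<Longrightarrow> op ` L \<subseteq> cvs.span (op ` K)" by blast
  have sK: "subgroup K G" using K(1) compact_open_subgroupD(1) unfolding \<K>_def by blast
  have all: "op g \<in> cvs.span (op ` K)" if g: "g \<in> carrier G" for g
  proof -
    obtain L where L: "compact_open_subgroup G T L" "g \<in> L" using lc_groupD(2)[OF lc g] by blast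
    obtain M where M: "M \<in> \<K>" "K \<union> L \<subseteq> M" using dir[OF K(1) L(1)] by blast
    have "op g \<in> op ` M" using M(2) L(2) by blast
    thus ?thesis using K(2)[OF M(1)] by blast
  qed
  have main: "P \<subseteq> cvs.span ((\<lambda>k. action \<pi> k x) ` K)" if x: "x \<in> P" "x \<noteq> 0" for x
  proof -
    have xV: "x \<in> vspace \<pi>" using x PV by blast
    let ?O = "(\<lambda>k. action \<pi> k x) ` K"
    \<comment> \<open>Evaluation at \<open>x\<close> turns the statement about operators into one
      about vectors: \<open>E (\<pi>(k) x)\<close> is a combination of vectors
      \<open>\<pi>(h) \<pi>(k) x\<close> with \<open>h\<close> in \<open>N\<close>, and
      \<open>h \<otimes> k\<close> lies in \<open>K\<close>.\<close>
    have eval: "\<phi> x \<in> cvs.span ?O" if "\<phi> \<in> cvs.span (op ` K)" for \<phi>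
    proof -
      have "cvs.span (op ` K) \<subseteq> {\<phi>. \<phi> x \<in> cvs.span ?O}"
      proof (rule cvs.span_minimal)
        show "cvs.subspace {\<phi>. \<phi> x \<in> cvs.span ?O}"
          by (auto simp: cvs.subspace_def fun_scaleC_def cvs.span_zero cvs.span_add cvs.span_scale)
        show "op ` K \<subseteq> {\<phi>. \<phi> x \<in> cvs.span ?O}"
        proof
          fix \<phi> assume "\<phi> \<in> op ` K"
          then obtain k where k: "k \<in> K" "\<phi> = op k" by blast
          have kG: "k \<in> carrier G" using k KG[OF K(1)] by blast
          have "(\<lambda>h. action \<pi> h (action \<pi> k x)) ` N \<subseteq> ?O"
          proof
            fix y assume "y \<in> (\<lambda>h. action \<pi> h (action \<pi> k x)) ` N"
            then obtain h where h: "h \<in> N" "y = action \<pi> h (action \<pi> k x)" by blast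
            have hK: "h \<in> K" using h(1) K(1) unfolding \<K>_def by blast
            have "y = action \<pi> (h \<otimes>\<^bsub>G\<^esub> k) x"
              using h hK kG KG[OF K(1)] xV action_mult[of h k x] by auto
            thus "y \<in> ?O" using subgroup.m_closed[OF sK hK k(1)] by blast
          qed
          hence "E (action \<pi> k x) \<in> cvs.span ?O"
            using E(5)[OF action_mem[OF kG xV]] cvs.span_mono by blast
          thus "\<phi> \<in> {\<phi>. \<phi> x \<in> cvs.span ?O}" using k x by (simp add: op_def)
        qed
      qed
      thus ?thesis using that by blast
    qed
    \<comment> \<open>\<open>Q\<close> contains the whole \<open>G\<close>-orbit of
      \<open>x\<close>, since each \<open>op g\<close> is a combination of operators from
      \<open>K\<close>. By irreducibility that orbit spans the space, so \<open>Q\<close> is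
      everything; on \<open>P\<close>, where \<open>E\<close> is the identity, this is the
      claim.\<close>
    define Q where "Q = {y \<in> vspace \<pi>. E y \<in> cvs.span ?O}"
    have sQ: "cvs.subspace Q"
      unfolding Q_def using linear_map_on_subspace_vimage[OF E(1) subspace_vspace cvs.subspace_span] .
    let ?Y = "cvs.span ((\<lambda>g. action \<pi> g x) ` carrier G)"
    have orb: "(\<lambda>g. action \<pi> g x) ` carrier G \<subseteq> Q"
    proof
      fix y assume "y \<in> (\<lambda>g. action \<pi> g x) ` carrier G"
      then obtain g where g: "g \<in> carrier G" "y = action \<pi> g x" by blast
      have "op g x \<in> cvs.span ?O" using eval[OF all[OF g(1)]] .
      thus "y \<in> Q" using g action_mem[OF g(1) xV] x(1) unfolding Q_def op_def by simp
    qed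
    have "?Y \<subseteq> Q" by (rule cvs.span_minimal[OF orb sQ])
    moreover have "?Y = vspace \<pi>"
    proof -
      have sY: "cvs.subspace ?Y" by (rule cvs.subspace_span)
      have YV: "?Y \<subseteq> vspace \<pi>"
        using xV action_mem by (intro cvs.span_minimal[OF _ subspace_vspace]) blast
      have "action \<pi> h ` ?Y \<subseteq> ?Y" if h: "h \<in> carrier G" for h
      proof -
        have "?Y \<subseteq> {v \<in> vspace \<pi>. action \<pi> h v \<in> ?Y}"
        proof (rule cvs.span_minimal[OF _ linear_map_on_subspace_vimage[OF linear_action[OF h] subspace_vspace sY]])
          show "(\<lambda>g. action \<pi> g x) ` carrier G \<subseteq> {v \<in> vspace \<pi>. action \<pi> h v \<in> ?Y}"
          proof
            fix y assume "y \<in> (\<lambda>g. action \<pi> g x) ` carrier G"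
            then obtain g where g: "g \<in> carrier G" "y = action \<pi> g x" by blast
            have "action \<pi> h y = action \<pi> (h \<otimes>\<^bsub>G\<^esub> g) x" using action_mult h g xV by simp
            hence "action \<pi> h y \<in> ?Y" using g h by (auto intro!: cvs.span_base)
            thus "y \<in> {v \<in> vspace \<pi>. action \<pi> h v \<in> ?Y}" using g xV action_mem by simp
          qed
        qed
        thus ?thesis by blast
      qed
      hence "?Y = {0} \<or> ?Y = vspace \<pi>" using \<pi>'(2) sY YV unfolding irreducible_rep_def by blast
      moreover have "x \<in> ?Y"
        using action_one[OF xV] one_closed by (intro cvs.span_base) (metis imageI)
      ultimately show ?thesis using x(2) by blast
    qed
    ultimately have VQ: "vspace \<pi> \<subseteq> Q" by simp
    show ?thesis
    proof
      fix y assume y: "y \<in> P"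
      hence "y \<in> Q" using PV VQ by blast
      thus "y \<in> cvs.span ?O" using E(3)[of y] y unfolding Q_def P_def by simp
    qed
  qed
  show thesis
    by (rule that[of K]) (use K(1) main in \<open>auto simp: \<K>_def P_def\<close>)
qed

text \<open>An invariant subspace \<open>X\<close> of \<open>Y\<close> containing a nonzero
  \<open>N\<close>-invariant vector contains all of \<open>fixed_vectors N \<pi>\<close> by
  \<open>cyc\<close>, hence the generators of \<open>Y\<close>. If it contains none, the equivariant
  projection onto \<open>X\<close> must kill these generators, and so \<open>X\<close> is 0.\<close>

lemma (in compact_representation) irreducible_generated_by_invariants:
  assumes N: "N \<subseteq> carrier G" and B: "finite B" "cvs.span B = fixed_vectors N \<pi>"
    and ne: "fixed_vectors N \<pi> \<noteq> {0}"
    and cyc: "\<And>x. x \<in> fixed_vectors N \<pi> \<Longrightarrow> x \<noteq> 0 \<Longrightarrow>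
      fixed_vectors N \<pi> \<subseteq> cvs.span ((\<lambda>k. action \<pi> k x) ` carrier G)"
  defines "Y \<equiv> cvs.span (\<Union>b\<in>B. (\<lambda>g. action \<pi> g b) ` carrier G)"
  shows "irreducible_smooth G T (\<pi>\<lparr>vspace := Y\<rparr>)"
proof -
  let ?P = "fixed_vectors N \<pi>"
  have BP: "B \<subseteq> ?P" using B(2) cvs.span_superset by blast
  have BV: "B \<subseteq> vspace \<pi>" using BP unfolding fixed_vectors_def by blast
  have sY: "cvs.subspace Y" unfolding Y_def by (rule cvs.subspace_span)
  note Y = invariant_span_orbits[OF BV, folded Y_def]
  have PY: "?P \<subseteq> Y" using cvs.span_minimal[OF Y(2) sY] B(2) by simp
  have fdY: "finite_dimensional Y"
    unfolding finite_dimensional_def Y_def using finite_orbit B(1) BV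
    by (intro exI conjI) (rule finite_UN_I, auto)
  have rY: "group_rep G (\<pi>\<lparr>vspace := Y\<rparr>)" using subrepresentation[OF sY Y(1,3)] .
  have sub_eq: "X = Y"
    if X: "cvs.subspace X" "X \<subseteq> Y" "\<And>g. g \<in> carrier G \<Longrightarrow> action \<pi> g ` X \<subseteq> X" and "X \<noteq> {0}" for X
  proof (cases "\<exists>x\<in>X. x \<in> ?P \<and> x \<noteq> 0")
    case True
    then obtain x where x: "x \<in> X" "x \<in> ?P" "x \<noteq> 0" by blast
    have "(\<lambda>k. action \<pi> k x) ` carrier G \<subseteq> X" using X(3) x(1) by blast
    hence "?P \<subseteq> X" using cyc[OF x(2,3)] cvs.span_minimal[OF _ X(1)] by blast
    hence "(\<Union>b\<in>B. (\<lambda>g. action \<pi> g b) ` carrier G) \<subseteq> X" using BP X(3) by blast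
    hence "Y \<subseteq> X" unfolding Y_def using cvs.span_minimal[OF _ X(1)] by blast
    thus ?thesis using X(2) by blast
  next
    case False
    have XV: "X \<subseteq> vspace \<pi>" using X(2) Y(1) by blast
    obtain p where p: "p \<in> Hom_rep (carrier G) \<pi> (\<pi>\<lparr>vspace := X\<rparr>)" "\<And>y. y \<in> X \<Longrightarrow> p y = y"
      using equivariant_projection[OF X(1) XV X(3) finite_dimensional_subspace[OF fdY X(1,2)]] by blast
    have p_lin: "linear_map_on (vspace \<pi>) X p"
      and p_eq: "\<And>g v. g \<in> carrier G \<Longrightarrow> v \<in> vspace \<pi> \<Longrightarrow> p (action \<pi> g v) = action \<pi> g (p v)"
      using p(1) unfolding Hom_rep_def by auto
    \<comment> \<open>Equivariance makes \<open>p b\<close> fixed by \<open>N\<close>, and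
      \<open>X\<close> has no such vector except 0. Then \<open>p\<close> vanishes on
      \<open>Y\<close>, although it is the identity on \<open>X\<close>.\<close>
    have pb: "p b = 0" if b: "b \<in> B" for b
    proof -
      have bV: "b \<in> vspace \<pi>" using b BV by blast
      have "action \<pi> n (p b) = p b" if n: "n \<in> N" for n
      proof -
        have "action \<pi> n b = b" using b BP n unfolding fixed_vectors_def by blast
        thus ?thesis using p_eq[of n b] n N bV by auto
      qed
      moreover have "p b \<in> X" using linear_map_onD(1)[OF p_lin bV] .
      ultimately have "p b \<in> ?P" using XV unfolding fixed_vectors_def by blast
      thus ?thesis using False \<open>p b \<in> X\<close> by blast
    qed
    have "Y \<subseteq> {v \<in> vspace \<pi>. p v \<in> {0}}"
      unfolding Y_def
    proof (rule cvs.span_minimal)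
      show "cvs.subspace {v \<in> vspace \<pi>. p v \<in> {0}}"
        using linear_map_on_subspace_vimage[OF p_lin subspace_vspace cvs.subspace_single_0] .
      show "(\<Union>b\<in>B. (\<lambda>g. action \<pi> g b) ` carrier G) \<subseteq> {v \<in> vspace \<pi>. p v \<in> {0}}"
        using BV action_mem action_zero pb by (auto simp: p_eq subset_iff)
    qed
    hence "p x = 0" if "x \<in> X" for x using X(2) that by blast
    hence "X \<subseteq> {0}" using p(2) by auto
    hence "X = {0}" using cvs.subspace_0[OF X(1)] by blast
    thus ?thesis using \<open>X \<noteq> {0}\<close> by blast
  qed
  have Y0: "Y \<noteq> {0}"
  proof
    assume "Y = {0}"
    hence "?P \<subseteq> {0}" using PY by simp
    thus False using ne cvs.subspace_0[OF subspace_fixed_vectors[OF N]] by blast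
  qed
  have "irreducible_rep G (\<pi>\<lparr>vspace := Y\<rparr>)"
    unfolding irreducible_rep_def
  proof (intro conjI allI impI rY)
    show "vspace (\<pi>\<lparr>vspace := Y\<rparr>) \<noteq> {0}" using Y0 by simp
    fix W assume "cvs.subspace W \<and> W \<subseteq> vspace (\<pi>\<lparr>vspace := Y\<rparr>) \<and>
      (\<forall>g\<in>carrier G. action (\<pi>\<lparr>vspace := Y\<rparr>) g ` W \<subseteq> W)"
    hence W: "cvs.subspace W" "W \<subseteq> Y" "\<And>g. g \<in> carrier G \<Longrightarrow> action \<pi> g ` W \<subseteq> W" by auto
    show "W = {0} \<or> W = vspace (\<pi>\<lparr>vspace := Y\<rparr>)" using sub_eq[OF W] by auto
  qed
  moreover have "smooth_rep G T (\<pi>\<lparr>vspace := Y\<rparr>)"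
    using rY smooth Y(1) unfolding smooth_rep_def by auto
  ultimately show ?thesis unfolding irreducible_smooth_def by blast
qed

lemma fell_open_contains_basic:
  assumes lc: "lc_group G T" and tame: "tame G T" and U: "fell_open G T U" and c: "c \<in> U"
  obtains K r where "compact_open_subgroup G T K" "r \<in> subgroup_classes G T K"
    "c \<in> fell_basic G T K r" "fell_basic G T K r \<subseteq> U"
proof -
  note G = lc_groupD(1)[OF lc]
  have c': "c \<in> irr_classes G T" using U c unfolding fell_open_def by blast
  obtain \<pi> where \<pi>: "\<pi> \<in> c" using irr_classes_nonempty[OF c'] .
  note irr = irr_classesD(1)[OF c' \<pi>] and \<pi>' = irreducible_smoothD[OF irr_classesD(1)[OF c' \<pi>]]
  obtain n v \<xi> B \<epsilon> where v: "\<forall>j\<in>{1..n}. v j \<in> vspace \<pi> \<and> \<xi> j \<in> smooth_dual G T \<pi>"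
    and B: "compactin T B" and \<epsilon>: "0 < \<epsilon>" and nbhd: "fell_nbhd G T \<pi> n v \<xi> B \<epsilon> \<subseteq> U"
    using fell_openE[OF U c \<pi>] .
  have sub: "cvs.subspace (vspace \<pi>)" using \<pi>'(3) unfolding group_rep_def by blast
  \<comment> \<open>Added to the \<open>v j\<close> so that the \<open>N\<close>-invariants are
    nonzero even if \<open>n = 0\<close> or all \<open>v j\<close> vanish.\<close>
  obtain v0 where v0: "v0 \<in> vspace \<pi>" "v0 \<noteq> 0"
    using \<pi>'(2) cvs.subspace_0[OF sub] unfolding irreducible_rep_def by blast
  obtain N where N: "compact_open_subgroup G T N"
    "\<And>m x. m \<in> N \<Longrightarrow> x \<in> insert v0 (v ` {1..n}) \<Longrightarrow> action \<pi> m x = x"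
    using compact_open_subgroup_fixing[OF lc \<pi>'(1), of "insert v0 (v ` {1..n})"] v v0(1) by blast
  let ?P = "fixed_vectors N \<pi>"
  have P: "v0 \<in> ?P" "\<And>j. j \<in> {1..n} \<Longrightarrow> v j \<in> ?P"
    using N(2) v v0(1) unfolding fixed_vectors_def by auto
  have fd: "finite_dimensional ?P" using tame irr N(1) unfolding tame_def admissible_def by blast
  obtain K1 where K1: "compact_open_subgroup G T K1" "B \<subseteq> K1" using lc_group_compact_subset[OF lc B] .
  obtain K where K: "compact_open_subgroup G T K" "K1 \<subseteq> K" "N \<subseteq> K"
    and cyc: "\<And>x. x \<in> ?P \<Longrightarrow> x \<noteq> 0 \<Longrightarrow> ?P \<subseteq> cvs.span ((\<lambda>k. action \<pi> k x) ` K)"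
    using invariants_cyclic_over_subgroup[OF lc irr N(1) fd K1(1)] by blast
  let ?K = "G\<lparr>carrier := K\<rparr>" and ?T = "subtopology T K"
  note K' = compact_open_subgroupD[OF K(1)]
  interpret \<pi>: compact_representation ?K ?T \<pi>
    using compact_representation_subgroup[OF G K'(1,2) \<pi>'(1)] .
  obtain A where A: "finite A" "cvs.span A = ?P" using fd unfolding finite_dimensional_def by blast
  define Y where "Y = cvs.span (\<Union>b\<in>A. (\<lambda>g. action \<pi> g b) ` carrier ?K)"
  define \<rho> where "\<rho> = \<pi>\<lparr>vspace := Y\<rparr>"
  have AV: "A \<subseteq> vspace \<pi>" using A(2) cvs.span_superset unfolding fixed_vectors_def by blast
  note Y = \<pi>.invariant_span_orbits[OF AV, folded Y_def]
  have sY: "cvs.subspace Y" unfolding Y_def by (rule cvs.subspace_span)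
  have PY: "?P \<subseteq> Y" using cvs.span_minimal[OF Y(2) sY] A(2) by simp
  have \<rho>: "irreducible_smooth ?K ?T \<rho>"
    unfolding \<rho>_def Y_def
  proof (rule \<pi>.irreducible_generated_by_invariants[OF _ A])
    show "?P \<noteq> {0}" using P(1) v0(2) by blast
  qed (use K(3) cyc in auto)
  note \<rho>' = irreducible_smoothD[OF \<rho>]
  interpret \<rho>: compact_representation ?K ?T \<rho>
    using compact_group_subgroup[OF G K'(1,2)] \<rho>'(1)
    by (simp add: compact_representation_def compact_representation_axioms_def)
  have fdY: "finite_dimensional Y" using \<rho>.irreducible_finite_dimensional[OF \<rho>'(2)] by (simp add: \<rho>_def)
  define r where "r = irr_iso_rel ?K ?T `` {\<rho>}"
  have r: "r \<in> subgroup_classes G T K" "\<rho> \<in> r"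
    using irr_class_of[OF \<rho>] unfolding r_def subgroup_classes_def by auto
  have "c \<in> fell_basic G T K r"
  proof -
    obtain p where p: "p \<in> Hom_rep (carrier ?K) \<pi> \<rho>" "\<And>y. y \<in> Y \<Longrightarrow> p y = y"
      by (rule \<pi>.equivariant_projection[OF sY Y(1,3) fdY, folded \<rho>_def]) (assumption, rule that)
    have "p v0 \<noteq> 0" using p(2) P(1) PY v0(2) by auto
    hence "p \<noteq> 0" by auto
    hence "Hom_rep K \<pi> \<rho> \<noteq> {0}" using p(1) by auto
    hence "\<exists>\<pi>\<in>c. \<exists>\<rho>\<in>r. Hom_rep K \<pi> \<rho> \<noteq> {0}"
      by (rule bexI[OF bexI[OF _ r(2)] \<pi>])
    thus ?thesis using c' unfolding fell_basic_def by simp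
  qed
  moreover have "fell_basic G T K r \<subseteq> fell_nbhd G T \<pi> n v \<xi> B \<epsilon>"
  proof
    fix c2 assume c2: "c2 \<in> fell_basic G T K r"
    hence c2': "c2 \<in> irr_classes G T" unfolding fell_basic_def by blast
    obtain \<sigma> where \<sigma>: "\<sigma> \<in> c2" using irr_classes_nonempty[OF c2'] .
    note \<sigma>' = irreducible_smoothD[OF irr_classesD(1)[OF c2' \<sigma>]]
    interpret \<sigma>: compact_representation ?K ?T \<sigma>
      using compact_representation_subgroup[OF G K'(1,2) \<sigma>'(1)] .
    obtain f x where f: "f \<in> Hom_rep K \<sigma> \<rho>" "x \<in> vspace \<sigma>" "f x \<noteq> 0"
      using fell_basicD[OF c2 K'(1) r(1) \<sigma> r(2)] .
    have fK: "f \<in> Hom_rep (carrier ?K) \<sigma> \<rho>" using f(1) by simp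
    have surj: "f ` vspace \<sigma> = vspace \<rho>"
      by (rule nonzero_Hom_surj[of ?K \<sigma> \<rho> f x]) (fact \<sigma>.rep \<rho>'(2) fK f(2,3))+
    obtain s where s: "s \<in> Hom_rep (carrier ?K) \<rho> \<sigma>" "\<And>y. y \<in> vspace \<rho> \<Longrightarrow> f (s y) = y"
      using intertwining_section[OF \<sigma>.compact_representation_axioms \<rho>.compact_representation_axioms fK surj]
        fdY by (auto simp: \<rho>_def)
    have f_lin: "linear_map_on (vspace \<sigma>) Y f"
      and f_eq: "\<And>k y. k \<in> K \<Longrightarrow> y \<in> vspace \<sigma> \<Longrightarrow> f (action \<sigma> k y) = action \<pi> k (f y)"
      using f(1) unfolding Hom_rep_def \<rho>_def by auto
    have s_mem: "s y \<in> vspace \<sigma>" if "y \<in> Y" for y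
      using s(1) that unfolding Hom_rep_def linear_map_on_def \<rho>_def by auto
    \<comment> \<open>The partner of \<open>s (v j)\<close>: composing with \<open>f\<close> undoes
      the section, and for \<open>g\<close> in \<open>B\<close>, hence in \<open>K\<close>, both
      maps pass through the action. The error is exactly 0, whatever \<epsilon> is.\<close>
    define \<zeta> where "\<zeta> = (\<lambda>j y. if y \<in> vspace \<sigma> then \<xi> j (f y) else 0)"
    have \<zeta>: "\<zeta> j \<in> smooth_dual G T \<sigma>" if j: "j \<in> {1..n}" for j
    proof -
      have \<xi>j: "\<xi> j \<in> smooth_dual G T \<pi>" using v j by blast
      hence \<xi>_lin: "linear_map_on (vspace \<pi>) UNIV (\<xi> j)" unfolding smooth_dual_def by blast
      \<comment> \<open>Since \<open>f\<close> is equivariant only under \<open>K\<close>, the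
        subgroup fixing \<open>\<xi> j\<close> is taken inside \<open>K\<close>; it is open in
        \<open>G\<close> because \<open>K\<close> is.\<close>
      obtain L where L: "open_subgroup ?K ?T L"
        "\<And>m y. m \<in> L \<Longrightarrow> y \<in> vspace \<pi> \<Longrightarrow> \<xi> j (action \<pi> m y) = \<xi> j y"
        using smooth_functional_restrict[OF G K'(1) \<pi>'(3) \<xi>j] by blast
      have LK: "L \<subseteq> K" using L(1) subgroup.subset[of L ?K] unfolding open_subgroup_def by auto
      have fV: "f y \<in> vspace \<pi>" if "y \<in> vspace \<sigma>" for y
        using linear_map_onD(1)[OF f_lin that] Y(1) by blast
      show ?thesis
      proof (rule smooth_dualI[OF G \<sigma>'(3)])
        show "linear_map_on (vspace \<sigma>) UNIV (\<zeta> j)"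
          unfolding linear_map_on_def
        proof (intro conjI ballI allI)
          fix y z assume y: "y \<in> vspace \<sigma>" and z: "z \<in> vspace \<sigma>"
          show "\<zeta> j (y + z) = \<zeta> j y + \<zeta> j z"
            using y z cvs.subspace_add[OF \<sigma>.subspace_vspace y z] linear_map_onD(2)[OF f_lin y z]
              linear_map_onD(2)[OF \<xi>_lin fV[OF y] fV[OF z]] unfolding \<zeta>_def by simp
        next
          fix a y assume y: "y \<in> vspace \<sigma>"
          show "\<zeta> j (a *\<^sub>C y) = a *\<^sub>C \<zeta> j y"
            using y cvs.subspace_scale[OF \<sigma>.subspace_vspace y] linear_map_onD(3)[OF f_lin y]
              linear_map_onD(3)[OF \<xi>_lin fV[OF y]] unfolding \<zeta>_def by simp
        qed simp
        show "open_subgroup G T L"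
          using open_subgroup_of_open_subgroup[OF topological_group_group[OF G] K'(1,3) L(1)] .
        fix m y assume m: "m \<in> L" and y: "y \<in> vspace \<sigma>"
        have mK: "m \<in> K" using m LK by blast
        show "\<zeta> j (action \<sigma> m y) = \<zeta> j y"
          using \<sigma>.action_mem[of m y] mK y f_eq[OF mK y] L(2)[OF m fV[OF y]] unfolding \<zeta>_def by simp
      qed (simp add: \<zeta>_def)
    qed
    have coeff: "\<zeta> j (action \<sigma> g (s (v j))) = \<xi> j (action \<pi> g (v j))" if j: "j \<in> {1..n}" and g: "g \<in> B" for j g
    proof -
      have gK: "g \<in> K" using g K1(2) K(2) by blast
      have vY: "v j \<in> Y" using P(2)[OF j] PY by blast
      have "f (s (v j)) = v j" using s(2) vY by (simp add: \<rho>_def)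
      thus ?thesis
        using f_eq[OF gK s_mem[OF vY]] \<sigma>.action_mem[of g "s (v j)"] gK s_mem[OF vY]
        unfolding \<zeta>_def by simp
    qed
    have sv: "s (v j) \<in> vspace \<sigma>" if "j \<in> {1..n}" for j using s_mem P(2)[OF that] PY by blast
    show "c2 \<in> fell_nbhd G T \<pi> n v \<xi> B \<epsilon>"
      unfolding fell_nbhd_def mem_Collect_eq
      using c2' \<sigma> \<zeta> sv coeff \<epsilon>
      by (intro conjI bexI[of _ \<sigma>] exI[of _ "\<lambda>j. s (v j)"] exI[of _ \<zeta>]) auto
  qed
  ultimately show thesis using that[OF K(1) r(1)] nbhd by blast
qed

theorem theorem1p4:
  fixes G :: "('g, 'b) monoid_scheme" and T :: "'g topology"
  assumes "lc_group G T" and "tame G T"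
  shows "(\<forall>K \<rho>. compact_open_subgroup G T K \<and> \<rho> \<in> subgroup_classes G T K \<longrightarrow>
            openin (fell_topology G T) (fell_basic G T K \<rho>)) \<and>
         (\<forall>U. openin (fell_topology G T) U \<longrightarrow>
            (\<exists>F. (\<forall>(K, \<rho>)\<in>F. compact_open_subgroup G T K \<and> \<rho> \<in> subgroup_classes G T K) \<and>
                 U = (\<Union>(K, \<rho>)\<in>F. fell_basic G T K \<rho>)))"
proof (intro conjI allI impI)
  fix K \<rho> assume "compact_open_subgroup G T K \<and> \<rho> \<in> subgroup_classes G T K"
  thus "openin (fell_topology G T) (fell_basic G T K \<rho>)"
    using fell_basic_open[OF lc_groupD(1)[OF assms(1)]] by (simp add: openin_fell_topology)
next
  fix U assume "openin (fell_topology G T) U"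
  hence U: "fell_open G T U" by (simp add: openin_fell_topology)
  define F where "F = {(K, \<rho>). compact_open_subgroup G T K \<and> \<rho> \<in> subgroup_classes G T K \<and>
    fell_basic G T K \<rho> \<subseteq> U}"
  have "U \<subseteq> (\<Union>(K, \<rho>)\<in>F. fell_basic G T K \<rho>)"
  proof
    fix c assume "c \<in> U"
    then obtain K r where "(K, r) \<in> F" "c \<in> fell_basic G T K r"
      using fell_open_contains_basic[OF assms U] unfolding F_def by blast
    thus "c \<in> (\<Union>(K, \<rho>)\<in>F. fell_basic G T K \<rho>)" by blast
  qed
  moreover have "(\<Union>(K, \<rho>)\<in>F. fell_basic G T K \<rho>) \<subseteq> U" unfolding F_def by blast
  ultimately show "\<exists>F. (\<forall>(K, \<rho>)\<in>F. compact_open_subgroup G T K \<and> \<rho> \<in> subgroup_classes G T K) \<and>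
      U = (\<Union>(K, \<rho>)\<in>F. fell_basic G T K \<rho>)"
    by (intro exI[of _ F]) (auto simp: F_def)
qed

end
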